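(* Let $U=\overline U_\zeta(\mathfrak{sl}_3)$ and let $\mathcal A\subseteq\mathcal P^2$ be the acyclicity locus, i.e. the set of $(\boldsymbol t,\boldsymbol s)\in\mathcal P^2$ for which $V(\boldsymbol t)\otimes V(\boldsymbol s)$ is not homogeneous cyclic. Then $$\mathcal A=\mathcal X_1^2\cup\mathcal X_2^2\cup\mathcal X_{12}^2\cup(\mathcal X_{12}\times\mathcal R_{1,2})\cup(\mathcal R_{1,2}\times\mathcal X_{12}).$$
   Context: Fix a primitive fourth root of unity $\zeta$; the base field is $\mathbb C$; $\lfloor x\rfloor=\frac{x-x^{-1}}{\zeta-\zeta^{-1}}$. $U=\overline U_\zeta(\mathfrak{sl}_3)$ is the algebra generated by $E_i,F_i,K_i^{\pm1}$ ($i=1,2$) with relations $K_1K_2=K_2K_1$, $K_iE_j=\zeta^{A_{ij}}E_jK_i$, $K_iF_j=\zeta^{-A_{ij}}F_jK_i$ ($A_{11}=A_{22}=2$, $A_{12}=A_{21}=-1$), $[E_i,F_j]=\delta_{ij}\lfloor K_i\rfloor$, $E_i^2=F_i^2=0$, $E_{12}^2=F_{12}^2=0$, where $E_{12}=-(E_1E_2+\zeta E_2E_1)$, $F_{12}=-(F_2F_1-\zeta F_1F_2)$. Hopf structure: $\Delta(E_i)=E_i\otimes K_i+1\otimes E_i$, $\Delta(F_i)=F_i\otimes1+K_i^{-1}\otimes F_i$, $\Delta(K_i)=K_i\otimes K_i$. $\mathcal P=(\mathbb C^\times)^2$ is the group of characters of $\langle K_1^{\pm1},K_2^{\pm1}\rangle$.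 $B\subset U$ is the subalgebra generated by $K_1^{\pm1},K_2^{\pm1},E_1,E_2$; for $\boldsymbol t=(t_1,t_2)\in\mathcal P$, $V(\boldsymbol t)=U\otimes_B\langle v_h\rangle$ where $K_iv_h=t_iv_h$, $E_iv_h=0$. $\Psi=\{0,1\}^3$, $\psi=(\psi_1\psi_{12}\psi_2)$, $F^\psi=F_1^{\psi_1}F_{12}^{\psi_{12}}F_2^{\psi_2}$, $E^\psi=E_1^{\psi_1}E_{12}^{\psi_{12}}E_2^{\psi_2}$. A weight vector is a simultaneous eigenvector of $K_1,K_2$. A homogeneous cyclic vector of a $U$-module $M$ is a weight vector $\tilde v\in M$ such that $M$ is spanned by $\{F^\psi E^{\psi'}\tilde v:\psi,\psi'\in\Psi\}$; $M$ is homogeneous cyclic if it has such a vector. $\mathcal X_1=\{\boldsymbol t\in\mathcal P:t_1^2=1\}$, $\mathcal X_2=\{\boldsymbol t:t_2^2=1\}$, $\mathcal X_{12}=\{\boldsymbol t:(t_1t_2)^2=-1\}$, and $\mathcal R_{1,2}=(\mathcal X_1\cap\mathcal X_2)\setminus\mathcal X_{12}$. For a set $S$, $S^2=S\times S$. *)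

theory Defs
  imports
    "HOL-Algebra.Algebra"
    "HOL-Algebra.Algebraic_Closure_Type"
    "HOL-Library.Poly_Mapping"
    "HOL-Library.Product_Plus"
    Complex_Main
begin

text \<open>The fourth root of unity \<open>\<zeta>\<close> is an explicit argument throughout.\<close>

definition primitive_root_of_unity :: "nat \<Rightarrow> complex \<Rightarrow> bool" where
  "primitive_root_of_unity n \<zeta> \<longleftrightarrow> \<zeta> ^ n = 1 \<and> (\<forall>k. 0 < k \<and> k < n \<longrightarrow> \<zeta> ^ k \<noteq> 1)"

abbreviation complex_ring :: "complex ring" where
  "complex_ring \<equiv> ring_of_type_algebra"


section \<open>Free algebra\<close>

datatype node = N1 | N2

datatype gen = GE node | GF node | GK node | GKinv node

datatype word = Word (letters: "gen list")

text \<open>Words form a monoid under concatenation, written additively so that the convolution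
  product of \<open>Poly_Mapping\<close> turns finitely supported functions on words into the free algebra.\<close>

instantiation word :: monoid_add
begin

definition zero_word :: word where
  "0 = Word []"

definition plus_word :: "word \<Rightarrow> word \<Rightarrow> word" where
  "v + w = Word (letters v @ letters w)"

instance
  by standard (simp_all add: zero_word_def plus_word_def)

end

type_synonym falg = "word \<Rightarrow>\<^sub>0 complex"

definition scal :: "complex \<Rightarrow> falg" where
  "scal c = Poly_Mapping.single 0 c"

definition gen :: "gen \<Rightarrow> falg" where
  "gen g = Poly_Mapping.single (Word [g]) 1"

abbreviation genE :: "node \<Rightarrow> falg" where "genE i \<equiv> gen (GE i)"
abbreviation genF :: "node \<Rightarrow> falg" where "genF i \<equiv> gen (GF i)"
abbreviation genK :: "node \<Rightarrow> falg" where "genK i \<equiv> gen (GK i)"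
abbreviation genKinv :: "node \<Rightarrow> falg" where "genKinv i \<equiv> gen (GKinv i)"

definition E12 :: "complex \<Rightarrow> falg" where
  "E12 \<zeta> = - (genE N1 * genE N2 + scal \<zeta> * genE N2 * genE N1)"

definition F12 :: "complex \<Rightarrow> falg" where
  "F12 \<zeta> = - (genF N2 * genF N1 - scal \<zeta> * genF N1 * genF N2)"


section \<open>The quantum group\<close>

definition cartan :: "node \<Rightarrow> node \<Rightarrow> int" where
  "cartan i j = (if i = j then 2 else - 1)"

definition bracket_K :: "complex \<Rightarrow> node \<Rightarrow> falg" where
  "bracket_K \<zeta> i = scal (1 / (\<zeta> - inverse \<zeta>)) * (genK i - genKinv i)"

text \<open>A relation \<open>a = b\<close> is represented by \<open>a - b\<close>.\<close>

definition U_relations :: "complex \<Rightarrow> falg set" where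
  "U_relations \<zeta> =
     {genK i * genKinv i - 1 | i. True} \<union> {genKinv i * genK i - 1 | i. True} \<union>
     {genK N1 * genK N2 - genK N2 * genK N1} \<union>
     {genK i * genE j - scal (\<zeta> powi cartan i j) * genE j * genK i | i j. True} \<union>
     {genK i * genF j - scal (\<zeta> powi (- cartan i j)) * genF j * genK i | i j. True} \<union>
     {genE i * genF j - genF j * genE i - (if i = j then bracket_K \<zeta> i else 0) | i j. True} \<union>
     {(genE i)\<^sup>2 | i. True} \<union> {(genF i)\<^sup>2 | i. True} \<union>
     {(E12 \<zeta>)\<^sup>2, (F12 \<zeta>)\<^sup>2}"

definition U_ideal :: "complex \<Rightarrow> falg set" where
  "U_ideal \<zeta> = genideal ring_of_type_algebra (U_relations \<zeta>)"

definition Uq :: "complex \<Rightarrow> falg set ring" where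
  "Uq \<zeta> = ring_of_type_algebra Quot U_ideal \<zeta>"

definition U_class :: "complex \<Rightarrow> falg \<Rightarrow> falg set" where
  "U_class \<zeta> x = U_ideal \<zeta> +>\<^bsub>ring_of_type_algebra\<^esub> x"

definition Uq_borel :: "complex \<Rightarrow> falg set ring" where
  "Uq_borel \<zeta> = (Uq \<zeta>)\<lparr>carrier := generate_ring (Uq \<zeta>)
     (U_class \<zeta> ` (range scal \<union> range genK \<union> range genKinv \<union> range genE))\<rparr>"

text \<open>The coproduct on the free algebra. Finitely supported functions on \<open>word \<times> word\<close> are the
  tensor square of the free algebra, with \<open>single (v, w) 1\<close> being \<open>v \<otimes> w\<close> and convolution being
  the usual multiplication of the tensor square; the empty word \<open>0\<close> is the unit. The value on
  \<open>K\<^sub>i\<^sup>-\<^sup>1\<close> is forced by multiplicativity.\<close>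

fun coproduct_gen :: "gen \<Rightarrow> (word \<times> word \<Rightarrow>\<^sub>0 complex)" where
  "coproduct_gen (GE i) =
     Poly_Mapping.single (Word [GE i], Word [GK i]) 1 + Poly_Mapping.single (0, Word [GE i]) 1"
| "coproduct_gen (GF i) =
     Poly_Mapping.single (Word [GF i], 0) 1 + Poly_Mapping.single (Word [GKinv i], Word [GF i]) 1"
| "coproduct_gen (GK i) = Poly_Mapping.single (Word [GK i], Word [GK i]) 1"
| "coproduct_gen (GKinv i) = Poly_Mapping.single (Word [GKinv i], Word [GKinv i]) 1"

definition coproduct :: "falg \<Rightarrow> (word \<times> word \<Rightarrow>\<^sub>0 complex)" where
  "coproduct x = (\<Sum>w\<in>Poly_Mapping.keys x.
     Poly_Mapping.single 0 (Poly_Mapping.lookup x w) * prod_list (map coproduct_gen (letters w)))"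


section \<open>Tensor products of modules\<close>

text \<open>\<open>M\<close> is a right \<open>R\<close>-module with action \<open>ract\<close> and \<open>N\<close> is a left \<open>R\<close>-module; \<open>R\<close> need not be
  commutative. The tensor product is the free abelian group on \<open>carrier M \<times> carrier N\<close> modulo
  biadditivity and balancedness. Its elements are cosets.\<close>

definition tensor_relations ::
    "('r, 'x) ring_scheme \<Rightarrow> ('m, 'y) ring_scheme \<Rightarrow> ('m \<Rightarrow> 'r \<Rightarrow> 'm) \<Rightarrow> ('r, 'n, 'z) module_scheme
      \<Rightarrow> ('m \<times> 'n \<Rightarrow>\<^sub>0 int) set" where
  "tensor_relations R M ract N =
     {frag_of (m \<oplus>\<^bsub>M\<^esub> m', n) - frag_of (m, n) - frag_of (m', n) | m m' n.
        m \<in> carrier M \<and> m' \<in> carrier M \<and> n \<in> carrier N} \<union>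
     {frag_of (m, n \<oplus>\<^bsub>N\<^esub> n') - frag_of (m, n) - frag_of (m, n') | m n n'.
        m \<in> carrier M \<and> n \<in> carrier N \<and> n' \<in> carrier N} \<union>
     {frag_of (ract m r, n) - frag_of (m, r \<odot>\<^bsub>N\<^esub> n) | m r n.
        m \<in> carrier M \<and> r \<in> carrier R \<and> n \<in> carrier N}"

definition tensor_subgroup ::
    "('r, 'x) ring_scheme \<Rightarrow> ('m, 'y) ring_scheme \<Rightarrow> ('m \<Rightarrow> 'r \<Rightarrow> 'm) \<Rightarrow> ('r, 'n, 'z) module_scheme
      \<Rightarrow> ('m \<times> 'n \<Rightarrow>\<^sub>0 int) set" where
  "tensor_subgroup R M ract N =
     generate (free_Abelian_group (carrier M \<times> carrier N)) (tensor_relations R M ract N)"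

definition tensor_class ::
    "('r, 'x) ring_scheme \<Rightarrow> ('m, 'y) ring_scheme \<Rightarrow> ('m \<Rightarrow> 'r \<Rightarrow> 'm) \<Rightarrow> ('r, 'n, 'z) module_scheme
      \<Rightarrow> ('m \<times> 'n \<Rightarrow>\<^sub>0 int) \<Rightarrow> ('m \<times> 'n \<Rightarrow>\<^sub>0 int) set" where
  "tensor_class R M ract N x =
     tensor_subgroup R M ract N #>\<^bsub>free_Abelian_group (carrier M \<times> carrier N)\<^esub> x"

text \<open>The tensor product with a left action of a further ring, given by its
  action \<open>act\<close> on cosets. The fields \<open>mult\<close> and \<open>one\<close> play no role in a module.\<close>

definition tensor_module ::
    "('r, 'x) ring_scheme \<Rightarrow> ('m, 'y) ring_scheme \<Rightarrow> ('m \<Rightarrow> 'r \<Rightarrow> 'm) \<Rightarrow> ('r, 'n, 'z) module_scheme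
      \<Rightarrow> ('a \<Rightarrow> ('m \<times> 'n \<Rightarrow>\<^sub>0 int) set \<Rightarrow> ('m \<times> 'n \<Rightarrow>\<^sub>0 int) set)
      \<Rightarrow> ('a, ('m \<times> 'n \<Rightarrow>\<^sub>0 int) set) module" where
  "tensor_module R M ract N act =
     (let T = free_Abelian_group (carrier M \<times> carrier N) Mod tensor_subgroup R M ract N
      in \<lparr>carrier = carrier T, monoid.mult = undefined, one = undefined,
          ring.zero = \<one>\<^bsub>T\<^esub>, add = (\<otimes>\<^bsub>T\<^esub>), module.smult = act\<rparr>)"


section \<open>Modules over the quantum group\<close>

type_synonym 'm U_module = "(falg set, 'm) module"

definition complex_vs :: "complex \<Rightarrow> 'm U_module \<Rightarrow> (complex, 'm) module" where
  "complex_vs \<zeta> M =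
     \<lparr>carrier = carrier M, monoid.mult = (\<otimes>\<^bsub>M\<^esub>), one = \<one>\<^bsub>M\<^esub>, ring.zero = \<zero>\<^bsub>M\<^esub>, add = (\<oplus>\<^bsub>M\<^esub>),
      module.smult = (\<lambda>c m. U_class \<zeta> (scal c) \<odot>\<^bsub>M\<^esub> m)\<rparr>"

definition complex_span :: "complex \<Rightarrow> 'm U_module \<Rightarrow> 'm set \<Rightarrow> 'm set" where
  "complex_span \<zeta> M S = \<Inter>{N. submodule N complex_ring (complex_vs \<zeta> M) \<and> S \<subseteq> N}"

text \<open>\<open>M \<otimes>\<^sub>\<complex> N\<close>: if \<open>\<Delta>(x) = \<Sum> c v \<otimes> w\<close> for a representative \<open>x\<close> of \<open>u\<close>, then \<open>u\<close> acts by
  \<open>m \<otimes> n \<mapsto> \<Sum> (c v) m \<otimes> w n\<close>. The result does not depend on the representatives \<open>x\<close>, \<open>y\<close>, so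
  that the union below is over one and the same coset.\<close>

definition U_tensor :: "complex \<Rightarrow> 'm U_module \<Rightarrow> 'n U_module \<Rightarrow> ('m \<times> 'n \<Rightarrow>\<^sub>0 int) set U_module" where
  "U_tensor \<zeta> M N =
     (let ract = (\<lambda>m c. U_class \<zeta> (scal c) \<odot>\<^bsub>M\<^esub> m); N\<^sub>0 = complex_vs \<zeta> N
      in tensor_module complex_ring M ract N\<^sub>0 (\<lambda>u T. \<Union>x\<in>u. \<Union>y\<in>T.
           tensor_class complex_ring M ract N\<^sub>0
             (frag_extend (\<lambda>(m, n). \<Sum>(v, w)\<in>Poly_Mapping.keys (coproduct x). frag_of
                (U_class \<zeta> (Poly_Mapping.single v (Poly_Mapping.lookup (coproduct x) (v, w)))
                   \<odot>\<^bsub>M\<^esub> m,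
                 U_class \<zeta> (Poly_Mapping.single w 1) \<odot>\<^bsub>N\<^esub> n)) y)))"

text \<open>Characters of \<open>\<langle>K\<^sub>1\<^sup>\<plusminus>\<^sup>1, K\<^sub>2\<^sup>\<plusminus>\<^sup>1\<rangle>\<close>, given by their values on \<open>K\<^sub>1\<close> and \<open>K\<^sub>2\<close>.\<close>

type_synonym torus_char = "complex \<times> complex"

definition \<P> :: "torus_char set" where
  "\<P> = {t. fst t \<noteq> 0 \<and> snd t \<noteq> 0}"

fun at_node :: "torus_char \<Rightarrow> node \<Rightarrow> complex" where
  "at_node t N1 = fst t"
| "at_node t N2 = snd t"

text \<open>\<open>B = Uq_borel \<zeta>\<close> acts on the line \<open>\<langle>v\<^sub>h\<rangle>\<close> by the unique algebra homomorphism \<open>B \<rightarrow> \<complex>\<close> with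
  \<open>K\<^sub>i \<mapsto> t\<^sub>i\<close> and \<open>E\<^sub>i \<mapsto> 0\<close>; the line is modelled as \<open>\<complex>\<close> with \<open>v\<^sub>h = 1\<close>.\<close>

definition borel_char :: "complex \<Rightarrow> torus_char \<Rightarrow> falg set \<Rightarrow> complex" where
  "borel_char \<zeta> t = (SOME \<chi>. \<chi> \<in> ring_hom (Uq_borel \<zeta>) complex_ring \<and>
     (\<forall>c. \<chi> (U_class \<zeta> (scal c)) = c) \<and>
     (\<forall>i. \<chi> (U_class \<zeta> (genK i)) = at_node t i \<and> \<chi> (U_class \<zeta> (genE i)) = 0))"

definition highest_line :: "complex \<Rightarrow> torus_char \<Rightarrow> (falg set, complex) module" where
  "highest_line \<zeta> t =
     \<lparr>carrier = UNIV, monoid.mult = (*), one = 1, ring.zero = 0, add = (+),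
      module.smult = (\<lambda>b z. borel_char \<zeta> t b * z)\<rparr>"

text \<open>\<open>V(t) = U \<otimes>\<^sub>B \<langle>v\<^sub>h\<rangle>\<close>, with \<open>U\<close> acting by left multiplication on the first factor.\<close>

definition verma :: "complex \<Rightarrow> torus_char \<Rightarrow> (falg set \<times> complex \<Rightarrow>\<^sub>0 int) set U_module" where
  "verma \<zeta> t =
     (let L = highest_line \<zeta> t; ract = (\<otimes>\<^bsub>Uq \<zeta>\<^esub>)
      in tensor_module (Uq_borel \<zeta>) (Uq \<zeta>) ract L
           (\<lambda>u T. \<Union>y\<in>T. tensor_class (Uq_borel \<zeta>) (Uq \<zeta>) ract L
              (frag_extend (\<lambda>(a, z). frag_of (u \<otimes>\<^bsub>Uq \<zeta>\<^esub> a, z)) y)))"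


section \<open>Homogeneous cyclic modules\<close>

definition weight_vector :: "complex \<Rightarrow> 'm U_module \<Rightarrow> 'm \<Rightarrow> bool" where
  "weight_vector \<zeta> M v \<longleftrightarrow> v \<in> carrier M \<and> v \<noteq> \<zero>\<^bsub>M\<^esub> \<and>
     (\<forall>i. \<exists>c. U_class \<zeta> (genK i) \<odot>\<^bsub>M\<^esub> v = U_class \<zeta> (scal c) \<odot>\<^bsub>M\<^esub> v)"

text \<open>Exponents \<open>(\<psi>\<^sub>1, \<psi>\<^sub>1\<^sub>2, \<psi>\<^sub>2)\<close>.\<close>

definition \<Psi> :: "(nat \<times> nat \<times> nat) set" where
  "\<Psi> = {0, 1} \<times> {0, 1} \<times> {0, 1}"

fun F_pow :: "complex \<Rightarrow> nat \<times> nat \<times> nat \<Rightarrow> falg" where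
  "F_pow \<zeta> (a, b, c) = genF N1 ^ a * F12 \<zeta> ^ b * genF N2 ^ c"

fun E_pow :: "complex \<Rightarrow> nat \<times> nat \<times> nat \<Rightarrow> falg" where
  "E_pow \<zeta> (a, b, c) = genE N1 ^ a * E12 \<zeta> ^ b * genE N2 ^ c"

definition homogeneous_cyclic_vector :: "complex \<Rightarrow> 'm U_module \<Rightarrow> 'm \<Rightarrow> bool" where
  "homogeneous_cyclic_vector \<zeta> M v \<longleftrightarrow> weight_vector \<zeta> M v \<and>
     complex_span \<zeta> M
       {U_class \<zeta> (F_pow \<zeta> \<psi> * E_pow \<zeta> \<psi>') \<odot>\<^bsub>M\<^esub> v | \<psi> \<psi>'. \<psi> \<in> \<Psi> \<and> \<psi>' \<in> \<Psi>} = carrier M"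

definition homogeneous_cyclic :: "complex \<Rightarrow> 'm U_module \<Rightarrow> bool" where
  "homogeneous_cyclic \<zeta> M \<longleftrightarrow> (\<exists>v. homogeneous_cyclic_vector \<zeta> M v)"

definition acyclicity_locus :: "complex \<Rightarrow> (torus_char \<times> torus_char) set" where
  "acyclicity_locus \<zeta> =
     {(t, s). t \<in> \<P> \<and> s \<in> \<P> \<and> \<not> homogeneous_cyclic \<zeta> (U_tensor \<zeta> (verma \<zeta> t) (verma \<zeta> s))}"

definition \<X>1 :: "torus_char set" where
  "\<X>1 = {t \<in> \<P>. (fst t)\<^sup>2 = 1}"

definition \<X>2 :: "torus_char set" where
  "\<X>2 = {t \<in> \<P>. (snd t)\<^sup>2 = 1}"

definition \<X>12 :: "torus_char set" where
  "\<X>12 = {t \<in> \<P>. (fst t * snd t)\<^sup>2 = - 1}"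

definition \<R>12 :: "torus_char set" where
  "\<R>12 = (\<X>1 \<inter> \<X>2) - \<X>12"

end

theory Submission
  imports Defs "HOL-Library.Function_Algebras"
begin

text \<open>
  As \<open>U\<^sup>-\<close> is the nil-Coxeter algebra of type \<open>B\<^sub>2\<close>, \<open>V(t)\<close> has a basis of eight words in \<open>F\<^sub>1, F\<^sub>2\<close>. The
  matrix entries of \<open>E\<^sub>i\<close> in this basis are, up to sign, \<open>sn\<^sub>i = \<lfloor>t\<^sub>i\<rfloor>\<close> and \<open>cs\<^sub>i = \<lfloor>\<zeta>t\<^sub>i\<rfloor>\<close>; these satisfy
  \<open>t\<^sub>i = cs\<^sub>i + \<zeta> sn\<^sub>i\<close>, so that \<open>\<X>\<^sub>i\<close> is given by \<open>sn\<^sub>i = 0\<close> and \<open>\<X>\<^sub>1\<^sub>2\<close> by \<open>cs\<^sub>1 cs\<^sub>2 = sn\<^sub>1 sn\<^sub>2\<close>.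

  By triangular decomposition a weight vector is homogeneous cyclic if and only if it generates the
  module. Outside the locus a generator is \<open>l \<otimes> v\<^sub>h\<close> or \<open>v\<^sub>h \<otimes> l\<close> with \<open>l\<close> the lowest weight vector, if
  \<open>V(t)\<close> or \<open>V(s)\<close> is irreducible, and otherwise a perturbation of one of these by a vector
  \<open>F\<^sub>jF\<^sub>iF\<^sub>jv\<^sub>h \<otimes> F\<^sub>iv\<^sub>h\<close> or \<open>F\<^sub>iv\<^sub>h \<otimes> F\<^sub>jF\<^sub>iF\<^sub>jv\<^sub>h\<close>.

  Conversely, comparing dimensions of weight spaces shows that a cyclic vector \<open>v\<close> has the middle
  degree \<open>(2, 2)\<close>. The extremal weight spaces are one-dimensional and are reached from \<open>v\<close> by a single
  monomial \<open>F\<^sup>\<psi> E\<^sup>\<psi>'\<close> each: \<open>F\<^sub>jF\<^sub>iF\<^sub>jE\<^sub>i\<close>, \<open>F\<^sub>1E\<^sub>2E\<^sub>1E\<^sub>2\<close> and \<open>E\<^sub>1E\<^sub>2E\<^sub>1E\<^sub>2\<close> up to scalars. The first vanishes on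
  the middle weight space if \<open>(t, s) \<in> \<X>\<^sub>i\<^sup>2\<close>, the second if \<open>(t, s) \<in> \<X>\<^sub>1\<^sub>2\<^sup>2\<close>, and the third if
  \<open>(t, s) \<in> \<X>\<^sub>1\<^sub>2 \<times> \<R>\<^sub>1\<^sub>,\<^sub>2\<close> or \<open>(t, s) \<in> \<R>\<^sub>1\<^sub>,\<^sub>2 \<times> \<X>\<^sub>1\<^sub>2\<close>.
\<close>


section \<open>Linear extension from a monoid to its algebra\<close>

text \<open>\<open>Uq\<close>, \<open>verma\<close> and \<open>U_tensor\<close> are quotients made
  of cosets, so no basis or dimension is known at the outset: the relations might collapse
  \<open>V(t)\<close>. The bound from below is an explicit representation on functions over eight
  labels, checked against the relations; the bound from above is a spanning set of ordered monomials
  modulo the left ideal annihilating v_h. Where they meet, \<open>V(t)\<close> becomes a function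
  space, and the rest is linear algebra in dimension 64. As \<zeta> has order four, the eigenvalues
  of K_1, K_2 see degrees only modulo 4, and a weight vector may mix degrees such as (0, 0) and (4,
  4). Degree (2, 2) is alone in its class because degrees lie between 0 and 4. Its dimension is ten,
  and ten products F^\<psi> E^\<psi>' preserve it, whereas at most six lead into it from any other
  class. The perturbation of a generator is needed because E_i annihilates the lowest weight vector
  l when \<open>sn\<^sub>i\<close> vanishes. Then F_j F_i F_j v_h cannot be reached from l by the
  E's, and the added term lets E_i produce it.\<close>

lemma poly_mapping_induct_single [case_names single add]:
  assumes single: "\<And>k c. P (Poly_Mapping.single k c)"
    and add: "\<And>x y. P x \<Longrightarrow> P y \<Longrightarrow> P (x + y)"
  shows "P (x :: 'a \<Rightarrow>\<^sub>0 'b::comm_monoid_add)"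
proof (induction x rule: update_induct)
  case const
  show ?case using single[of undefined 0] by simp
next
  case (update f a b)
  have "Poly_Mapping.update a b f = f + Poly_Mapping.single a b"
    using update
    by (intro poly_mapping_eqI) (auto simp: lookup_update lookup_add lookup_single when_def in_keys_iff)
  then show ?case using update single add by simp
qed

text \<open>A ring with a central copy of the complex numbers. The free algebra, its tensor square
  and the endomorphism rings are the instances, and \<open>lin\<close> is linear extension into each
  of them.\<close>

locale scalars =
  fixes sc :: "complex \<Rightarrow> 'r::ring_1"
  assumes sc_1 [simp]: "sc 1 = 1"
    and sc_add: "sc (a + b) = sc a + sc b"
    and sc_mult: "sc (a * b) = sc a * sc b"
    and sc_comm: "sc a * x = x * sc a"
begin

lemma sc_0 [simp]: "sc 0 = 0"
  using sc_add[of 0 0] by simp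

lemma sc_minus: "sc (- a) = - sc a"
  using sc_add[of "- a" a] by (simp add: eq_neg_iff_add_eq_0)

definition lin :: "('m \<Rightarrow> 'r) \<Rightarrow> ('m \<Rightarrow>\<^sub>0 complex) \<Rightarrow> 'r" where
  "lin h x = (\<Sum>m\<in>Poly_Mapping.keys x. sc (Poly_Mapping.lookup x m) * h m)"

lemma lin_superset:
  "finite A \<Longrightarrow> Poly_Mapping.keys x \<subseteq> A \<Longrightarrow> lin h x = (\<Sum>m\<in>A. sc (Poly_Mapping.lookup x m) * h m)"
  unfolding lin_def by (rule sum.mono_neutral_left) (auto simp: in_keys_iff)

lemma lin_single [simp]: "lin h (Poly_Mapping.single m c) = sc c * h m"
  by (simp add: lin_superset[of "{m}"])

lemma lin_0 [simp]: "lin h 0 = 0"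
  by (simp add: lin_def)

lemma lin_add: "lin h (x + y) = lin h x + lin h y"
  using keys_add[of x y]
  by (simp add: lin_superset[of "Poly_Mapping.keys x \<union> Poly_Mapping.keys y"] lookup_add sc_add
      ring_distribs sum.distrib)

lemma lin_minus: "lin h (- x) = - lin h x"
  using lin_add[of h "- x" x] by (simp add: eq_neg_iff_add_eq_0)

lemma lin_diff: "lin h (x - y) = lin h x - lin h y"
  using lin_add[of h x "- y"] by (simp add: lin_minus)

lemma lin_mult:
  fixes h :: "'m::monoid_add \<Rightarrow> 'r"
  assumes "\<And>m n. h (m + n) = h m * h n"
  shows "lin h (x * y) = lin h x * lin h y"
proof (induction x rule: poly_mapping_induct_single)
  case (single k c)
  show ?case
  proof (induction y rule: poly_mapping_induct_single)
    case (single l d)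
    show ?case
      by (simp add: mult_single assms sc_mult mult.assoc) (metis mult.assoc sc_comm)
  qed (simp_all add: lin_add ring_distribs)
qed (simp_all add: lin_add ring_distribs)

text \<open>Applied with \<open>H = rep2 g h\<close>, this reduces a statement on coproducts of
  arbitrary elements to one on words.\<close>

lemma lin_comp:
  fixes H :: "'s::ring_1 \<Rightarrow> 'r"
  assumes add: "\<And>x y. H (x + y) = H x + H y" and mult: "\<And>x y. H (x * y) = H x * H y"
    and "scalars sc'" and sc: "\<And>c. H (sc' c) = sc c"
  shows "H (scalars.lin sc' h x) = lin (\<lambda>m. H (h m)) x"
proof -
  interpret S: scalars sc' by fact
  show ?thesis
    by (induction x rule: poly_mapping_induct_single) (simp_all add: S.lin_add lin_add add mult sc)
qed

end

abbreviation word_value :: "(gen \<Rightarrow> 'r::monoid_mult) \<Rightarrow> word \<Rightarrow> 'r" where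
  "word_value g w \<equiv> prod_list (map g (letters w))"

lemma word_value_add [simp]: "word_value g (v + w) = word_value g v * word_value g w"
  by (simp add: plus_word_def)

lemma word_value_zero [simp]: "word_value g 0 = 1"
  by (simp add: zero_word_def)

lemma monoid_algebra_scalars:
  "scalars (Poly_Mapping.single 0 :: complex \<Rightarrow> ('m::monoid_add \<Rightarrow>\<^sub>0 complex))"
proof
  fix c :: complex and x :: "'m \<Rightarrow>\<^sub>0 complex"
  show "Poly_Mapping.single 0 c * x = x * Poly_Mapping.single 0 c"
    by (induction x rule: poly_mapping_induct_single) (simp_all add: mult_single ring_distribs mult.commute)
qed (simp_all add: single_add mult_single)

interpretation falg: scalars scal
  unfolding scal_def by (rule monoid_algebra_scalars)

interpretation falg2: scalars "Poly_Mapping.single (0 :: word \<times> word)"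
  by (rule monoid_algebra_scalars)

lemma coproduct_eq_lin: "coproduct = falg2.lin (word_value coproduct_gen)"
  by (simp add: fun_eq_iff coproduct_def falg2.lin_def)


section \<open>Linear endomorphisms\<close>

definition cscale :: "complex \<Rightarrow> ('b \<Rightarrow> complex) \<Rightarrow> 'b \<Rightarrow> complex" where
  "cscale c f = (\<lambda>b. c * f b)"

lemma cscale_apply [simp]: "cscale c f b = c * f b"
  by (simp add: cscale_def)

definition clinear :: "(('b \<Rightarrow> complex) \<Rightarrow> 'c \<Rightarrow> complex) \<Rightarrow> bool" where
  "clinear A \<longleftrightarrow> (\<forall>f g. A (f + g) = A f + A g) \<and> (\<forall>c f. A (cscale c f) = cscale c (A f))"

text \<open>With a type of their own, linear maps form an instance of \<open>ring_1\<close>: words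
  in generators become products, and the ring simplification rules apply to operators.\<close>

typedef 'b endo = "{A :: ('b \<Rightarrow> complex) \<Rightarrow> 'b \<Rightarrow> complex. clinear A}"
  morphisms app Endo
  by (rule exI[of _ id]) (simp add: clinear_def)

lemma app_Endo: "clinear A \<Longrightarrow> app (Endo A) = A"
  by (simp add: Endo_inverse)

lemma app_add: "app A (f + g) = app A f + app A g"
  and app_cscale: "app A (cscale c f) = cscale c (app A f)"
  using app[of A] by (simp_all add: clinear_def)

lemma app_zero [simp]: "app A 0 = 0"
  using app_add[of A 0 0] by simp

lemma app_minus: "app A (- f) = - app A f"
  using app_add[of A "- f" f] by (simp add: eq_neg_iff_add_eq_0)

lemma app_diff: "app A (f - g) = app A f - app A g"
  using app_add[of A f "- g"] by (simp add: app_minus)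

lemma app_sum: "app A (\<Sum>i\<in>I. f i) = (\<Sum>i\<in>I. app A (f i))"
  by (induction I rule: infinite_finite_induct) (simp_all only: sum.infinite sum.empty sum.insert app_add app_zero not_False_eq_True)

lemma endo_eqI: "(\<And>f. app A f = app B f) \<Longrightarrow> A = B"
  by (metis app_inject ext)

instantiation endo :: (type) ring_1
begin

definition "0 = Endo (\<lambda>f. 0)"
definition "1 = Endo (\<lambda>f. f)"
definition "A + B = Endo (\<lambda>f. app A f + app B f)"
definition "- A = Endo (\<lambda>f. - app A f)"
definition "(A :: 'a endo) - B = Endo (\<lambda>f. app A f - app B f)"
definition "A * B = Endo (\<lambda>f. app A (app B f))"

lemma app_endo [simp]:
  "app (0 :: 'a endo) f = 0"
  "app (1 :: 'a endo) f = f"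
  "app (A + B) f = app A f + app B f"
  "app (- A) f = - app A f"
  "app (A - B) f = app A f - app B f"
  "app (A * B) f = app A (app B f)"
  for A B :: "'a endo"
  unfolding zero_endo_def one_endo_def plus_endo_def uminus_endo_def minus_endo_def times_endo_def
  by (subst app_Endo; simp add: clinear_def app_add app_cscale fun_eq_iff algebra_simps)+

instance
proof
  show "(0 :: 'a endo) \<noteq> 1"
  proof
    assume "(0 :: 'a endo) = 1"
    then have "app 0 (\<lambda>_ :: 'a. 1) = app 1 (\<lambda>_. 1)" by simp
    then show False by (simp add: fun_eq_iff)
  qed
qed (auto intro!: endo_eqI simp: algebra_simps app_add)

end

definition sce :: "complex \<Rightarrow> 'b endo" where
  "sce c = Endo (cscale c)"

lemma app_sce [simp]: "app (sce c) f = cscale c f"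
  unfolding sce_def by (subst app_Endo) (simp_all add: clinear_def fun_eq_iff algebra_simps)

interpretation endo: scalars "sce :: complex \<Rightarrow> 'b endo"
  by standard (auto intro!: endo_eqI simp: app_cscale fun_eq_iff algebra_simps)

text \<open>\<open>lft A\<close> is A tensor 1 and \<open>rgt B\<close> is 1 tensor B, with
  functions on pairs in the role of the tensor product of two function spaces.\<close>

definition lft :: "'b endo \<Rightarrow> ('b \<times> 'c) endo" where
  "lft A = Endo (\<lambda>f (b, c). app A (\<lambda>b'. f (b', c)) b)"

definition rgt :: "'c endo \<Rightarrow> ('b \<times> 'c) endo" where
  "rgt B = Endo (\<lambda>f (b, c). app B (\<lambda>c'. f (b, c')) c)"

lemma app_add_lambda: "app A (\<lambda>x. f x + g x) = (\<lambda>b. app A f b + app A g b)"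
  using app_add[of A f g] by (simp add: plus_fun_def)

lemma app_mult_lambda: "app A (\<lambda>x. c * f x) = (\<lambda>b. c * app A f b)"
  using app_cscale[of A c f] by (simp add: cscale_def)

lemma app_lft [simp]: "app (lft A) f (b, c) = app A (\<lambda>b'. f (b', c)) b"
  unfolding lft_def
  by (subst app_Endo) (auto simp: clinear_def fun_eq_iff app_add_lambda app_mult_lambda)

lemma app_rgt [simp]: "app (rgt B) f (b, c) = app B (\<lambda>c'. f (b, c')) c"
  unfolding rgt_def
  by (subst app_Endo) (auto simp: clinear_def fun_eq_iff app_add_lambda app_mult_lambda)

lemma endo_prod_eqI:
  "(\<And>f b c. app A f (b, c) = app B f (b, c)) \<Longrightarrow> A = (B :: ('b \<times> 'c) endo)"
  by (rule endo_eqI) (simp add: fun_eq_iff)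

lemma lft_ring:
  "lft (A + B) = lft A + lft B" "lft (A * B) = lft A * lft B" "lft (sce k) = sce k"
  "lft 0 = 0" "lft 1 = 1" "lft (- A) = - lft A" "lft (A - B) = lft A - lft B"
  by (rule endo_prod_eqI, simp)+

lemma rgt_ring:
  "rgt (A + B) = rgt A + rgt B" "rgt (A * B) = rgt A * rgt B" "rgt (sce k) = sce k"
  "rgt 0 = 0" "rgt 1 = 1" "rgt (- A) = - rgt A" "rgt (A - B) = rgt A - rgt B"
  by (rule endo_prod_eqI, simp)+

definition unit_vec :: "'b \<Rightarrow> 'b \<Rightarrow> complex" where
  "unit_vec b = (\<lambda>b'. if b' = b then 1 else 0)"

lemma sum_fun_apply: "(\<Sum>i\<in>I. f i) x = (\<Sum>i\<in>I. f i x)"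
  by (induction I rule: infinite_finite_induct) simp_all

lemma unit_vec_expansion: "f = (\<Sum>b\<in>UNIV. cscale (f b) (unit_vec b))"
  for f :: "'b::finite \<Rightarrow> complex"
  by (simp add: fun_eq_iff sum_fun_apply unit_vec_def if_distrib cong: if_cong)

lemma app_expansion: "app A f b = (\<Sum>b'\<in>UNIV. f b' * app A (unit_vec b') b)"
  for f :: "'b::finite \<Rightarrow> complex"
proof -
  have "app A f b = app A (\<Sum>b\<in>UNIV. cscale (f b) (unit_vec b)) b"
    by (simp only: unit_vec_expansion[of f, symmetric])
  then show ?thesis by (simp only: app_sum app_cscale sum_fun_apply cscale_apply)
qed

text \<open>Over finite index types both operators are given by matrices, and the claim is an
  exchange of two finite sums.\<close>

lemma lft_rgt_commute: "rgt B * lft A = lft A * (rgt B :: ('b::finite \<times> 'c::finite) endo)"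
proof (rule endo_prod_eqI)
  fix f :: "'b \<times> 'c \<Rightarrow> complex" and b c
  have l: "app (lft A) f (b, c) = (\<Sum>b'\<in>UNIV. f (b', c) * app A (unit_vec b') b)"
    for f :: "'b \<times> 'c \<Rightarrow> complex" and b c
    by (simp only: app_lft) (rule app_expansion)
  have r: "app (rgt B) f (b, c) = (\<Sum>c'\<in>UNIV. f (b, c') * app B (unit_vec c') c)"
    for f :: "'b \<times> 'c \<Rightarrow> complex" and b c
    by (simp only: app_rgt) (rule app_expansion)
  show "app (rgt B * lft A) f (b, c) = app (lft A * rgt B) f (b, c)"
    unfolding app_endo l r sum_distrib_right by (subst sum.swap) (simp only: mult.assoc mult.commute[of "app A _ _"])
qed


section \<open>The defining ideal\<close>

lemma ring_of_type_algebra_ring: "ring (ring_of_type_algebra :: 'a::ring_1 ring)"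
proof -
  have "\<exists>y. x + y = 0" for x :: 'a
    by (rule exI[of _ "- x"]) simp
  then show ?thesis
    unfolding ring_of_type_algebra_def using add.right_inverse
    by unfold_locales (auto simp: algebra_simps Units_def)
qed

lemma ring_of_type_algebra_simps [simp]:
  "carrier ring_of_type_algebra = (UNIV :: 'a::ring_1 set)"
  "x \<otimes>\<^bsub>ring_of_type_algebra\<^esub> y = x * (y :: 'a)"
  "x \<oplus>\<^bsub>ring_of_type_algebra\<^esub> y = x + (y :: 'a)"
  "\<one>\<^bsub>ring_of_type_algebra\<^esub> = (1 :: 'a)"
  "\<zero>\<^bsub>ring_of_type_algebra\<^esub> = (0 :: 'a)"
  by (simp_all add: ring_of_type_algebra_def)

lemma a_inv_ring_of_type_algebra [simp]: "\<ominus>\<^bsub>ring_of_type_algebra\<^esub> x = - (x :: 'a::ring_1)"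
proof -
  interpret ring "ring_of_type_algebra :: 'a ring" by (rule ring_of_type_algebra_ring)
  show ?thesis using minus_equality[of "- x" x] by simp
qed

text \<open>Ideals restated in type class arithmetic, which spares the record operations of
  \<open>ring_of_type_algebra\<close>.\<close>

definition two_sided :: "'a::ring_1 set \<Rightarrow> bool" where
  "two_sided I \<longleftrightarrow> 0 \<in> I \<and> (\<forall>x\<in>I. \<forall>y\<in>I. x + y \<in> I) \<and> (\<forall>x\<in>I. \<forall>y. y * x \<in> I \<and> x * y \<in> I)"

lemma two_sided_minus: "two_sided I \<Longrightarrow> x \<in> I \<Longrightarrow> - x \<in> I"
  unfolding two_sided_def by (metis mult_minus1)

lemma two_sided_iff_ideal: "two_sided I \<longleftrightarrow> ideal I (ring_of_type_algebra :: 'a::ring_1 ring)"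
proof
  interpret ring "ring_of_type_algebra :: 'a ring" by (rule ring_of_type_algebra_ring)
  show "ideal I (ring_of_type_algebra :: 'a ring)" if "two_sided I"
  proof (rule idealI)
    show "subgroup I (add_monoid (ring_of_type_algebra :: 'a ring))"
      by (rule add.subgroupI)
         (use that two_sided_minus[OF that] in \<open>auto simp: two_sided_def\<close>)
  qed (use that in \<open>auto simp: two_sided_def ring_axioms\<close>)
  show "two_sided I" if "ideal I (ring_of_type_algebra :: 'a ring)"
  proof -
    interpret I: ideal I "ring_of_type_algebra :: 'a ring" by fact
    show ?thesis
      using I.a_closed I.zero_closed I.I_l_closed I.I_r_closed
      by (auto simp: two_sided_def)
  qed
qed

lemma two_sided_U_ideal: "two_sided (U_ideal \<zeta>)"
  unfolding two_sided_iff_ideal U_ideal_def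
  by (rule ring.genideal_ideal[OF ring_of_type_algebra_ring]) simp

lemma U_relations_subset: "U_relations \<zeta> \<subseteq> U_ideal \<zeta>"
  unfolding U_ideal_def by (rule ring.genideal_self[OF ring_of_type_algebra_ring]) simp

lemma U_ideal_minimal: "two_sided I \<Longrightarrow> U_relations \<zeta> \<subseteq> I \<Longrightarrow> U_ideal \<zeta> \<subseteq> I"
  unfolding U_ideal_def two_sided_iff_ideal
  by (rule ring.genideal_minimal[OF ring_of_type_algebra_ring])

lemma U_ideal_closed:
  "0 \<in> U_ideal \<zeta>"
  "x \<in> U_ideal \<zeta> \<Longrightarrow> y \<in> U_ideal \<zeta> \<Longrightarrow> x + y \<in> U_ideal \<zeta>"
  "x \<in> U_ideal \<zeta> \<Longrightarrow> y \<in> U_ideal \<zeta> \<Longrightarrow> x - y \<in> U_ideal \<zeta>"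
  "x \<in> U_ideal \<zeta> \<Longrightarrow> - x \<in> U_ideal \<zeta>"
  "x \<in> U_ideal \<zeta> \<Longrightarrow> z * x \<in> U_ideal \<zeta>"
  "x \<in> U_ideal \<zeta> \<Longrightarrow> x * z \<in> U_ideal \<zeta>"
proof -
  note two_sided_U_ideal[of \<zeta>]
  note * = this two_sided_minus[OF this]
  show "x \<in> U_ideal \<zeta> \<Longrightarrow> y \<in> U_ideal \<zeta> \<Longrightarrow> x - y \<in> U_ideal \<zeta>"
    using * unfolding two_sided_def by (metis add_uminus_conv_diff)
qed (use two_sided_U_ideal[of \<zeta>] two_sided_minus[of "U_ideal \<zeta>"] in \<open>auto simp: two_sided_def\<close>)

lemma U_class_eq: "U_class \<zeta> x = {y. y - x \<in> U_ideal \<zeta>}"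
proof -
  have "y \<in> (\<Union>h\<in>U_ideal \<zeta>. {h + x}) \<longleftrightarrow> y - x \<in> U_ideal \<zeta>" for y
    by (auto intro: bexI[of _ "y - x"])
  then show ?thesis
    by (simp add: U_class_def a_r_coset_def r_coset_def) blast
qed

lemma U_class_eq_iff: "U_class \<zeta> x = U_class \<zeta> y \<longleftrightarrow> x - y \<in> U_ideal \<zeta>"
proof
  assume "U_class \<zeta> x = U_class \<zeta> y"
  then have "x \<in> U_class \<zeta> y" by (metis U_class_eq U_ideal_closed(1) diff_self mem_Collect_eq)
  then show "x - y \<in> U_ideal \<zeta>" by (simp add: U_class_eq)
next
  assume *: "x - y \<in> U_ideal \<zeta>"
  have "z - x \<in> U_ideal \<zeta> \<longleftrightarrow> z - y \<in> U_ideal \<zeta>" for z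
    using U_ideal_closed(2)[OF _ *, of "z - x"] U_ideal_closed(3)[OF _ *, of "z - y"] by auto
  then show "U_class \<zeta> x = U_class \<zeta> y" by (simp add: U_class_eq)
qed

lemma ideal_U_ideal: "ideal (U_ideal \<zeta>) ring_of_type_algebra"
  using two_sided_U_ideal by (simp add: two_sided_iff_ideal)

lemma Uq_ring: "ring (Uq \<zeta>)"
  unfolding Uq_def by (rule ideal.quotient_is_ring[OF ideal_U_ideal])

lemma Uq_carrier: "carrier (Uq \<zeta>) = range (U_class \<zeta>)"
  by (auto simp: Uq_def FactRing_def U_class_def A_RCOSETS_def' a_r_coset_def)

lemma Uq_simps:
  "U_class \<zeta> x \<otimes>\<^bsub>Uq \<zeta>\<^esub> U_class \<zeta> y = U_class \<zeta> (x * y)"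
  "U_class \<zeta> x \<oplus>\<^bsub>Uq \<zeta>\<^esub> U_class \<zeta> y = U_class \<zeta> (x + y)"
  "\<one>\<^bsub>Uq \<zeta>\<^esub> = U_class \<zeta> 1"
  "\<zero>\<^bsub>Uq \<zeta>\<^esub> = U_class \<zeta> 0"
proof -
  interpret ideal "U_ideal \<zeta>" ring_of_type_algebra by (rule ideal_U_ideal)
  show "U_class \<zeta> x \<otimes>\<^bsub>Uq \<zeta>\<^esub> U_class \<zeta> y = U_class \<zeta> (x * y)"
    using rcoset_mult_add[of x y] by (simp add: Uq_def FactRing_def U_class_def)
  show "U_class \<zeta> x \<oplus>\<^bsub>Uq \<zeta>\<^esub> U_class \<zeta> y = U_class \<zeta> (x + y)"
    using a_rcos_sum[of x y] by (simp add: Uq_def FactRing_def U_class_def)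
  show "\<one>\<^bsub>Uq \<zeta>\<^esub> = U_class \<zeta> 1"
    by (simp add: Uq_def FactRing_def U_class_def)
  show "\<zero>\<^bsub>Uq \<zeta>\<^esub> = U_class \<zeta> 0"
    by (simp add: Uq_def FactRing_def U_class_eq)
qed

lemma Uq_minus: "\<ominus>\<^bsub>Uq \<zeta>\<^esub> U_class \<zeta> x = U_class \<zeta> (- x)"
proof -
  interpret ring "Uq \<zeta>" by (rule Uq_ring)
  show ?thesis
    by (rule minus_equality) (simp_all add: Uq_simps Uq_carrier)
qed


section \<open>A triangular spanning set\<close>

text \<open>Linear combinations of B modulo N. In the applications N is the defining ideal or a left
  ideal containing it; keeping it apart from B allows B to be finite.\<close>

inductive_set spn :: "falg set \<Rightarrow> falg set \<Rightarrow> falg set" for N B where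
  sub: "x \<in> N \<Longrightarrow> x \<in> spn N B"
| base: "x \<in> B \<Longrightarrow> x \<in> spn N B"
| add: "x \<in> spn N B \<Longrightarrow> y \<in> spn N B \<Longrightarrow> x + y \<in> spn N B"
| scal: "x \<in> spn N B \<Longrightarrow> scal c * x \<in> spn N B"

lemma spn_minus: "x \<in> spn N B \<Longrightarrow> - x \<in> spn N B"
  using spn.scal[of x N B "-1"] by (simp add: falg.sc_minus)

lemma spn_diff: "x \<in> spn N B \<Longrightarrow> y \<in> spn N B \<Longrightarrow> x - y \<in> spn N B"
  using spn.add[of x N B "- y"] spn_minus by simp

lemma spn_trans:
  assumes "x \<in> spn N B" "N \<subseteq> spn M C" "B \<subseteq> spn M C"
  shows "x \<in> spn M C"
  using assms(1) by induction (use assms(2,3) in \<open>auto intro: spn.add spn.scal\<close>)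

lemma spn_mult_left:
  assumes "x \<in> spn N B" "\<And>n. n \<in> N \<Longrightarrow> y * n \<in> spn N C" "\<And>b. b \<in> B \<Longrightarrow> y * b \<in> spn N C"
  shows "y * x \<in> spn N C"
  using assms(1)
proof induction
  case (scal x c)
  have "y * (scal c * x) = scal c * (y * x)"
    by (metis falg.sc_comm mult.assoc)
  then show ?case using spn.scal[OF scal.IH] by simp
qed (auto simp: assms ring_distribs intro: spn.add)

lemma spn_mult:
  assumes "x \<in> spn (U_ideal \<zeta>) B" "y \<in> spn (U_ideal \<zeta>) C"
  shows "x * y \<in> spn (U_ideal \<zeta>) {b * c | b c. b \<in> B \<and> c \<in> C}"
  using assms(1)
proof induction
  case (base b)
  show ?case
    by (rule spn_mult_left[OF assms(2)]) (use base in \<open>auto intro: spn.sub spn.base U_ideal_closed\<close>)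
next
  case (scal x c)
  then show ?case by (simp add: mult.assoc spn.scal)
qed (auto simp: ring_distribs intro: spn.add spn.sub U_ideal_closed)

text \<open>Extracts coefficients from the inductively defined span; the case \<open>scal\<close> is
  where N has to absorb multiplication from the left.\<close>

lemma spn_finite:
  assumes "x \<in> spn N B" "finite B" "\<And>x y. x \<in> N \<Longrightarrow> y \<in> N \<Longrightarrow> x + y \<in> N"
    "\<And>x y. x \<in> N \<Longrightarrow> y * x \<in> N" "0 \<in> N"
  shows "\<exists>a. x - (\<Sum>b\<in>B. scal (a b) * b) \<in> N"
  using assms(1)
proof induction
  case (sub x)
  then show ?case by (intro exI[of _ "\<lambda>_. 0"]) simp
next
  case (base x)
  have "(\<Sum>b\<in>B. scal (if b = x then 1 else 0) * b) = (\<Sum>b\<in>B. if b = x then b else 0)"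
    by (rule sum.cong) auto
  then have "x - (\<Sum>b\<in>B. scal (if b = x then 1 else 0) * b) = 0"
    using base assms(2) by simp
  then show ?case using assms(5) by (intro exI[of _ "\<lambda>b. if b = x then 1 else 0"]) simp
next
  case (add x y)
  then obtain a b where "x - (\<Sum>c\<in>B. scal (a c) * c) \<in> N" "y - (\<Sum>c\<in>B. scal (b c) * c) \<in> N"
    by blast
  then have "(x - (\<Sum>c\<in>B. scal (a c) * c)) + (y - (\<Sum>c\<in>B. scal (b c) * c)) \<in> N"
    by (rule assms(3))
  then show ?case
    by (intro exI[of _ "\<lambda>c. a c + b c"]) (simp add: falg.sc_add ring_distribs sum.distrib algebra_simps)
next
  case (scal x c)
  then obtain a where "x - (\<Sum>b\<in>B. scal (a b) * b) \<in> N" by blast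
  then have "scal c * (x - (\<Sum>b\<in>B. scal (a b) * b)) \<in> N" by (rule assms(4))
  then show ?case
    by (intro exI[of _ "\<lambda>b. c * a b"])
       (simp add: falg.sc_mult ring_distribs sum_distrib_left mult.assoc)
qed

text \<open>The case of interest is \<open>(p, m, q) = (F\<^sub>1, F\<^sub>1\<^sub>2, F\<^sub>2)\<close> or \<open>(E\<^sub>1, E\<^sub>1\<^sub>2, E\<^sub>2)\<close>, where \<open>m\<close> is a quantum
  commutator of \<open>p\<close> and \<open>q\<close>.\<close>

lemma ordered_monomials_closed:
  fixes p q m :: falg
  defines "B \<equiv> {p ^ a * m ^ b * q ^ c | a b c. (a, b, c) \<in> \<Psi>}"
  assumes qp: "q * p = scal \<alpha> * m + scal \<beta> * (p * q)"
    and qm: "q * m - scal \<gamma> * (m * q) \<in> U_ideal \<zeta>"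
    and sq: "p * p \<in> U_ideal \<zeta>" "q * q \<in> U_ideal \<zeta>" "m * m \<in> U_ideal \<zeta>"
  shows "x \<in> spn (U_ideal \<zeta>) B \<Longrightarrow> p * x \<in> spn (U_ideal \<zeta>) B"
    and "x \<in> spn (U_ideal \<zeta>) B \<Longrightarrow> q * x \<in> spn (U_ideal \<zeta>) B"
proof -
  have mem: "p ^ a * m ^ b * q ^ c \<in> spn (U_ideal \<zeta>) B" if "(a, b, c) \<in> \<Psi>" for a b c
    using that by (auto simp: B_def intro!: spn.base)
  have basis: "1 \<in> spn (U_ideal \<zeta>) B" "p \<in> spn (U_ideal \<zeta>) B" "q \<in> spn (U_ideal \<zeta>) B"
    "m \<in> spn (U_ideal \<zeta>) B" "p * q \<in> spn (U_ideal \<zeta>) B" "p * m \<in> spn (U_ideal \<zeta>) B"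
    "m * q \<in> spn (U_ideal \<zeta>) B" "p * m * q \<in> spn (U_ideal \<zeta>) B"
    using mem[of 0 0 0] mem[of 1 0 0] mem[of 0 0 1] mem[of 0 1 0] mem[of 1 0 1] mem[of 1 1 0]
      mem[of 0 1 1] mem[of 1 1 1] by (simp_all add: \<Psi>_def)
  have B: "b \<in> {1, p, q, m, p * q, p * m, m * q, p * m * q}" if "b \<in> B" for b
    using that by (auto simp: B_def \<Psi>_def)
  have ideal: "y * r * z \<in> spn (U_ideal \<zeta>) B" if "r \<in> U_ideal \<zeta>" for r y z
    using that by (intro spn.sub U_ideal_closed)
  \<comment> \<open>The commutation of q and m holds only modulo the ideal. Carrying the error r
    along turns it into an equation that can be used for rewriting.\<close>
  define r where "r = q * m - scal \<gamma> * (m * q)"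
  have r: "r \<in> U_ideal \<zeta>" using qm by (simp add: r_def)
  have qm': "q * m = r + scal \<gamma> * (m * q)" by (simp add: r_def)
  have comm: "u * (scal c * v) = scal c * (u * v)" for u v c
    by (metis falg.sc_comm mult.assoc)
  have "p * b \<in> spn (U_ideal \<zeta>) B" if "b \<in> B" for b
  proof -
    have "p * p \<in> spn (U_ideal \<zeta>) B" "p * (p * q) \<in> spn (U_ideal \<zeta>) B"
      "p * (p * m) \<in> spn (U_ideal \<zeta>) B" "p * (p * m * q) \<in> spn (U_ideal \<zeta>) B"
      using ideal[OF sq(1), of 1 1] ideal[OF sq(1), of 1 q] ideal[OF sq(1), of 1 m]
        ideal[OF sq(1), of 1 "m * q"] by (simp_all add: mult.assoc)
    then show ?thesis using B[OF that] basis by (auto simp: mult.assoc)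
  qed
  then show "x \<in> spn (U_ideal \<zeta>) B \<Longrightarrow> p * x \<in> spn (U_ideal \<zeta>) B"
    by (rule spn_mult_left[rotated 2]) (auto intro: spn.sub U_ideal_closed)
  have "q * b \<in> spn (U_ideal \<zeta>) B" if "b \<in> B" for b
  proof -
    have 1: "q * q \<in> spn (U_ideal \<zeta>) B" using ideal[OF sq(2), of 1 1] by simp
    have 2: "q * m \<in> spn (U_ideal \<zeta>) B"
      using ideal[OF r, of 1 1] basis by (simp add: qm' spn.add spn.scal)
    have 3: "q * p \<in> spn (U_ideal \<zeta>) B"
      using basis by (simp add: qp spn.add spn.scal)
    have mqq: "m * (q * q) \<in> spn (U_ideal \<zeta>) B" "p * (q * q) \<in> spn (U_ideal \<zeta>) B"
      "p * (m * (q * q)) \<in> spn (U_ideal \<zeta>) B" "m * m \<in> spn (U_ideal \<zeta>) B"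
      "m * m * q \<in> spn (U_ideal \<zeta>) B" "p * r \<in> spn (U_ideal \<zeta>) B" "p * r * q \<in> spn (U_ideal \<zeta>) B"
      using ideal[OF sq(2), of m 1] ideal[OF sq(2), of p 1] ideal[OF sq(2), of "p * m" 1]
        ideal[OF sq(3), of 1 1] ideal[OF sq(3), of 1 q] ideal[OF r, of p 1] ideal[OF r, of p q]
      by (simp_all add: mult.assoc)
    have "q * (m * q) = r * q + scal \<gamma> * (m * (q * q))"
      by (simp flip: mult.assoc add: qm') (simp add: ring_distribs mult.assoc)
    then have 4: "q * (m * q) \<in> spn (U_ideal \<zeta>) B"
      using ideal[OF r, of 1 q] mqq by (simp add: spn.add spn.scal)
    have "q * (p * q) = scal \<alpha> * (m * q) + scal \<beta> * (p * (q * q))"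
      by (simp flip: mult.assoc add: qp) (simp add: ring_distribs mult.assoc)
    then have 5: "q * (p * q) \<in> spn (U_ideal \<zeta>) B"
      using basis mqq by (simp add: spn.add spn.scal)
    have pm: "q * (p * m) = scal \<alpha> * (m * m) + scal \<beta> * (p * r + scal \<gamma> * (p * m * q))"
    proof -
      have "q * (p * m) = (scal \<alpha> * m + scal \<beta> * (p * q)) * m" by (simp flip: mult.assoc add: qp)
      also have "\<dots> = scal \<alpha> * (m * m) + scal \<beta> * (p * (q * m))" by (simp add: ring_distribs mult.assoc)
      finally show ?thesis by (simp add: qm' ring_distribs comm[of p \<gamma>] mult.assoc)
    qed
    then have 6: "q * (p * m) \<in> spn (U_ideal \<zeta>) B"
      using basis mqq by (simp add: spn.add spn.scal)
    have "q * (p * m * q) = scal \<alpha> * (m * m * q) + scal \<beta> * (p * r * q + scal \<gamma> * (p * (m * (q * q))))"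
    proof -
      have "q * (p * m * q) = q * (p * m) * q" by (simp add: mult.assoc)
      then show ?thesis by (simp add: pm ring_distribs mult.assoc)
    qed
    then have 7: "q * (p * m * q) \<in> spn (U_ideal \<zeta>) B"
      using mqq by (simp add: spn.add spn.scal)
    show ?thesis using B[OF that] basis 1 2 3 4 5 6 7 by auto
  qed
  then show "x \<in> spn (U_ideal \<zeta>) B \<Longrightarrow> q * x \<in> spn (U_ideal \<zeta>) B"
    by (rule spn_mult_left[rotated 2]) (auto intro: spn.sub U_ideal_closed)
qed


section \<open>Ordered monomials in the F's and in the E's\<close>

lemma primitive_4_square: "primitive_root_of_unity 4 \<zeta> \<Longrightarrow> \<zeta>\<^sup>2 = - 1"
proof -
  assume *: "primitive_root_of_unity 4 \<zeta>"
  then have "\<zeta>\<^sup>2 \<noteq> 1"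
    by (auto simp: primitive_root_of_unity_def)
  moreover have "(\<zeta>\<^sup>2)\<^sup>2 = 1"
    using * unfolding primitive_root_of_unity_def by (simp flip: power_mult)
  then have "\<zeta>\<^sup>2 = 1 \<or> \<zeta>\<^sup>2 = - 1" by (rule power2_eq_1_iff[THEN iffD1])
  ultimately show ?thesis by blast
qed

lemma ideal_rel:
  "genK i * genKinv i - 1 \<in> U_ideal \<zeta>"
  "genKinv i * genK i - 1 \<in> U_ideal \<zeta>"
  "genK N1 * genK N2 - genK N2 * genK N1 \<in> U_ideal \<zeta>"
  "genK i * genE j - scal (\<zeta> powi cartan i j) * genE j * genK i \<in> U_ideal \<zeta>"
  "genK i * genF j - scal (\<zeta> powi (- cartan i j)) * genF j * genK i \<in> U_ideal \<zeta>"
  "genE i * genF j - genF j * genE i - (if i = j then bracket_K \<zeta> i else 0) \<in> U_ideal \<zeta>"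
  "genE i * genE i \<in> U_ideal \<zeta>" "genF i * genF i \<in> U_ideal \<zeta>"
  "E12 \<zeta> * E12 \<zeta> \<in> U_ideal \<zeta>" "F12 \<zeta> * F12 \<zeta> \<in> U_ideal \<zeta>"
  by (rule subsetD[OF U_relations_subset]; (unfold U_relations_def power2_eq_square)?; blast)+

abbreviation F_word :: "node list \<Rightarrow> falg" where "F_word y \<equiv> prod_list (map genF y)"
abbreviation E_word :: "node list \<Rightarrow> falg" where "E_word x \<equiv> prod_list (map genE x)"

lemma scal_left: "y * (scal c * x) = scal c * (y * x)"
  by (metis falg.sc_comm mult.assoc)

text \<open>The factor \<gamma> is the ratio of the two coefficients of m, so that the terms q p q
  cancel in q m - \<gamma> m q; what remains contains q q.\<close>

lemma ordered_monomials_commutator: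
  assumes "m = scal a * (q * p) + scal (\<gamma> * a) * (p * q)" "a \<noteq> 0" "q * q \<in> U_ideal \<zeta>"
  shows "q * p = scal (1 / a) * m + scal (- \<gamma>) * (p * q)"
    and "q * m - scal \<gamma> * (m * q) \<in> U_ideal \<zeta>"
proof -
  have s: "scal c * (scal d * x) = scal (c * d) * x" for c d x
    by (simp add: falg.sc_mult mult.assoc)
  show "q * p = scal (1 / a) * m + scal (- \<gamma>) * (p * q)"
    using assms(2) by (simp add: assms(1) ring_distribs s falg.sc_minus)
  have "q * m - scal \<gamma> * (m * q) = scal a * ((q * q) * p) - scal (\<gamma> * \<gamma> * a) * (p * (q * q))"
    by (simp add: assms(1) ring_distribs scal_left[of q] s mult.assoc)
  then show "q * m - scal \<gamma> * (m * q) \<in> U_ideal \<zeta>"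
    using assms(3) by (simp add: U_ideal_closed(3,5,6))
qed

lemma F_word_spanned:
  assumes "\<zeta>\<^sup>2 = - 1"
  shows "F_word y \<in> spn (U_ideal \<zeta>) (F_pow \<zeta> ` \<Psi>)"
proof -
  have B: "F_pow \<zeta> ` \<Psi> = {genF N1 ^ a * F12 \<zeta> ^ b * genF N2 ^ c | a b c. (a, b, c) \<in> \<Psi>}"
    by force
  \<comment> \<open>The pattern of \<open>ordered_monomials_commutator\<close> with a = -1 and
    \<gamma> = -\<zeta>.\<close>
  have "F12 \<zeta> = scal (- 1) * (genF N2 * genF N1) + scal ((- \<zeta>) * (- 1)) * (genF N1 * genF N2)"
    by (simp add: F12_def falg.sc_minus mult.assoc)
  note c = ordered_monomials_commutator[OF this _ ideal_rel(8)[of N2 \<zeta>], simplified]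
  note cl = ordered_monomials_closed[OF c ideal_rel(8)[of N1 \<zeta>] ideal_rel(8)[of N2 \<zeta>] ideal_rel(10),
      folded B]
  show ?thesis
  proof (induction y)
    case Nil
    have "F_pow \<zeta> (0, 0, 0) \<in> spn (U_ideal \<zeta>) (F_pow \<zeta> ` \<Psi>)"
      by (intro spn.base imageI) (simp add: \<Psi>_def)
    then show ?case by simp
  next
    case (Cons i y)
    then show ?case by (cases i) (simp_all add: cl)
  qed
qed

lemma E_word_spanned:
  assumes "\<zeta>\<^sup>2 = - 1"
  shows "E_word y \<in> spn (U_ideal \<zeta>) (E_pow \<zeta> ` \<Psi>)"
proof -
  have B: "E_pow \<zeta> ` \<Psi> = {genE N1 ^ a * E12 \<zeta> ^ b * genE N2 ^ c | a b c. (a, b, c) \<in> \<Psi>}"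
    by force
  have "\<zeta> \<noteq> 0" "(- \<zeta>) * (- \<zeta>) = - 1" using assms by (auto simp: power2_eq_square)
  \<comment> \<open>Here a = \<gamma> = -\<zeta>, and \<zeta>^2 = -1 yields the coefficient -1 of
    E_1 E_2.\<close>
  then have "E12 \<zeta> = scal (- \<zeta>) * (genE N2 * genE N1) + scal ((- \<zeta>) * (- \<zeta>)) * (genE N1 * genE N2)"
    unfolding \<open>(- \<zeta>) * (- \<zeta>) = - 1\<close> by (simp add: E12_def falg.sc_minus mult.assoc)
  note c = ordered_monomials_commutator[OF this _ ideal_rel(7)[of N2 \<zeta>]]
  have nz: "- \<zeta> \<noteq> 0" using \<open>\<zeta> \<noteq> 0\<close> by simp
  note cl = ordered_monomials_closed[OF c(1)[OF nz] c(2)[OF nz] ideal_rel(7)[of N1 \<zeta>]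
      ideal_rel(7)[of N2 \<zeta>] ideal_rel(9), folded B]
  show ?thesis
  proof (induction y)
    case Nil
    have "E_pow \<zeta> (0, 0, 0) \<in> spn (U_ideal \<zeta>) (E_pow \<zeta> ` \<Psi>)"
      by (intro spn.base imageI) (simp add: \<Psi>_def)
    then show ?case by simp
  next
    case (Cons i y)
    then show ?case by (cases i) (simp_all add: cl)
  qed
qed

section \<open>Triangular decomposition modulo a left ideal that fixes the weight\<close>

definition PBW :: "complex \<Rightarrow> falg set" where
  "PBW \<zeta> = {F_pow \<zeta> \<psi> * E_pow \<zeta> \<psi>' | \<psi> \<psi>'. \<psi> \<in> \<Psi> \<and> \<psi>' \<in> \<Psi>}"

lemma finite_PBW: "finite (PBW \<zeta>)"
proof -
  have "PBW \<zeta> = (\<lambda>(\<psi>, \<psi>'). F_pow \<zeta> \<psi> * E_pow \<zeta> \<psi>') ` (\<Psi> \<times> \<Psi>)"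
    by (force simp: PBW_def)
  then show ?thesis by (simp add: \<Psi>_def)
qed

text \<open>N behaves like the annihilator of a vector of weight \<open>wt\<close>, so the factor in
  K_1, K_2 of the triangular decomposition reduces to scalars. There are two uses: the highest
  weight vector of \<open>V(t)\<close>, and a candidate for a cyclic vector.\<close>

locale weight_ideal =
  fixes \<zeta> :: complex and N :: "falg set" and wt :: "node \<Rightarrow> complex"
  assumes zeta: "\<zeta>\<^sup>2 = - 1"
    and N_add: "x \<in> N \<Longrightarrow> y \<in> N \<Longrightarrow> x + y \<in> N"
    and N_mult: "x \<in> N \<Longrightarrow> z * x \<in> N"
    and U_ideal_le: "U_ideal \<zeta> \<subseteq> N"
    and weight: "genK i - scal (wt i) \<in> N"
    and weight_nonzero: "wt i \<noteq> 0"
begin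

lemma zero_in_N: "0 \<in> N"
  using U_ideal_le U_ideal_closed(1) by blast

lemma zeta_nonzero: "\<zeta> \<noteq> 0"
  using zeta by auto

lemma K_step:
  assumes "genK i * g - scal k * g * genK i \<in> U_ideal \<zeta>" "genK i * z - scal d * z \<in> N"
  shows "genK i * (g * z) - scal (k * d) * (g * z) \<in> N"
proof -
  have "(genK i * g - scal k * g * genK i) * z + scal k * g * (genK i * z - scal d * z) \<in> N"
    using assms U_ideal_le by (blast intro: N_add N_mult U_ideal_closed)
  then show ?thesis
    by (simp add: ring_distribs mult.assoc falg.sc_mult scal_left[of g])
qed

text \<open>Moving K_i to the right past a letter costs a power of \<zeta>. The factor d is recorded
  as nonzero because \<open>Kinv_closed\<close> divides by it.\<close>

lemma K_eigen: "\<exists>d. d \<noteq> 0 \<and> genK i * (F_word y * E_word x) - scal d * (F_word y * E_word x) \<in> N"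
proof (induction y)
  case Nil
  show ?case
  proof (induction x)
    case Nil
    show ?case using weight weight_nonzero by auto
  next
    case (Cons j x)
    then obtain d where d: "d \<noteq> 0" "genK i * E_word x - scal d * E_word x \<in> N" by auto
    show ?case
      using K_step[OF ideal_rel(4) d(2), of j] d(1) zeta_nonzero
      by (intro exI[of _ "\<zeta> powi cartan i j * d"]) simp
  qed
next
  case (Cons j y)
  then obtain d where d: "d \<noteq> 0"
    "genK i * (F_word y * E_word x) - scal d * (F_word y * E_word x) \<in> N" by auto
  show ?case
    using K_step[OF ideal_rel(5) d(2), of j] d(1) zeta_nonzero
    by (intro exI[of _ "\<zeta> powi (- cartan i j) * d"]) (simp add: mult.assoc)
qed

definition words :: "falg set" where
  "words = {F_word y * E_word x | y x. True}"

lemma word_in: "F_word y * E_word x \<in> spn N words"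
  by (auto simp: words_def intro: spn.base)

lemma K_closed: "genK i * (F_word y * E_word x) \<in> spn N words"
proof -
  obtain d where "genK i * (F_word y * E_word x) - scal d * (F_word y * E_word x) \<in> N"
    using K_eigen by blast
  from spn.add[OF spn.sub[OF this] spn.scal[OF word_in, of d y x]] show ?thesis by simp
qed

lemma Kinv_closed: "genKinv i * (F_word y * E_word x) \<in> spn N words"
proof -
  let ?z = "F_word y * E_word x"
  obtain d where d: "d \<noteq> 0" "genK i * ?z - scal d * ?z \<in> N"
    using K_eigen by blast
  have "(genKinv i * genK i - 1) * ?z + - (genKinv i * (genK i * ?z - scal d * ?z)) \<in> N"
  proof (rule N_add)
    show "(genKinv i * genK i - 1) * ?z \<in> N"
      using U_ideal_closed(6)[OF ideal_rel(2)] U_ideal_le by blast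
    show "- (genKinv i * (genK i * ?z - scal d * ?z)) \<in> N"
      using N_mult[OF N_mult[OF d(2)], of "- 1" "genKinv i"] by simp
  qed
  also have "(genKinv i * genK i - 1) * ?z + - (genKinv i * (genK i * ?z - scal d * ?z)) =
      scal d * (genKinv i * ?z) - ?z"
    by (simp add: ring_distribs mult.assoc scal_left[of "genKinv i"])
  finally have "scal (1 / d) * (scal d * (genKinv i * ?z) - ?z) \<in> N"
    by (rule N_mult)
  also have "scal (1 / d) * (scal d * (genKinv i * ?z) - ?z) = genKinv i * ?z - scal (1 / d) * ?z"
    using d(1) by (simp add: ring_distribs flip: mult.assoc falg.sc_mult)
  finally show ?thesis
    using spn.add[OF spn.sub spn.scal[OF word_in]] by (metis diff_add_cancel)
qed

lemma F_closed: "z \<in> spn N words \<Longrightarrow> genF i * z \<in> spn N words"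
proof (rule spn_mult_left)
  fix b assume "b \<in> words"
  then obtain y x where "b = F_word y * E_word x" by (auto simp: words_def)
  then show "genF i * b \<in> spn N words" using word_in[of "i # y" x] by (simp add: mult.assoc)
qed (auto intro: spn.sub N_mult)

text \<open>E_i moves to the right through the F's. Each crossing leaves at most a combination of
  K_i and its inverse in front of the remaining word, where \<open>K_closed\<close> and
  \<open>Kinv_closed\<close> apply.\<close>

lemma E_closed: "genE i * (F_word y * E_word x) \<in> spn N words"
proof (induction y)
  case Nil
  then show ?case using word_in[of "[]" "i # x"] by simp
next
  case (Cons j y)
  let ?z = "F_word y * E_word x" and ?b = "if i = j then bracket_K \<zeta> i else 0"
  have "?b * ?z \<in> spn N words"
    using K_closed Kinv_closed zero_in_N
    by (auto simp: bracket_K_def mult.assoc left_diff_distrib intro!: spn.scal intro: spn.sub spn_diff)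
  moreover have "genF j * (genE i * ?z) \<in> spn N words"
    by (rule F_closed[OF Cons.IH])
  moreover have "(genE i * genF j - genF j * genE i - ?b) * ?z \<in> spn N words"
    using ideal_rel(6) U_ideal_le by (blast intro: spn.sub U_ideal_closed)
  ultimately have "(genE i * genF j - genF j * genE i - ?b) * ?z + genF j * (genE i * ?z) + ?b * ?z
      \<in> spn N words"
    by (intro spn.add)
  then show ?case by (simp add: left_diff_distrib mult.assoc)
qed

lemma gen_closed:
  assumes "z \<in> spn N words"
  shows "gen g * z \<in> spn N words"
proof (rule spn_mult_left[OF assms])
  fix b assume "b \<in> words"
  then obtain y x where "b = F_word y * E_word x" by (auto simp: words_def)
  then show "gen g * b \<in> spn N words"
    by (cases g) (simp_all only: F_closed[OF word_in] E_closed K_closed Kinv_closed)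
qed (auto intro: spn.sub N_mult)

lemma single_word: "Poly_Mapping.single (Word l) c = scal c * prod_list (map gen l)"
proof -
  have "prod_list (map gen l) = Poly_Mapping.single (Word l) 1"
    by (induction l) (simp_all add: gen_def mult_single plus_word_def flip: zero_word_def)
  then show ?thesis by (simp add: scal_def mult_single)
qed

lemma spanned_words: "x \<in> spn N words"
proof (induction x rule: poly_mapping_induct_single)
  case (single w k)
  have "prod_list (map gen l) \<in> spn N words" for l
  proof (induction l)
    case Nil
    then show ?case using word_in[of "[]" "[]"] by simp
  qed (simp add: gen_closed)
  then show ?case by (cases w) (simp add: single_word spn.scal)
qed (rule spn.add)

lemma spanned_PBW: "\<exists>a. x - (\<Sum>b\<in>PBW \<zeta>. scal (a b) * b) \<in> N"
proof (rule spn_finite)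
  \<comment> \<open>The F part and the E part of a word are straightened separately. This takes
    place modulo the two-sided ideal, as N only absorbs factors on the left.\<close>
  have "words \<subseteq> spn (U_ideal \<zeta>) (PBW \<zeta>)"
  proof
    fix b assume "b \<in> words"
    then obtain y x where "b = F_word y * E_word x" by (auto simp: words_def)
    then have "b \<in> spn (U_ideal \<zeta>) {b * c | b c. b \<in> F_pow \<zeta> ` \<Psi> \<and> c \<in> E_pow \<zeta> ` \<Psi>}"
      using spn_mult[OF F_word_spanned E_word_spanned, OF zeta zeta] by simp
    then show "b \<in> spn (U_ideal \<zeta>) (PBW \<zeta>)"
    proof (rule spn_trans)
      show "{b * c | b c. b \<in> F_pow \<zeta> ` \<Psi> \<and> c \<in> E_pow \<zeta> ` \<Psi>} \<subseteq> spn (U_ideal \<zeta>) (PBW \<zeta>)"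
        unfolding PBW_def by (blast intro: spn.base)
    qed (blast intro: spn.sub)
  qed
  then have "words \<subseteq> spn N (PBW \<zeta>)"
    using U_ideal_le by (blast intro: spn_trans spn.sub spn.base)
  then show "x \<in> spn N (PBW \<zeta>)"
    using spanned_words by (rule spn_trans[rotated 2]) (auto intro: spn.sub)
qed (auto intro: finite_PBW N_add N_mult zero_in_N)

end


section \<open>Representations\<close>

definition rep :: "(gen \<Rightarrow> 'b endo) \<Rightarrow> falg \<Rightarrow> 'b endo" where
  "rep g = endo.lin (word_value g)"

lemma rep_simps [simp]:
  "rep g 0 = 0" "rep g 1 = 1" "rep g (x + y) = rep g x + rep g y" "rep g (x - y) = rep g x - rep g y"
  "rep g (- x) = - rep g x" "rep g (x * y) = rep g x * rep g y" "rep g (scal c) = sce c"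
  "rep g (gen a) = g a"
  using endo.lin_single[of "word_value g" 0 1]
  by (simp_all add: rep_def endo.lin_add endo.lin_diff endo.lin_minus endo.lin_mult scal_def gen_def)

lemma rep_power [simp]: "rep g (x ^ n) = rep g x ^ n"
  by (induction n) simp_all

lemma rep_sum: "rep g (\<Sum>i\<in>I. f i) = (\<Sum>i\<in>I. rep g (f i))"
  by (induction I rule: infinite_finite_induct) simp_all

text \<open>The squares of \<open>E12\<close> and \<open>F12\<close> enter through the braid
  relations, which are free of \<zeta> and easy to test on basis vectors;
  \<open>commutator_square\<close> makes the passage.\<close>

definition U_rep :: "complex \<Rightarrow> (gen \<Rightarrow> 'b endo) \<Rightarrow> bool" where
  "U_rep \<zeta> g \<longleftrightarrow>
     (\<forall>i. g (GK i) * g (GKinv i) = 1 \<and> g (GKinv i) * g (GK i) = 1 \<and>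
       g (GE i) * g (GE i) = 0 \<and> g (GF i) * g (GF i) = 0) \<and>
     (\<forall>i j. g (GK i) * g (GK j) = g (GK j) * g (GK i) \<and>
       g (GK i) * g (GE j) = sce (\<zeta> powi cartan i j) * (g (GE j) * g (GK i)) \<and>
       g (GK i) * g (GF j) = sce (\<zeta> powi (- cartan i j)) * (g (GF j) * g (GK i)) \<and>
       g (GE i) * g (GF j) = g (GF j) * g (GE i) +
         (if i = j then sce (1 / (\<zeta> - inverse \<zeta>)) * (g (GK i) - g (GKinv i)) else 0)) \<and>
     g (GE N1) * (g (GE N2) * (g (GE N1) * g (GE N2))) =
       g (GE N2) * (g (GE N1) * (g (GE N2) * g (GE N1))) \<and>
     g (GF N1) * (g (GF N2) * (g (GF N1) * g (GF N2))) =
       g (GF N2) * (g (GF N1) * (g (GF N2) * g (GF N1)))"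

text \<open>Given \<open>p\<^sup>2 = q\<^sup>2 = 0\<close>, the square of a quantum commutator vanishes if and only if \<open>p\<close> and \<open>q\<close>
  satisfy the braid relation of type \<open>B\<^sub>2\<close>.\<close>

lemma commutator_square:
  fixes p q :: "'b endo"
  assumes "\<zeta>\<^sup>2 = - 1" "p * p = 0" "q * q = 0" "p * (q * (p * q)) = q * (p * (q * p))"
  shows "(p * q + sce \<zeta> * (q * p)) * (p * q + sce \<zeta> * (q * p)) = 0"
proof -
  have c: "x * (sce \<zeta> * y) = sce \<zeta> * (x * y)" if "x \<in> {p, q}" for x y :: "'b endo"
    by (metis endo.sc_comm mult.assoc)
  have z: "sce \<zeta> * (sce \<zeta> * y) = - y" for y :: "'b endo"
    using assms(1) by (simp add: power2_eq_square endo.sc_minus flip: mult.assoc endo.sc_mult)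
  have 0: "p * (p * y) = 0" "q * (q * y) = 0" for y
    using assms(2,3) by (simp_all flip: mult.assoc)
  show ?thesis
    by (simp add: ring_distribs mult.assoc c z 0 assms(2,3,4))
qed

text \<open>The kernel of \<open>rep g\<close> is a two-sided ideal, so only the relations have to
  be checked. This makes the action of a coset in \<open>Uq\<close> independent of its
  representative.\<close>

lemma U_rep_vanishes:
  assumes "\<zeta>\<^sup>2 = - 1" "U_rep \<zeta> g" "x \<in> U_ideal \<zeta>"
  shows "rep g x = 0"
proof -
  note g = assms(2)[unfolded U_rep_def]
  have "rep g (E12 \<zeta> * E12 \<zeta>) = (g (GE N1) * g (GE N2) + sce \<zeta> * (g (GE N2) * g (GE N1))) *
      (g (GE N1) * g (GE N2) + sce \<zeta> * (g (GE N2) * g (GE N1)))"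
    by (simp add: E12_def mult.assoc del: minus_add_distrib)
  then have E: "rep g ((E12 \<zeta>)\<^sup>2) = 0"
    using g commutator_square[OF assms(1), of "g (GE N1)" "g (GE N2)"]
    by (simp add: power2_eq_square)
  \<comment> \<open>Up to sign \<open>F12\<close> is the quantum commutator for -\<zeta>, which is a
    square root of -1 as well.\<close>
  have "rep g (F12 \<zeta> * F12 \<zeta>) = (g (GF N2) * g (GF N1) + sce (- \<zeta>) * (g (GF N1) * g (GF N2))) *
      (g (GF N2) * g (GF N1) + sce (- \<zeta>) * (g (GF N1) * g (GF N2)))"
    by (simp add: F12_def mult.assoc endo.sc_minus algebra_simps)
  then have F: "rep g ((F12 \<zeta>)\<^sup>2) = 0"
    using g commutator_square[of "- \<zeta>" "g (GF N2)" "g (GF N1)"] assms(1)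
    by (simp add: power2_eq_square)
  have EF: "rep g (genE i * genF j - genF j * genE i - (if i = j then bracket_K \<zeta> i else 0)) = 0" for i j
    using g by (cases "i = j") (simp_all add: bracket_K_def)
  have "U_relations \<zeta> \<subseteq> {x. rep g x = 0}"
    unfolding U_relations_def
    by (intro Un_least; (use EF in blast)?; use g E F in
        \<open>auto simp: mult.assoc power2_eq_square simp del: rep_power\<close>)
  then have "U_ideal \<zeta> \<subseteq> {x. rep g x = 0}"
    by (rule U_ideal_minimal[rotated]) (auto simp: two_sided_def)
  with assms(3) show ?thesis by auto
qed


section \<open>Tensor products of representations\<close>

fun tensor_gen :: "(gen \<Rightarrow> 'b endo) \<Rightarrow> (gen \<Rightarrow> 'c endo) \<Rightarrow> gen \<Rightarrow> ('b \<times> 'c) endo" where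
  "tensor_gen g h (GE i) = lft (g (GE i)) * rgt (h (GK i)) + rgt (h (GE i))"
| "tensor_gen g h (GF i) = lft (g (GF i)) + lft (g (GKinv i)) * rgt (h (GF i))"
| "tensor_gen g h (GK i) = lft (g (GK i)) * rgt (h (GK i))"
| "tensor_gen g h (GKinv i) = lft (g (GKinv i)) * rgt (h (GKinv i))"

definition rep2 :: "(gen \<Rightarrow> 'b endo) \<Rightarrow> (gen \<Rightarrow> 'c endo) \<Rightarrow> (word \<times> word \<Rightarrow>\<^sub>0 complex) \<Rightarrow> ('b \<times> 'c) endo"
  where "rep2 g h = endo.lin (\<lambda>(v, w). lft (word_value g v) * rgt (word_value h w))"

text \<open>Both sides are algebra homomorphisms in x that agree on generators; that
  \<open>rep2 g h\<close> is multiplicative rests on \<open>lft_rgt_commute\<close>.\<close>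

lemma rep2_coproduct:
  fixes g :: "gen \<Rightarrow> 'b::finite endo" and h :: "gen \<Rightarrow> 'c::finite endo"
  shows "rep2 g h (coproduct x) = rep (tensor_gen g h) x"
proof -
  have mult: "rep2 g h (x * y) = rep2 g h x * rep2 g h y" for x y
    unfolding rep2_def
  proof (rule endo.lin_mult, clarsimp)
    fix v w v' w'
    have "lft (word_value g v) * (rgt (word_value h w) * lft (word_value g v')) * rgt (word_value h w') =
      lft (word_value g v) * (lft (word_value g v') * rgt (word_value h w)) * rgt (word_value h w')"
      by (simp only: lft_rgt_commute)
    then show "lft (word_value g v * word_value g v') * rgt (word_value h w * word_value h w') =
        lft (word_value g v) * rgt (word_value h w) * (lft (word_value g v') * rgt (word_value h w'))"
      by (simp add: lft_ring rgt_ring mult.assoc)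
  qed
  have add: "rep2 g h (x + y) = rep2 g h x + rep2 g h y" for x y
    by (simp add: rep2_def endo.lin_add)
  have gens: "rep2 g h (coproduct_gen a) = tensor_gen g h a" for a
    by (cases a) (simp_all add: add, simp_all add: rep2_def lft_ring rgt_ring flip: zero_prod_def)
  have one: "rep2 g h 1 = 1"
    unfolding rep2_def by (simp flip: single_one add: lft_ring rgt_ring zero_prod_def)
  have words: "rep2 g h (word_value coproduct_gen w) = word_value (tensor_gen g h) w" for w
  proof -
    have "rep2 g h (prod_list (map coproduct_gen l)) = prod_list (map (tensor_gen g h) l)" for l
      by (induction l) (simp_all add: one mult gens)
    then show ?thesis .
  qed
  have "rep2 g h (Poly_Mapping.single 0 c) = sce c" for c
    by (simp add: rep2_def lft_ring rgt_ring zero_prod_def)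
  then show ?thesis
    unfolding coproduct_eq_lin rep_def words[symmetric]
    by (intro endo.lin_comp add mult monoid_algebra_scalars)
qed

text \<open>For coproducts, \<open>x = E\<^sub>1 \<otimes> K\<^sub>1\<close>, \<open>P = 1 \<otimes> E\<^sub>1\<close>, \<open>y = E\<^sub>2 \<otimes> K\<^sub>2\<close> and \<open>Q = 1 \<otimes> E\<^sub>2\<close>, and similarly for the \<open>F\<^sub>i\<close>.\<close>

lemma braid_sum:
  fixes x y P Q z :: "'r::ring_1"
  assumes z: "z * z = - 1" "\<And>u. u * z = z * u"
    and sq: "x * x = 0" "y * y = 0" "P * P = 0" "Q * Q = 0"
    and comm: "P * x = - (x * P)" "P * y = z * (y * P)" "Q * x = z * (x * Q)" "Q * y = - (y * Q)"
    and braid: "x * (y * (x * y)) = y * (x * (y * x))" "P * (Q * (P * Q)) = Q * (P * (Q * P))"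
  shows "(x + P) * ((y + Q) * ((x + P) * (y + Q))) = (y + Q) * ((x + P) * ((y + Q) * (x + P)))"
proof -
  have zl: "u * (z * w) = z * (u * w)" if "u \<in> {x, y, P, Q}" for u w
    using z(2)[of u] by (metis mult.assoc)
  have zr: "u * z = z * u" if "u \<in> {x, y, P, Q}" for u by (rule z(2))
  have zz: "z * (z * u) = - u" for u using z(1) by (simp flip: mult.assoc)
  have sq': "x * (x * u) = 0" "y * (y * u) = 0" "P * (P * u) = 0" "Q * (Q * u) = 0" for u
    using sq by (simp_all flip: mult.assoc)
  have comm': "P * (x * u) = - (x * (P * u))" "P * (y * u) = z * (y * (P * u))"
    "Q * (x * u) = z * (x * (Q * u))" "Q * (y * u) = - (y * (Q * u))" for u
    using comm by (simp_all flip: mult.assoc)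
  \<comment> \<open>The rewriting moves z to the front and P, Q to the right of x, y. The normal
    forms of the two sides then differ only by the two braid relations.\<close>
  show ?thesis
    by (simp add: ring_distribs zl zr zz sq sq' comm comm' braid)
qed

text \<open>Multiply the relation between K_i and x by the inverse of K_i on both sides.\<close>

lemma U_rep_Kinv:
  assumes g: "U_rep \<zeta> g"
  shows "g (GE j) * g (GKinv i) = sce (\<zeta> powi cartan i j) * (g (GKinv i) * g (GE j))"
    and "g (GF j) * g (GKinv i) = sce (\<zeta> powi (- cartan i j)) * (g (GKinv i) * g (GF j))"
    and "g (GK j) * g (GKinv i) = g (GKinv i) * g (GK j)"
proof -
  have *: "x * g (GKinv i) = sce c * (g (GKinv i) * x)" if "g (GK i) * x = sce c * (x * g (GK i))" for x c
  proof -
    have k: "g (GKinv i) * g (GK i) = 1" "g (GK i) * g (GKinv i) = 1" using g by (auto simp: U_rep_def)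
    have "x * g (GKinv i) = g (GKinv i) * (g (GK i) * x) * g (GKinv i)"
      using k by (simp flip: mult.assoc)
    also have "\<dots> = (g (GKinv i) * sce c) * (x * (g (GK i) * g (GKinv i)))"
      by (simp only: that mult.assoc)
    finally show ?thesis by (simp add: k mult.assoc flip: endo.sc_comm[of c "g (GKinv i)"])
  qed
  show "g (GE j) * g (GKinv i) = sce (\<zeta> powi cartan i j) * (g (GKinv i) * g (GE j))"
    "g (GF j) * g (GKinv i) = sce (\<zeta> powi (- cartan i j)) * (g (GKinv i) * g (GF j))"
    by (rule *; use g in \<open>simp add: U_rep_def\<close>)+
  have "g (GK i) * g (GK j) = g (GK j) * g (GK i)" using g by (simp add: U_rep_def)
  then show "g (GK j) * g (GKinv i) = g (GKinv i) * g (GK j)" using *[of "g (GK j)" 1] by simp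
qed

lemma sce_zeta_square: "\<zeta>\<^sup>2 = - 1 \<Longrightarrow> sce \<zeta> * sce \<zeta> = - (1 :: 'b endo)"
  by (simp add: power2_eq_square endo.sc_minus flip: endo.sc_mult)

lemma zeta_powi:
  assumes "\<zeta>\<^sup>2 = (- 1 :: complex)"
  shows "\<zeta> powi 2 = - 1" "\<zeta> powi (- 2) = - 1" "\<zeta> powi (- 1) = - \<zeta>" "inverse \<zeta> = - \<zeta>"
proof -
  have "\<zeta> * - \<zeta> = 1" using assms by (simp add: power2_eq_square)
  then show i: "inverse \<zeta> = - \<zeta>" by (rule inverse_unique)
  show "\<zeta> powi 2 = - 1" "\<zeta> powi (- 2) = - 1" "\<zeta> powi (- 1) = - \<zeta>"
    using assms power_int_minus[of \<zeta> 2] power_int_minus[of \<zeta> 1] i by simp_all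
qed

text \<open>Pure tensors of operators as a single symbol, so that simplification multiplies them
  factor by factor.\<close>

definition tens :: "'b endo \<Rightarrow> 'c endo \<Rightarrow> ('b \<times> 'c) endo" where
  "tens A B = lft A * rgt B"

lemma tens_simps:
  fixes A A' :: "'b::finite endo" and B B' :: "'c::finite endo"
  shows "tens A B * tens A' B' = tens (A * A') (B * B')"
    "tens A (B + B') = tens A B + tens A B'" "tens (A + A') B = tens A B + tens A' B"
    "tens A (B - B') = tens A B - tens A B'" "tens (A - A') B = tens A B - tens A' B"
    "tens A (- B) = - tens A B" "tens (- A) B = - tens A B"
    "tens 1 1 = (1 :: ('b \<times> 'c) endo)" "tens 0 B = 0" "tens A 0 = 0"
    "tens (sce k * A) B = sce k * tens A B" "tens A (sce k * B) = sce k * tens A B"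
proof -
  have "lft A * (rgt B * lft A') * rgt B' = lft A * (lft A' * rgt B) * rgt B'"
    by (simp only: lft_rgt_commute)
  then show "tens A B * tens A' B' = tens (A * A') (B * B')"
    by (simp add: tens_def lft_ring rgt_ring mult.assoc)
  show "tens A (sce k * B) = sce k * tens A B"
    unfolding tens_def rgt_ring mult.assoc[symmetric] endo.sc_comm[of k "lft A"] ..
qed (simp_all add: tens_def lft_ring rgt_ring ring_distribs mult.assoc)

lemma tensor_gen_tens:
  "tensor_gen g h (GE i) = tens (g (GE i)) (h (GK i)) + tens 1 (h (GE i))"
  "tensor_gen g h (GF i) = tens (g (GF i)) 1 + tens (g (GKinv i)) (h (GF i))"
  "tensor_gen g h (GK i) = tens (g (GK i)) (h (GK i))"
  "tensor_gen g h (GKinv i) = tens (g (GKinv i)) (h (GKinv i))"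
  by (simp_all add: tens_def lft_ring rgt_ring)

declare tensor_gen.simps [simp del]

lemma U_rep_Kinv_commute:
  assumes g: "U_rep \<zeta> g"
  shows "g (GKinv i) * g (GKinv j) = g (GKinv j) * g (GKinv i)"
proof -
  have k: "g (GKinv i) * g (GK i) = 1" "g (GK i) * g (GKinv i) = 1" "g (GK i) * g (GK j) = g (GK j) * g (GK i)" for i j
    using g by (auto simp: U_rep_def)
  have "g (GKinv i) * g (GKinv j) = g (GKinv i) * g (GKinv j) * (g (GK i) * g (GK j)) * g (GKinv j) * g (GKinv i)"
    by (simp add: mult.assoc k(2))
  also have "g (GKinv i) * g (GKinv j) * (g (GK i) * g (GK j)) =
      g (GKinv i) * (g (GKinv j) * g (GK j)) * g (GK i)"
    unfolding k(3)[of i j] by (simp add: mult.assoc)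
  finally show ?thesis by (simp add: k mult.assoc)
qed

text \<open>The coproduct respects the defining relations. In the squares the mixed terms cancel
  since K_i anticommutes with E_i and F_i, as \<zeta>^2 = -1; the braid relations are the content of
  \<open>braid_sum\<close>.\<close>

lemma U_rep_tensor:
  fixes g :: "gen \<Rightarrow> 'b::finite endo" and h :: "gen \<Rightarrow> 'c::finite endo"
  assumes z: "\<zeta>\<^sup>2 = - 1" and g: "U_rep \<zeta> g" and h: "U_rep \<zeta> h"
  shows "U_rep \<zeta> (tensor_gen g h)"
proof -
  note zp = zeta_powi[OF z]
  have nz: "\<zeta> \<noteq> 0" using z by auto
  have z': "(- \<zeta>)\<^sup>2 = - 1" using z by simp
  have sm: "sce (- 1) = - (1 :: 'd endo)" "sce (- \<zeta>) = - (sce \<zeta> :: 'd endo)"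
    by (simp_all add: endo.sc_minus)
  have sz: "sce \<zeta> * (sce \<zeta> * u) = - u" for u :: "'d endo"
    by (simp add: sce_zeta_square[OF z] flip: mult.assoc)
  have comm: "rel (GK i) * rel (GK j) = rel (GK j) * rel (GK i)"
    "rel (GKinv i) * rel (GKinv j) = rel (GKinv j) * rel (GKinv i)"
    if "U_rep \<zeta> rel" for i j and rel :: "gen \<Rightarrow> 'd endo"
    using that U_rep_Kinv_commute[OF that] by (auto simp: U_rep_def)
  have R: "rel (GK i) * rel (GKinv i) = 1" "rel (GKinv i) * rel (GK i) = 1"
    "rel (GE i) * rel (GE i) = 0" "rel (GF i) * rel (GF i) = 0"
    "rel (GK i) * rel (GE j) = sce (\<zeta> powi cartan i j) * (rel (GE j) * rel (GK i))"
    "rel (GK i) * rel (GF j) = sce (\<zeta> powi (- cartan i j)) * (rel (GF j) * rel (GK i))"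
    "rel (GE i) * rel (GF j) = rel (GF j) * rel (GE i) +
         (if i = j then sce (1 / (\<zeta> - inverse \<zeta>)) * (rel (GK i) - rel (GKinv i)) else 0)"
    "rel (GE N1) * (rel (GE N2) * (rel (GE N1) * rel (GE N2))) =
       rel (GE N2) * (rel (GE N1) * (rel (GE N2) * rel (GE N1)))"
    "rel (GF N1) * (rel (GF N2) * (rel (GF N1) * rel (GF N2))) =
       rel (GF N2) * (rel (GF N1) * (rel (GF N2) * rel (GF N1)))"
    "rel (GE j) * rel (GKinv i) = sce (\<zeta> powi cartan i j) * (rel (GKinv i) * rel (GE j))"
    "rel (GF j) * rel (GKinv i) = sce (\<zeta> powi (- cartan i j)) * (rel (GKinv i) * rel (GF j))"
    "rel (GK j) * rel (GKinv i) = rel (GKinv i) * rel (GK j)"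
    if "U_rep \<zeta> rel" for i j and rel :: "gen \<Rightarrow> 'd endo"
    using that U_rep_Kinv[OF that] by (auto simp: U_rep_def)
  have ss: "sce a * (sce b * u) = sce (a * b) * u" for a b and u :: "'d endo"
    by (simp add: endo.sc_mult mult.assoc)
  let ?T = "tensor_gen g h"
  have 1: "?T (GK i) * ?T (GKinv i) = 1" "?T (GKinv i) * ?T (GK i) = 1" for i
    by (simp_all add: tensor_gen_tens tens_simps R[OF g] R[OF h])
  have 2: "?T (GK i) * ?T (GK j) = ?T (GK j) * ?T (GK i)" for i j
    by (simp add: tensor_gen_tens tens_simps comm(1)[OF g, of i j] comm(1)[OF h, of i j])
  have 3: "?T (GE i) * ?T (GE i) = 0" "?T (GF i) * ?T (GF i) = 0" for i
    by (simp_all add: tensor_gen_tens tens_simps R[OF g] R[OF h] ring_distribs cartan_def zp z sm)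
  have 4: "?T (GK i) * ?T (GE j) = sce (\<zeta> powi cartan i j) * (?T (GE j) * ?T (GK i))"
    "?T (GK i) * ?T (GF j) = sce (\<zeta> powi (- cartan i j)) * (?T (GF j) * ?T (GK i))" for i j
  proof -
    have "h (GK i) * h (GK j) = h (GK j) * h (GK i)" "g (GK i) * g (GKinv j) = g (GKinv j) * g (GK i)"
      by (rule comm(1)[OF h], rule R(12)[OF g])
    then show "?T (GK i) * ?T (GE j) = sce (\<zeta> powi cartan i j) * (?T (GE j) * ?T (GK i))"
      "?T (GK i) * ?T (GF j) = sce (\<zeta> powi (- cartan i j)) * (?T (GF j) * ?T (GK i))"
      by (simp_all add: tensor_gen_tens tens_simps R(5,6)[OF g] R(5,6)[OF h] ring_distribs)
  qed
  have 5: "?T (GE i) * ?T (GF j) = ?T (GF j) * ?T (GE i) +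
         (if i = j then sce (1 / (\<zeta> - inverse \<zeta>)) * (?T (GK i) - ?T (GKinv i)) else 0)" for i j
  proof -
    \<comment> \<open>Exchanging E_i tensor K_i with the inverse of K_j tensor F_j produces these
      two powers; they cancel by symmetry of the Cartan matrix.\<close>
    have 1: "\<zeta> powi (- cartan i j) * \<zeta> powi cartan j i = 1" "\<zeta> powi (- cartan j j) * \<zeta> powi cartan j j = 1"
      using nz by (simp_all add: cartan_def power_int_minus)
    show ?thesis
      by (simp add: tensor_gen_tens tens_simps R(6,7,10)[OF g] R(6,7,10)[OF h] ring_distribs ss 1)
  qed
  have 6: "?T (GE N1) * (?T (GE N2) * (?T (GE N1) * ?T (GE N2))) = ?T (GE N2) * (?T (GE N1) * (?T (GE N2) * ?T (GE N1)))"
  proof -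
    have "h (GK N1) * (h (GK N2) * u) = h (GK N2) * (h (GK N1) * u)" for u
      using comm(1)[OF h, of N1 N2] by (simp flip: mult.assoc)
    note kk = this comm(1)[OF h, of N1 N2]
    show ?thesis
      unfolding tensor_gen_tens
      by (rule braid_sum[OF sce_zeta_square[OF z] endo.sc_comm[symmetric]])
         (simp_all add: tens_simps R[OF g] R(3,5,8)[OF h] kk zp z sm sz cartan_def)
  qed
  have 7: "?T (GF N1) * (?T (GF N2) * (?T (GF N1) * ?T (GF N2))) = ?T (GF N2) * (?T (GF N1) * (?T (GF N2) * ?T (GF N1)))"
  proof -
    have "g (GKinv N1) * (g (GKinv N2) * u) = g (GKinv N2) * (g (GKinv N1) * u)" for u
      using comm(2)[OF g, of N1 N2] by (simp flip: mult.assoc)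
    note kk = this comm(2)[OF g, of N1 N2]
    \<comment> \<open>The exponents for the F's are opposite to those for the E's, hence -\<zeta> in
      place of \<zeta>.\<close>
    show ?thesis
      unfolding tensor_gen_tens
      by (rule braid_sum[OF sce_zeta_square[OF z'] endo.sc_comm[symmetric]])
         (simp_all add: tens_simps R(4,9,11)[OF g] R[OF h] kk zp z sm sz cartan_def)
  qed
  show ?thesis
    unfolding U_rep_def using 1 2 3 4 5 6 7 by blast
qed


section \<open>A model of the Verma module\<close>

text \<open>The basis vectors \<open>B0\<close>, \<open>B1 i\<close>, \<open>B2 i\<close>, \<open>B3 i\<close>, \<open>B4\<close> stand for \<open>v\<^sub>h\<close>, \<open>F\<^sub>i v\<^sub>h\<close>, \<open>F\<^sub>i F\<^sub>j v\<^sub>h\<close>,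
  \<open>F\<^sub>i F\<^sub>j F\<^sub>i v\<^sub>h\<close> and \<open>F\<^sub>1 F\<^sub>2 F\<^sub>1 F\<^sub>2 v\<^sub>h = F\<^sub>2 F\<^sub>1 F\<^sub>2 F\<^sub>1 v\<^sub>h\<close>, where \<open>j\<close> is the node different from \<open>i\<close>.\<close>

datatype b8 = B0 | B1 node | B2 node | B3 node | B4

fun other :: "node \<Rightarrow> node" where
  "other N1 = N2"
| "other N2 = N1"

lemma other_simps [simp]: "other i \<noteq> i" "i \<noteq> other i" "other (other i) = i"
  by (cases i; simp)+

lemma neq_iff_other: "k \<noteq> i \<longleftrightarrow> k = other i"
  by (cases i; cases k; simp)

lemma b8_cases [case_names B0 B11 B12 B21 B22 B31 B32 B4]:
  obtains "b = B0" | "b = B1 N1" | "b = B1 N2" | "b = B2 N1" | "b = B2 N2" | "b = B3 N1" | "b = B3 N2" | "b = B4"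
  using b8.exhaust[of b] node.exhaust by metis

lemma UNIV_b8: "UNIV = {B0, B1 N1, B1 N2, B2 N1, B2 N2, B3 N1, B3 N2, B4}"
proof -
  have "b \<in> {B0, B1 N1, B1 N2, B2 N1, B2 N2, B3 N1, B3 N2, B4}" for b
    by (cases b rule: b8_cases) auto
  then show ?thesis by blast
qed

instance b8 :: finite
  by standard (simp add: UNIV_b8)

text \<open>Sine and cosine, with \<zeta> as imaginary unit and x in the role of the exponential;
  the denominator is \<zeta> - inverse \<zeta> = 2 \<zeta>.\<close>

definition sn :: "complex \<Rightarrow> complex \<Rightarrow> complex" where
  "sn \<zeta> x = (x - inverse x) / (2 * \<zeta>)"

definition cs :: "complex \<Rightarrow> complex" where
  "cs x = (x + inverse x) / 2"

text \<open>The factor by which the eigenvalue of \<open>K\<^sub>i\<close> on a basis vector differs from that on \<open>v\<^sub>h\<close>.\<close>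

fun wt :: "complex \<Rightarrow> node \<Rightarrow> b8 \<Rightarrow> complex" where
  "wt \<zeta> i B0 = 1"
| "wt \<zeta> i (B1 k) = (if k = i then - 1 else \<zeta>)"
| "wt \<zeta> i (B2 k) = - \<zeta>"
| "wt \<zeta> i (B3 k) = (if k = i then \<zeta> else 1)"
| "wt \<zeta> i B4 = - 1"

text \<open>\<open>F_fun\<close> and \<open>E_fun\<close> act on coefficient functions, so each
  equation collects what arrives at one basis vector. The images of the basis vectors are found in
  \<open>F_unit_vec\<close> and \<open>E_unit_vec\<close>.\<close>

fun F_fun :: "node \<Rightarrow> (b8 \<Rightarrow> complex) \<Rightarrow> b8 \<Rightarrow> complex" where
  "F_fun i v B0 = 0"
| "F_fun i v (B1 k) = (if k = i then v B0 else 0)"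
| "F_fun i v (B2 k) = (if k = i then v (B1 (other i)) else 0)"
| "F_fun i v (B3 k) = (if k = i then v (B2 (other i)) else 0)"
| "F_fun i v B4 = v (B3 (other i))"

fun E_fun :: "complex \<Rightarrow> complex \<Rightarrow> node \<Rightarrow> (b8 \<Rightarrow> complex) \<Rightarrow> b8 \<Rightarrow> complex" where
  "E_fun a c i v B0 = a * v (B1 i)"
| "E_fun a c i v (B1 k) = (if k = i then 0 else c * v (B2 i) + a * v (B2 (other i)))"
| "E_fun a c i v (B2 k) = (if k = i then a * v (B3 i) else - c * v (B3 i))"
| "E_fun a c i v (B3 k) = (if k = i then 0 else a * v B4)"
| "E_fun a c i v B4 = 0"

fun vgen :: "complex \<Rightarrow> torus_char \<Rightarrow> gen \<Rightarrow> b8 endo" where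
  "vgen \<zeta> t (GE i) = Endo (E_fun (sn \<zeta> (at_node t i)) (cs (at_node t i)) i)"
| "vgen \<zeta> t (GF i) = Endo (F_fun i)"
| "vgen \<zeta> t (GK i) = Endo (\<lambda>v b. at_node t i * wt \<zeta> i b * v b)"
| "vgen \<zeta> t (GKinv i) = Endo (\<lambda>v b. inverse (at_node t i * wt \<zeta> i b) * v b)"

lemma app_vgen:
  "app (vgen \<zeta> t (GE i)) = E_fun (sn \<zeta> (at_node t i)) (cs (at_node t i)) i"
  "app (vgen \<zeta> t (GF i)) = F_fun i"
  "app (vgen \<zeta> t (GK i)) = (\<lambda>v b. at_node t i * wt \<zeta> i b * v b)"
  "app (vgen \<zeta> t (GKinv i)) = (\<lambda>v b. inverse (at_node t i * wt \<zeta> i b) * v b)"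
proof -
  have "E_fun a c i (f + g) b = E_fun a c i f b + E_fun a c i g b"
    "E_fun a c i (cscale k f) b = k * E_fun a c i f b"
    "F_fun i (f + g) b = F_fun i f b + F_fun i g b"
    "F_fun i (cscale k f) b = k * F_fun i f b" for a c f g b k
    by (cases b; simp add: algebra_simps)+
  then show "app (vgen \<zeta> t (GE i)) = E_fun (sn \<zeta> (at_node t i)) (cs (at_node t i)) i"
    "app (vgen \<zeta> t (GF i)) = F_fun i"
    by (simp_all add: app_Endo clinear_def fun_eq_iff)
qed (simp_all add: app_Endo clinear_def fun_eq_iff algebra_simps)

declare vgen.simps [simp del]

text \<open>A check on eight basis vectors. Only \<open>EF\<close> depends on what \<open>sn\<close>
  and \<open>cs\<close> are; the other relations hold with arbitrary entries in their place.\<close>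

lemma U_rep_vgen:
  assumes z: "\<zeta>\<^sup>2 = - 1" and t: "t \<in> \<P>"
  shows "U_rep \<zeta> (vgen \<zeta> t)"
proof -
  have z2: "\<zeta> * \<zeta> = - 1" and nz: "\<zeta> \<noteq> 0" using z by (auto simp: power2_eq_square)
  note zp = zeta_powi[OF z]
  have tn: "at_node t i \<noteq> 0" for i using t by (cases i) (auto simp: \<P>_def)
  have wtn: "wt \<zeta> i b \<noteq> 0" for i b using nz by (cases b) auto
  have sn: "sn \<zeta> x = - (\<zeta> / 2) * (x - inverse x)" for x
    unfolding sn_def divide_inverse[of "x - inverse x"] inverse_mult_distrib zp(4) by simp
  have "\<zeta> - inverse \<zeta> = 2 * \<zeta>" by (simp add: zp(4))
  then have d: "1 / (\<zeta> - inverse \<zeta>) = - (\<zeta> / 2)"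
    by (simp only: divide_inverse inverse_mult_distrib zp(4)) simp
  have z3: "\<zeta> * (\<zeta> * x) = - x" for x using z2 by (simp flip: mult.assoc)
  let ?g = "vgen \<zeta> t"
  have KK: "app (?g (GK i) * ?g (GKinv i)) v b = app 1 v b" "app (?g (GKinv i) * ?g (GK i)) v b = app 1 v b" for i v b
  proof -
    have c: "at_node t i * wt \<zeta> i b \<noteq> 0" using tn wtn by simp
    have inv: "c * (inverse c * x) = x" "inverse c * (c * x) = x" if "c \<noteq> 0" for c x :: complex
      using that by (simp_all flip: mult.assoc)
    show "app (?g (GK i) * ?g (GKinv i)) v b = app 1 v b" "app (?g (GKinv i) * ?g (GK i)) v b = app 1 v b"
      by (simp_all only: app_endo app_vgen inv[OF c])
  qed
  have EE: "app (?g (GE i) * ?g (GE i)) v b = app 0 v b" for i v b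
    by (cases i; cases b rule: b8_cases) (simp_all add: app_vgen)
  have FF: "app (?g (GF i) * ?g (GF i)) v b = app 0 v b" for i v b
    by (cases i; cases b rule: b8_cases) (simp_all add: app_vgen)
  have K: "app (?g (GK i) * ?g (GK j)) v b = app (?g (GK j) * ?g (GK i)) v b" for i j v b
    by (simp add: app_vgen)
  have KE: "app (?g (GK i) * ?g (GE j)) v b = app (sce (\<zeta> powi cartan i j) * (?g (GE j) * ?g (GK i))) v b" for i j v b
    by (cases i; cases j; cases b rule: b8_cases)
       (simp_all add: app_vgen cartan_def zp z z2 z3 algebra_simps)
  have KF: "app (?g (GK i) * ?g (GF j)) v b = app (sce (\<zeta> powi (- cartan i j)) * (?g (GF j) * ?g (GK i))) v b" for i j v b
    by (cases i; cases j; cases b rule: b8_cases)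
       (simp_all add: app_vgen cartan_def zp z z2 z3 algebra_simps)
  have EF: "app (?g (GE i) * ?g (GF j)) v b = app (?g (GF j) * ?g (GE i) +
         (if i = j then sce (1 / (\<zeta> - inverse \<zeta>)) * (?g (GK i) - ?g (GKinv i)) else 0)) v b" for i j v b
    unfolding d
    by (cases i; cases j; cases b rule: b8_cases)
       (simp_all add: app_vgen sn cs_def zp(4) z z2 z3 algebra_simps)
  have BE: "app (?g (GE N1) * (?g (GE N2) * (?g (GE N1) * ?g (GE N2)))) v b =
       app (?g (GE N2) * (?g (GE N1) * (?g (GE N2) * ?g (GE N1)))) v b" for v b
    by (cases b rule: b8_cases) (simp_all add: app_vgen algebra_simps)
  have BF: "app (?g (GF N1) * (?g (GF N2) * (?g (GF N1) * ?g (GF N2)))) v b =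
       app (?g (GF N2) * (?g (GF N1) * (?g (GF N2) * ?g (GF N1)))) v b" for v b
    by (cases b rule: b8_cases) (simp_all add: app_vgen algebra_simps)
  show ?thesis
    unfolding U_rep_def by (intro conjI allI endo_eqI ext) (rule KK EE FF K KE KF EF BE BF)+
qed


section \<open>Modules with a coordinate description\<close>

text \<open>An isomorphism from functions with the action \<open>rep g\<close> onto M. Zero and
  addition are listed because M is a bare record for which no module axioms are known.\<close>

definition models :: "complex \<Rightarrow> 'm U_module \<Rightarrow> (gen \<Rightarrow> 'b endo) \<Rightarrow> (('b \<Rightarrow> complex) \<Rightarrow> 'm) \<Rightarrow> bool" where
  "models \<zeta> M g \<Phi> \<longleftrightarrow> inj \<Phi> \<and> carrier M = range \<Phi> \<and> \<zero>\<^bsub>M\<^esub> = \<Phi> 0 \<and>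
     (\<forall>f h. \<Phi> f \<oplus>\<^bsub>M\<^esub> \<Phi> h = \<Phi> (f + h)) \<and>
     (\<forall>x f. U_class \<zeta> x \<odot>\<^bsub>M\<^esub> \<Phi> f = \<Phi> (app (rep g x) f))"

lemma modelsD:
  assumes "models \<zeta> M g \<Phi>"
  shows "inj \<Phi>" "carrier M = range \<Phi>" "\<zero>\<^bsub>M\<^esub> = \<Phi> 0" "\<Phi> f \<oplus>\<^bsub>M\<^esub> \<Phi> h = \<Phi> (f + h)"
    "U_class \<zeta> x \<odot>\<^bsub>M\<^esub> \<Phi> f = \<Phi> (app (rep g x) f)" "\<Phi> f = \<Phi> h \<longleftrightarrow> f = h"
  using assms by (auto simp: models_def inj_eq)

definition csubspace :: "('b \<Rightarrow> complex) set \<Rightarrow> bool" where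
  "csubspace W \<longleftrightarrow> 0 \<in> W \<and> (\<forall>f\<in>W. \<forall>h\<in>W. f + h \<in> W) \<and> (\<forall>c. \<forall>f\<in>W. cscale c f \<in> W)"

lemma csubspace_minus: "csubspace W \<Longrightarrow> f \<in> W \<Longrightarrow> - f \<in> W"
proof -
  assume "csubspace W" "f \<in> W"
  then have "cscale (- 1) f \<in> W" by (auto simp: csubspace_def)
  then show ?thesis by (simp add: cscale_def fun_Compl_def)
qed

lemma models_group:
  assumes "models \<zeta> M g \<Phi>"
  shows "Group.group (add_monoid (complex_vs \<zeta> M))"
proof (rule groupI)
  note m = modelsD[OF assms]
  show "\<exists>y\<in>carrier (add_monoid (complex_vs \<zeta> M)).
      y \<otimes>\<^bsub>add_monoid (complex_vs \<zeta> M)\<^esub> x = \<one>\<^bsub>add_monoid (complex_vs \<zeta> M)\<^esub>"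
    if x: "x \<in> carrier (add_monoid (complex_vs \<zeta> M))" for x
  proof -
    obtain f where "x = \<Phi> f" using x by (auto simp: m complex_vs_def)
    then show ?thesis by (intro bexI[of _ "\<Phi> (- f)"]) (simp_all add: m complex_vs_def)
  qed
qed (auto simp: modelsD[OF assms] complex_vs_def add.assoc)

lemma submodule_models:
  assumes "models \<zeta> M g \<Phi>"
  shows "submodule H complex_ring (complex_vs \<zeta> M) \<longleftrightarrow> (\<exists>W. csubspace W \<and> H = \<Phi> ` W)"
proof
  note m = modelsD[OF assms]
  assume "submodule H complex_ring (complex_vs \<zeta> M)"
  then interpret H: submodule H complex_ring "complex_vs \<zeta> M" .
  have sm: "U_class \<zeta> (scal c) \<odot>\<^bsub>M\<^esub> \<Phi> f = \<Phi> (cscale c f)" for c f by (simp add: m)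
  have "H \<subseteq> range \<Phi>" using H.subset by (simp add: complex_vs_def m)
  then have "H = \<Phi> ` (\<Phi> -` H)" by auto
  moreover have "csubspace (\<Phi> -` H)"
    unfolding csubspace_def
    using H.one_closed H.m_closed H.smult_closed
    by (auto simp: complex_vs_def m(3) simp flip: m(4) sm)
  ultimately show "\<exists>W. csubspace W \<and> H = \<Phi> ` W" by blast
next
  note m = modelsD[OF assms]
  assume "\<exists>W. csubspace W \<and> H = \<Phi> ` W"
  then obtain W where W: "csubspace W" "H = \<Phi> ` W" by blast
  have "Group.group (add_monoid (complex_vs \<zeta> M))"
    by (rule models_group[OF assms])
  moreover have "inv\<^bsub>add_monoid (complex_vs \<zeta> M)\<^esub> \<Phi> f = \<Phi> (- f)" for f
    by (rule group.inv_equality[OF calculation]) (simp_all add: complex_vs_def m)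
  ultimately have "subgroup H (add_monoid (complex_vs \<zeta> M))"
    using W csubspace_minus[OF W(1)]
    by (intro group.subgroupI) (auto simp: complex_vs_def m csubspace_def)
  then show "submodule H complex_ring (complex_vs \<zeta> M)"
    using W by (auto intro!: submodule.intro submodule_axioms.intro simp: complex_vs_def m csubspace_def)
qed

text \<open>Submodules correspond to subspaces of functions by \<open>submodule_models\<close>.
  Spanning is phrased through the subspaces W that contain the products, which suits the
  obstructions: there W is given by the vanishing of one coordinate.\<close>

lemma homogeneous_cyclic_models:
  assumes "models \<zeta> M g \<Phi>"
  shows "homogeneous_cyclic \<zeta> M \<longleftrightarrow>
    (\<exists>v. v \<noteq> 0 \<and> (\<forall>i. \<exists>c. app (g (GK i)) v = cscale c v) \<and>
      (\<forall>W. csubspace W \<and> (\<forall>\<psi>\<in>\<Psi>. \<forall>\<psi>'\<in>\<Psi>. app (rep g (F_pow \<zeta> \<psi> * E_pow \<zeta> \<psi>')) v \<in> W) \<longrightarrow> W = UNIV))"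
proof -
  note m = modelsD[OF assms]
  have span: "complex_span \<zeta> M {U_class \<zeta> (F_pow \<zeta> \<psi> * E_pow \<zeta> \<psi>') \<odot>\<^bsub>M\<^esub> \<Phi> v | \<psi> \<psi>'. \<psi> \<in> \<Psi> \<and> \<psi>' \<in> \<Psi>} = carrier M \<longleftrightarrow>
      (\<forall>W. csubspace W \<and> (\<forall>\<psi>\<in>\<Psi>. \<forall>\<psi>'\<in>\<Psi>. app (rep g (F_pow \<zeta> \<psi> * E_pow \<zeta> \<psi>')) v \<in> W) \<longrightarrow> W = UNIV)"
    (is "complex_span \<zeta> M ?S = _ \<longleftrightarrow> ?R") for v
  proof -
    have W: "\<Phi> ` W = range \<Phi> \<longleftrightarrow> W = UNIV" for W
      using inj_image_eq_iff[OF m(1), of W UNIV] by simp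
    have S: "?S \<subseteq> \<Phi> ` W \<longleftrightarrow> (\<forall>\<psi>\<in>\<Psi>. \<forall>\<psi>'\<in>\<Psi>. app (rep g (F_pow \<zeta> \<psi> * E_pow \<zeta> \<psi>')) v \<in> W)" for W
    proof -
      have "?S \<subseteq> \<Phi> ` W \<longleftrightarrow> (\<forall>\<psi>\<in>\<Psi>. \<forall>\<psi>'\<in>\<Psi>. \<Phi> (app (rep g (F_pow \<zeta> \<psi> * E_pow \<zeta> \<psi>')) v) \<in> \<Phi> ` W)"
        unfolding m(5) subset_iff mem_Collect_eq by metis
      then show ?thesis unfolding inj_image_mem_iff[OF m(1)] .
    qed
    define A where "A = ?S"
    have U: "csubspace UNIV" by (auto simp: csubspace_def)
    have A: "A \<subseteq> range \<Phi>" unfolding A_def m(5) by blast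
    have "complex_span \<zeta> M A = \<Inter>{\<Phi> ` W | W. csubspace W \<and> A \<subseteq> \<Phi> ` W}"
      unfolding complex_span_def submodule_models[OF assms] by (rule arg_cong[where f = Inter], rule Collect_cong) metis
    also have "\<dots> = range \<Phi> \<longleftrightarrow> (\<forall>W. csubspace W \<and> A \<subseteq> \<Phi> ` W \<longrightarrow> \<Phi> ` W = range \<Phi>)"
      (is "\<Inter>?Z = _ \<longleftrightarrow> ?P")
    proof
      assume *: "\<Inter>?Z = range \<Phi>"
      show ?P
      proof (intro allI impI)
        fix W assume "csubspace W \<and> A \<subseteq> \<Phi> ` W"
        then have "\<Phi> ` W \<in> ?Z" unfolding mem_Collect_eq by metis
        then have "\<Inter>?Z \<subseteq> \<Phi> ` W" by (rule Inter_lower)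
        then show "\<Phi> ` W = range \<Phi>" unfolding * by (rule antisym[OF image_mono[OF subset_UNIV]])
      qed
    next
      assume *: ?P
      have Z: "Z = range \<Phi>" if "Z \<in> ?Z" for Z
        using that * unfolding mem_Collect_eq by metis
      have "range \<Phi> \<in> ?Z"
        unfolding mem_Collect_eq using U A by metis
      then have "\<Inter>?Z \<subseteq> range \<Phi>" by (rule Inter_lower)
      moreover have "range \<Phi> \<subseteq> \<Inter>?Z"
        by (rule Inter_greatest) (drule Z, simp)
      ultimately show "\<Inter>?Z = range \<Phi>" by (rule antisym)
    qed
    finally have "complex_span \<zeta> M ?S = range \<Phi> \<longleftrightarrow> (\<forall>W. csubspace W \<and> ?S \<subseteq> \<Phi> ` W \<longrightarrow> \<Phi> ` W = range \<Phi>)"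
      unfolding A_def .
    then show ?thesis unfolding W S m(2) .
  qed
  have "homogeneous_cyclic \<zeta> M \<longleftrightarrow> (\<exists>v. homogeneous_cyclic_vector \<zeta> M (\<Phi> v))"
    unfolding homogeneous_cyclic_def homogeneous_cyclic_vector_def weight_vector_def m(2) by blast
  moreover have "weight_vector \<zeta> M (\<Phi> v) \<longleftrightarrow> v \<noteq> 0 \<and> (\<forall>i. \<exists>c. app (g (GK i)) v = cscale c v)" for v
    unfolding weight_vector_def m(2,3,5,6) rep_simps(7,8) app_sce by simp
  ultimately show ?thesis
    unfolding homogeneous_cyclic_vector_def span by (simp only: conj_assoc)
qed


section \<open>Coordinates on a tensor product\<close>

text \<open>The additive extension of \<pi> to formal sums, that is, to the free abelian group on
  its arguments.\<close>

definition add_ext :: "('a \<Rightarrow> 'b \<Rightarrow> complex) \<Rightarrow> ('a \<Rightarrow>\<^sub>0 int) \<Rightarrow> 'b \<Rightarrow> complex" where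
  "add_ext \<pi> z = (\<Sum>k\<in>Poly_Mapping.keys z. cscale (of_int (Poly_Mapping.lookup z k)) (\<pi> k))"

lemma add_ext_superset:
  "finite A \<Longrightarrow> Poly_Mapping.keys z \<subseteq> A \<Longrightarrow>
    add_ext \<pi> z = (\<Sum>k\<in>A. cscale (of_int (Poly_Mapping.lookup z k)) (\<pi> k))"
  unfolding add_ext_def by (rule sum.mono_neutral_left) (auto simp: in_keys_iff fun_eq_iff)

lemma add_ext_simps [simp]:
  "add_ext \<pi> 0 = 0" "add_ext \<pi> (frag_of k) = \<pi> k" "add_ext \<pi> (x + y) = add_ext \<pi> x + add_ext \<pi> y"
  "add_ext \<pi> (- x) = - add_ext \<pi> x" "add_ext \<pi> (x - y) = add_ext \<pi> x - add_ext \<pi> y"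
proof -
  show 0: "add_ext \<pi> 0 = 0" by (simp add: add_ext_def)
  show "add_ext \<pi> (frag_of k) = \<pi> k" by (simp add: add_ext_def cscale_def)
  show p: "add_ext \<pi> (x + y) = add_ext \<pi> x + add_ext \<pi> y" for x y
    using keys_add[of x y]
    by (simp add: add_ext_superset[of "Poly_Mapping.keys x \<union> Poly_Mapping.keys y"] lookup_add
        fun_eq_iff sum_fun_apply sum.distrib ring_distribs)
  show m: "add_ext \<pi> (- x) = - add_ext \<pi> x" for x
    using p[of "- x" x] 0 by (simp only: left_minus eq_neg_iff_add_eq_0)
  show "add_ext \<pi> (x - y) = add_ext \<pi> x - add_ext \<pi> y"
    using p[of x "- y"] m by simp
qed

lemma add_ext_sum: "add_ext \<pi> (\<Sum>i\<in>I. f i) = (\<Sum>i\<in>I. add_ext \<pi> (f i))"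
  by (induction I rule: infinite_finite_induct) (simp_all del: plus_fun_apply zero_fun_apply)

lemma add_ext_extend:
  assumes "\<And>k. k \<in> Poly_Mapping.keys y \<Longrightarrow> add_ext \<pi> (h k) = app A (\<pi> k)"
  shows "add_ext \<pi> (frag_extend h y) = app A (add_ext \<pi> y)"
proof -
  have c: "add_ext \<pi> (frag_cmul c x) = cscale (of_int c) (add_ext \<pi> x)" for c x
    by (simp add: add_ext_superset[of "Poly_Mapping.keys x"] fun_eq_iff sum_fun_apply sum_distrib_left subset_iff mult.assoc)
  show ?thesis
    by (simp add: frag_extend_def add_ext_sum c assms add_ext_def[of \<pi> y] app_sum app_cscale)
qed

text \<open>A balanced biadditive map, hence a map out of the tensor product: it shows that the
  tensor product is large enough.\<close>

locale tensor_form =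
  fixes R :: "('r, 'x) ring_scheme" and M :: "('m, 'y) ring_scheme" and ract :: "'m \<Rightarrow> 'r \<Rightarrow> 'm"
    and N :: "('r, 'n, 'z) module_scheme" and \<pi> :: "'m \<times> 'n \<Rightarrow> 'b \<Rightarrow> complex"
  assumes closed: "m \<in> carrier M \<Longrightarrow> m' \<in> carrier M \<Longrightarrow> m \<oplus>\<^bsub>M\<^esub> m' \<in> carrier M"
      "n \<in> carrier N \<Longrightarrow> n' \<in> carrier N \<Longrightarrow> n \<oplus>\<^bsub>N\<^esub> n' \<in> carrier N"
      "m \<in> carrier M \<Longrightarrow> r \<in> carrier R \<Longrightarrow> ract m r \<in> carrier M"
      "r \<in> carrier R \<Longrightarrow> n \<in> carrier N \<Longrightarrow> r \<odot>\<^bsub>N\<^esub> n \<in> carrier N"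
    and biadditive:
      "m \<in> carrier M \<Longrightarrow> m' \<in> carrier M \<Longrightarrow> n \<in> carrier N \<Longrightarrow> \<pi> (m \<oplus>\<^bsub>M\<^esub> m', n) = \<pi> (m, n) + \<pi> (m', n)"
      "m \<in> carrier M \<Longrightarrow> n \<in> carrier N \<Longrightarrow> n' \<in> carrier N \<Longrightarrow> \<pi> (m, n \<oplus>\<^bsub>N\<^esub> n') = \<pi> (m, n) + \<pi> (m, n')"
    and balanced: "m \<in> carrier M \<Longrightarrow> r \<in> carrier R \<Longrightarrow> n \<in> carrier N \<Longrightarrow> \<pi> (ract m r, n) = \<pi> (m, r \<odot>\<^bsub>N\<^esub> n)"
begin

abbreviation G :: "('m \<times> 'n \<Rightarrow>\<^sub>0 int) monoid" where
  "G \<equiv> free_Abelian_group (carrier M \<times> carrier N)"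

abbreviation S :: "('m \<times> 'n \<Rightarrow>\<^sub>0 int) set" where
  "S \<equiv> tensor_subgroup R M ract N"

lemma relations_subset: "tensor_relations R M ract N \<subseteq> carrier G"
proof -
  have d: "Poly_Mapping.keys (frag_of a - frag_of b) \<subseteq> {a, b}"
    "Poly_Mapping.keys (frag_of a - frag_of b - frag_of c) \<subseteq> {a, b, c}" for a b c :: "'m \<times> 'n"
    by (auto simp: in_keys_iff lookup_minus split: if_splits)
  show ?thesis
    unfolding tensor_relations_def
    by (auto simp del: frag_of_in_free_Abelian_group dest!: d[THEN subsetD] simp: closed)
qed

lemma S_subgroup: "subgroup S G"
  unfolding tensor_subgroup_def
  by (rule group.generate_is_subgroup[OF group_free_Abelian_group relations_subset])

lemma S_keys: "z \<in> S \<Longrightarrow> Poly_Mapping.keys z \<subseteq> carrier M \<times> carrier N"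
  using subgroup.mem_carrier[OF S_subgroup, of z] unfolding carrier_free_Abelian_group_iff .

lemma S_closed:
  "0 \<in> S" "x \<in> S \<Longrightarrow> y \<in> S \<Longrightarrow> x + y \<in> S" "x \<in> S \<Longrightarrow> - x \<in> S" "x \<in> S \<Longrightarrow> y \<in> S \<Longrightarrow> x - y \<in> S"
proof -
  show "0 \<in> S" using subgroup.one_closed[OF S_subgroup] by simp
  show p: "x \<in> S \<Longrightarrow> y \<in> S \<Longrightarrow> x + y \<in> S" for x y
    using subgroup.m_closed[OF S_subgroup, of x y] by simp
  show m: "x \<in> S \<Longrightarrow> - x \<in> S" for x
    using subgroup.m_inv_closed[OF S_subgroup, of x] S_keys[of x] by simp
  show "x \<in> S \<Longrightarrow> y \<in> S \<Longrightarrow> x - y \<in> S"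
    using p[of x "- y"] m[of y] by simp
qed

lemma S_sum: "(\<And>i. i \<in> I \<Longrightarrow> f i \<in> S) \<Longrightarrow> (\<Sum>i\<in>I. f i) \<in> S"
  by (induction I rule: infinite_finite_induct) (simp_all add: S_closed)

lemma S_relations:
  "m \<in> carrier M \<Longrightarrow> m' \<in> carrier M \<Longrightarrow> n \<in> carrier N \<Longrightarrow>
    frag_of (m \<oplus>\<^bsub>M\<^esub> m', n) - frag_of (m, n) - frag_of (m', n) \<in> S"
  "m \<in> carrier M \<Longrightarrow> n \<in> carrier N \<Longrightarrow> n' \<in> carrier N \<Longrightarrow>
    frag_of (m, n \<oplus>\<^bsub>N\<^esub> n') - frag_of (m, n) - frag_of (m, n') \<in> S"
  "m \<in> carrier M \<Longrightarrow> r \<in> carrier R \<Longrightarrow> n \<in> carrier N \<Longrightarrow>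
    frag_of (ract m r, n) - frag_of (m, r \<odot>\<^bsub>N\<^esub> n) \<in> S"
proof -
  have rel: "r \<in> tensor_relations R M ract N \<Longrightarrow> r \<in> S" for r
    unfolding tensor_subgroup_def by (rule generate.incl)
  show "m \<in> carrier M \<Longrightarrow> m' \<in> carrier M \<Longrightarrow> n \<in> carrier N \<Longrightarrow>
    frag_of (m \<oplus>\<^bsub>M\<^esub> m', n) - frag_of (m, n) - frag_of (m', n) \<in> S"
    by (rule rel, unfold tensor_relations_def, rule UnI1, rule UnI1, rule CollectI, (rule exI)+, rule conjI[OF refl], intro conjI)
  show "m \<in> carrier M \<Longrightarrow> n \<in> carrier N \<Longrightarrow> n' \<in> carrier N \<Longrightarrow>
    frag_of (m, n \<oplus>\<^bsub>N\<^esub> n') - frag_of (m, n) - frag_of (m, n') \<in> S"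
    by (rule rel, unfold tensor_relations_def, rule UnI1, rule UnI2, rule CollectI, (rule exI)+, rule conjI[OF refl], intro conjI)
  show "m \<in> carrier M \<Longrightarrow> r \<in> carrier R \<Longrightarrow> n \<in> carrier N \<Longrightarrow>
    frag_of (ract m r, n) - frag_of (m, r \<odot>\<^bsub>N\<^esub> n) \<in> S"
    by (rule rel, unfold tensor_relations_def, rule UnI2, rule CollectI, (rule exI)+, rule conjI[OF refl], intro conjI)
qed

lemma S_induct [consumes 1, case_names relation plus minus]:
  assumes "z \<in> S" and rel: "\<And>r. r \<in> tensor_relations R M ract N \<Longrightarrow> P r"
    and plus: "\<And>x y. x \<in> S \<Longrightarrow> y \<in> S \<Longrightarrow> P x \<Longrightarrow> P y \<Longrightarrow> P (x + y)" and minus: "\<And>r. r \<in> tensor_relations R M ract N \<Longrightarrow> P r \<Longrightarrow> P (- r)"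
    and zero: "P 0"
  shows "P z"
proof -
  have "z \<in> generate G (tensor_relations R M ract N)" using assms(1) by (simp add: tensor_subgroup_def)
  then show ?thesis
  proof induction
    case one
    then show ?case using zero by simp
  next
    case (incl h)
    then show ?case by (rule rel)
  next
    case (inv h)
    then have "Poly_Mapping.keys h \<subseteq> carrier M \<times> carrier N"
      by (rule subsetD[OF relations_subset, unfolded carrier_free_Abelian_group_iff])
    then have "inv\<^bsub>G\<^esub> h = - h" by (rule inv_free_Abelian_group)
    then show ?case using minus[OF inv rel[OF inv]] by simp
  next
    case (eng h1 h2)
    then show ?case using plus by (simp add: tensor_subgroup_def)
  qed
qed

lemma add_ext_S: "z \<in> S \<Longrightarrow> add_ext \<pi> z = 0"
proof (induction rule: S_induct)
  case (relation r)
  then show ?case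
    unfolding tensor_relations_def by (auto simp: biadditive balanced simp del: plus_fun_apply zero_fun_apply)
qed (simp_all del: plus_fun_apply zero_fun_apply)

end

text \<open>A section \<sigma>, additive modulo the relations and inverse to \<pi> on pure tensors,
  shows that the tensor product is no larger than the function space.\<close>

locale tensor_model = tensor_form R M ract N \<pi>
  for R :: "('r, 'x) ring_scheme" and M :: "('m, 'y) ring_scheme" and ract and N :: "('r, 'n, 'z) module_scheme"
    and \<pi> :: "'m \<times> 'n \<Rightarrow> 'b \<Rightarrow> complex" +
  fixes \<sigma> :: "('b \<Rightarrow> complex) \<Rightarrow> ('m \<times> 'n \<Rightarrow>\<^sub>0 int)"
  assumes section_carrier: "Poly_Mapping.keys (\<sigma> f) \<subseteq> carrier M \<times> carrier N"
    and section_add: "\<sigma> (f + g) - \<sigma> f - \<sigma> g \<in> tensor_subgroup R M ract N"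
    and section_right: "add_ext \<pi> (\<sigma> f) = f"
    and section_left: "m \<in> carrier M \<Longrightarrow> n \<in> carrier N \<Longrightarrow> frag_of (m, n) - \<sigma> (\<pi> (m, n)) \<in> tensor_subgroup R M ract N"
begin

lemma section_diff: "\<sigma> f - \<sigma> g - \<sigma> (f - g) \<in> S"
proof -
  have eq: "p - q - r = p - r - q" for p q r :: "'m \<times> 'n \<Rightarrow>\<^sub>0 int" by simp
  show ?thesis
    using section_add[of "f - g" g] unfolding diff_add_cancel by (subst eq)
qed

lemma section_zero: "\<sigma> 0 \<in> S"
proof -
  have eq: "- (p - p - p) = p" for p :: "'m \<times> 'n \<Rightarrow>\<^sub>0 int" by simp
  show ?thesis
    using S_closed(3)[OF section_add[of 0 0]] unfolding add_0_left eq .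
qed

lemma congruent_section:
  assumes "Poly_Mapping.keys z \<subseteq> carrier M \<times> carrier N"
  shows "z - \<sigma> (add_ext \<pi> z) \<in> S"
  using assms
proof (induction z rule: frag_induction)
  case zero
  then show ?case using S_closed(3)[OF section_zero] by (simp only: add_ext_simps diff_0)
next
  case (one x)
  then show ?case using section_left by (cases x) simp
next
  case (diff a b)
  have eq: "x - y - w = (x - p - (y - q)) + (p - q - w)" for x y p q w :: "'m \<times> 'n \<Rightarrow>\<^sub>0 int"
    by simp
  from S_closed(2)[OF S_closed(4)[OF diff] section_diff[of "add_ext \<pi> a" "add_ext \<pi> b"]]
  show ?case
    by (simp only: add_ext_simps eq[of a b _ "\<sigma> (add_ext \<pi> a)" "\<sigma> (add_ext \<pi> b)"])
qed

text \<open>A formal sum is congruent to the section of its coordinates, and the section of 0 lies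
  in S.\<close>

lemma S_iff:
  assumes "Poly_Mapping.keys z \<subseteq> carrier M \<times> carrier N"
  shows "z \<in> S \<longleftrightarrow> add_ext \<pi> z = 0"
proof
  assume "add_ext \<pi> z = 0"
  then show "z \<in> S"
    using S_closed(2)[OF congruent_section[OF assms] section_zero] by (simp only: diff_add_cancel)
qed (rule add_ext_S)

text \<open>The elements of the tensor product are cosets of formal sums, and these are the level
  sets of the coordinates; \<open>fiber\<close> is the isomorphism from functions to the tensor
  product.\<close>

definition fiber :: "('b \<Rightarrow> complex) \<Rightarrow> ('m \<times> 'n \<Rightarrow>\<^sub>0 int) set" where
  "fiber f = {z. Poly_Mapping.keys z \<subseteq> carrier M \<times> carrier N \<and> add_ext \<pi> z = f}"

lemma inj_fiber: "inj fiber"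
proof (rule injI)
  fix f g assume "fiber f = fiber g"
  moreover have "\<sigma> f \<in> fiber f" using section_carrier section_right by (simp add: fiber_def)
  ultimately show "f = g" by (simp add: fiber_def section_right)
qed

lemma keys_plus_minus:
  "Poly_Mapping.keys x \<subseteq> A \<Longrightarrow> Poly_Mapping.keys y \<subseteq> A \<Longrightarrow> Poly_Mapping.keys (x + y) \<subseteq> A"
  "Poly_Mapping.keys x \<subseteq> A \<Longrightarrow> Poly_Mapping.keys y \<subseteq> A \<Longrightarrow> Poly_Mapping.keys (x - y) \<subseteq> A"
  for x y :: "'m \<times> 'n \<Rightarrow>\<^sub>0 int"
  using keys_add[of x y] keys_diff[of x y] by blast+

lemma tensor_class_fiber:
  assumes "Poly_Mapping.keys x \<subseteq> carrier M \<times> carrier N"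
  shows "tensor_class R M ract N x = fiber (add_ext \<pi> x)"
proof -
  have "z \<in> S #>\<^bsub>G\<^esub> x \<longleftrightarrow> z - x \<in> S" for z
    by (auto simp: r_coset_def intro!: bexI[of _ "z - x"])
  moreover have "z - x \<in> S \<longleftrightarrow> z \<in> fiber (add_ext \<pi> x)" for z
  proof
    assume *: "z - x \<in> S"
    then have "Poly_Mapping.keys (z - x + x) \<subseteq> carrier M \<times> carrier N"
      by (intro keys_plus_minus S_keys assms)
    then show "z \<in> fiber (add_ext \<pi> x)" using add_ext_S[OF *] by (simp add: fiber_def del: mem_Times_iff)
  next
    assume "z \<in> fiber (add_ext \<pi> x)"
    then show "z - x \<in> S" using assms by (subst S_iff) (simp_all add: fiber_def keys_plus_minus)
  qed
  ultimately show ?thesis unfolding tensor_class_def by blast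
qed

lemma tensor_carrier: "carrier (tensor_module R M ract N act) = range fiber"
proof -
  have "carrier (tensor_module R M ract N act) =
      {tensor_class R M ract N x | x. Poly_Mapping.keys x \<subseteq> carrier M \<times> carrier N}"
    by (auto simp: tensor_module_def Let_def FactGroup_def RCOSETS_def tensor_class_def)
  also have "\<dots> = range fiber"
  proof (intro equalityI subsetI)
    fix T assume "T \<in> range fiber"
    then obtain f where "T = fiber f" by blast
    then have "T = tensor_class R M ract N (\<sigma> f)"
      using section_carrier by (simp add: tensor_class_fiber section_right)
    then show "T \<in> {tensor_class R M ract N x | x. Poly_Mapping.keys x \<subseteq> carrier M \<times> carrier N}"
      using section_carrier by blast
  qed (auto simp: tensor_class_fiber)
  finally show ?thesis .
qed

lemma tensor_add: "fiber f \<oplus>\<^bsub>tensor_module R M ract N act\<^esub> fiber g = fiber (f + g)"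
proof -
  have "fiber f <#>\<^bsub>G\<^esub> fiber g = fiber (f + g)"
  proof (intro equalityI subsetI)
    fix z assume "z \<in> fiber (f + g)"
    then have "z - \<sigma> g \<in> fiber f" "\<sigma> g \<in> fiber g"
      using section_carrier by (simp_all add: fiber_def section_right keys_plus_minus)
    moreover have "z = (z - \<sigma> g) + \<sigma> g" by simp
    ultimately show "z \<in> fiber f <#>\<^bsub>G\<^esub> fiber g"
      unfolding set_mult_def mult_free_Abelian_group by blast
  next
    fix z assume "z \<in> fiber f <#>\<^bsub>G\<^esub> fiber g"
    then obtain x y where "z = x + y" "x \<in> fiber f" "y \<in> fiber g"
      unfolding set_mult_def mult_free_Abelian_group by blast
    then show "z \<in> fiber (f + g)" by (simp add: fiber_def keys_plus_minus)
  qed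
  then show ?thesis by (simp add: tensor_module_def Let_def FactGroup_def)
qed

lemma tensor_zero: "\<zero>\<^bsub>tensor_module R M ract N act\<^esub> = fiber 0"
proof -
  have "S = fiber 0" using S_iff S_keys by (auto simp: fiber_def)
  then show ?thesis by (simp add: tensor_module_def Let_def FactGroup_def)
qed

lemma tensor_smult: "u \<odot>\<^bsub>tensor_module R M ract N act\<^esub> T = act u T"
  by (simp add: tensor_module_def Let_def)

text \<open>Serves both module structures: left multiplication on \<open>V(t)\<close> and the action
  through the coproduct.\<close>

lemma tensor_class_extend:
  assumes h: "\<And>m n. m \<in> carrier M \<Longrightarrow> n \<in> carrier N \<Longrightarrow>
      Poly_Mapping.keys (h (m, n)) \<subseteq> carrier M \<times> carrier N \<and> add_ext \<pi> (h (m, n)) = app A (\<pi> (m, n))"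
    and y: "y \<in> fiber f"
  shows "tensor_class R M ract N (frag_extend h y) = fiber (app A f)"
proof -
  have k: "Poly_Mapping.keys y \<subseteq> carrier M \<times> carrier N" "add_ext \<pi> y = f"
    using y by (auto simp: fiber_def)
  have "Poly_Mapping.keys (frag_extend h y) \<subseteq> (\<Union>x\<in>Poly_Mapping.keys y. Poly_Mapping.keys (h x))"
    by (rule keys_frag_extend)
  also have "\<dots> \<subseteq> carrier M \<times> carrier N" using k(1) h by blast
  finally have "tensor_class R M ract N (frag_extend h y) = fiber (add_ext \<pi> (frag_extend h y))"
    by (rule tensor_class_fiber)
  also have "add_ext \<pi> (frag_extend h y) = app A f"
    unfolding k(2)[symmetric] using k(1) h by (intro add_ext_extend) auto
  finally show ?thesis .
qed

lemma fiber_nonempty: "fiber f \<noteq> {}"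
  using section_carrier section_right unfolding fiber_def by blast

end


section \<open>Coordinates on the Verma module\<close>

lemma cscale_simps [simp]:
  "cscale c (cscale d f) = cscale (c * d) f" "cscale c 0 = 0" "cscale 0 f = 0" "cscale 1 f = f"
  by (simp_all add: fun_eq_iff)

lemma app_vgen_unit_vec:
  "app (vgen \<zeta> t (GK i)) (unit_vec b) = cscale (at_node t i * wt \<zeta> i b) (unit_vec b)"
  "app (vgen \<zeta> t (GKinv i)) (unit_vec b) = cscale (inverse (at_node t i * wt \<zeta> i b)) (unit_vec b)"
  by (simp_all add: app_vgen fun_eq_iff unit_vec_def)

lemma E_unit_vec:
  "app (vgen \<zeta> t (GE i)) (unit_vec B0) = 0"
  "app (vgen \<zeta> t (GE i)) (unit_vec (B1 k)) = cscale (if k = i then sn \<zeta> (at_node t i) else 0) (unit_vec B0)"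
  "app (vgen \<zeta> t (GE i)) (unit_vec (B2 k)) =
    cscale (if k = i then cs (at_node t i) else sn \<zeta> (at_node t i)) (unit_vec (B1 (other i)))"
  "app (vgen \<zeta> t (GE i)) (unit_vec (B3 k)) = (if k = i then
    cscale (sn \<zeta> (at_node t i)) (unit_vec (B2 i)) - cscale (cs (at_node t i)) (unit_vec (B2 (other i))) else 0)"
  "app (vgen \<zeta> t (GE i)) (unit_vec B4) = cscale (sn \<zeta> (at_node t i)) (unit_vec (B3 (other i)))"
proof -
  have *: "f = g" if "f B0 = g B0" "\<And>k. f (B1 k) = g (B1 k)" "\<And>k. f (B2 k) = g (B2 k)"
    "\<And>k. f (B3 k) = g (B3 k)" "f B4 = g B4" for f g :: "b8 \<Rightarrow> complex"
    using that by (intro ext) (metis b8.exhaust)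
  note [simp] = app_vgen unit_vec_def
  show "app (vgen \<zeta> t (GE i)) (unit_vec B0) = 0"
    by (rule *) simp_all
  show "app (vgen \<zeta> t (GE i)) (unit_vec (B1 k)) = cscale (if k = i then sn \<zeta> (at_node t i) else 0) (unit_vec B0)"
    by (rule *) simp_all
  show "app (vgen \<zeta> t (GE i)) (unit_vec (B2 k)) =
      cscale (if k = i then cs (at_node t i) else sn \<zeta> (at_node t i)) (unit_vec (B1 (other i)))"
    by (rule *; cases i; cases k) (simp_all split: node.split, auto simp: neq_iff_other)
  show "app (vgen \<zeta> t (GE i)) (unit_vec (B3 k)) = (if k = i then
      cscale (sn \<zeta> (at_node t i)) (unit_vec (B2 i)) - cscale (cs (at_node t i)) (unit_vec (B2 (other i))) else 0)"
    by (rule *; cases i; cases k) (simp_all, auto simp: neq_iff_other)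
  show "app (vgen \<zeta> t (GE i)) (unit_vec B4) = cscale (sn \<zeta> (at_node t i)) (unit_vec (B3 (other i)))"
    by (rule *; cases i) (simp_all, auto simp: neq_iff_other)
qed

lemma F_unit_vec:
  "app (vgen \<zeta> t (GF i)) (unit_vec B0) = unit_vec (B1 i)"
  "app (vgen \<zeta> t (GF i)) (unit_vec (B1 k)) = (if k = i then 0 else unit_vec (B2 i))"
  "app (vgen \<zeta> t (GF i)) (unit_vec (B2 k)) = (if k = i then 0 else unit_vec (B3 i))"
  "app (vgen \<zeta> t (GF i)) (unit_vec (B3 k)) = (if k = i then 0 else unit_vec B4)"
  "app (vgen \<zeta> t (GF i)) (unit_vec B4) = 0"
  by (rule ext; rename_tac b; case_tac b rule: b8_cases; cases i; cases k; simp add: app_vgen unit_vec_def)+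

lemma Uq_borel_simps:
  "carrier (Uq_borel \<zeta>) =
     generate_ring (Uq \<zeta>) (U_class \<zeta> ` (range scal \<union> range genK \<union> range genKinv \<union> range genE))"
  "x \<otimes>\<^bsub>Uq_borel \<zeta>\<^esub> y = x \<otimes>\<^bsub>Uq \<zeta>\<^esub> y" "x \<oplus>\<^bsub>Uq_borel \<zeta>\<^esub> y = x \<oplus>\<^bsub>Uq \<zeta>\<^esub> y"
  "\<one>\<^bsub>Uq_borel \<zeta>\<^esub> = \<one>\<^bsub>Uq \<zeta>\<^esub>"
  by (simp_all add: Uq_borel_def)

text \<open>The predicate concerns elements of the free algebra, while the subalgebra consists of
  cosets; hence the conclusion provides a representative.\<close>

lemma Uq_borel_induct [consumes 1, case_names one scal K Kinv E minus add mult]: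
  assumes "b \<in> carrier (Uq_borel \<zeta>)"
    and "P 1" "\<And>c. P (scal c)" "\<And>i. P (genK i)" "\<And>i. P (genKinv i)" "\<And>i. P (genE i)"
    and "\<And>x. U_class \<zeta> x \<in> carrier (Uq_borel \<zeta>) \<Longrightarrow> P x \<Longrightarrow> P (- x)"
    and "\<And>x y. U_class \<zeta> x \<in> carrier (Uq_borel \<zeta>) \<Longrightarrow> U_class \<zeta> y \<in> carrier (Uq_borel \<zeta>) \<Longrightarrow> P x \<Longrightarrow> P y \<Longrightarrow> P (x + y)"
    and "\<And>x y. U_class \<zeta> x \<in> carrier (Uq_borel \<zeta>) \<Longrightarrow> U_class \<zeta> y \<in> carrier (Uq_borel \<zeta>) \<Longrightarrow> P x \<Longrightarrow> P y \<Longrightarrow> P (x * y)"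
  shows "\<exists>x. b = U_class \<zeta> x \<and> P x"
  using assms(1) unfolding Uq_borel_simps
proof induction
  case one
  show ?case using assms(2) by (auto simp: Uq_simps)
next
  case (incl h)
  then show ?case using assms(3-6) by blast
next
  case (a_inv h)
  then show ?case using assms(7) unfolding Uq_borel_simps by (metis Uq_minus)
next
  case (eng_add h1 h2)
  then show ?case using assms(8) unfolding Uq_borel_simps by (metis Uq_simps(2))
next
  case (eng_mult h1 h2)
  then show ?case using assms(9) unfolding Uq_borel_simps by (metis Uq_simps(1))
qed

lemma borel_generators:
  "U_class \<zeta> (scal c) \<in> carrier (Uq_borel \<zeta>)" "U_class \<zeta> (genK i) \<in> carrier (Uq_borel \<zeta>)"
  "U_class \<zeta> (genKinv i) \<in> carrier (Uq_borel \<zeta>)" "U_class \<zeta> (genE i) \<in> carrier (Uq_borel \<zeta>)"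
  unfolding Uq_borel_simps by (rule generate_ring.incl, blast)+

lemma Psi_mem: "(p, q, r) \<in> \<Psi> \<longleftrightarrow> p \<in> {0, 1} \<and> q \<in> {0, 1} \<and> r \<in> {0, 1}"
  unfolding \<Psi>_def mem_Times_iff by simp

locale verma_setup =
  fixes \<zeta> :: complex and t :: torus_char
  assumes zeta: "\<zeta>\<^sup>2 = - 1" and t: "t \<in> \<P>"
begin

abbreviation hw :: "falg \<Rightarrow> b8 \<Rightarrow> complex" where
  "hw x \<equiv> app (rep (vgen \<zeta> t) x) (unit_vec B0)"

lemma hw_class: "U_class \<zeta> x = U_class \<zeta> y \<Longrightarrow> rep (vgen \<zeta> t) x = rep (vgen \<zeta> t) y"
  using U_rep_vanishes[OF zeta U_rep_vgen[OF zeta t], of "x - y"] by (simp add: U_class_eq_iff)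

text \<open>The result of applying a coset to v_h; by \<open>hw_class\<close> the choice of x does
  not matter.\<close>

definition coord :: "falg set \<Rightarrow> b8 \<Rightarrow> complex" where
  "coord u = hw (SOME x. u = U_class \<zeta> x)"

lemma coord_class: "coord (U_class \<zeta> x) = hw x"
proof -
  have "U_class \<zeta> x = U_class \<zeta> (SOME y. U_class \<zeta> x = U_class \<zeta> y)" by (rule someI) (rule refl)
  from hw_class[OF this] show ?thesis by (simp add: coord_def)
qed

lemma hw_borel:
  assumes "b \<in> carrier (Uq_borel \<zeta>)"
  shows "\<exists>x. b = U_class \<zeta> x \<and> hw x = cscale (hw x B0) (unit_vec B0)"
proof -
  have "\<exists>x. b = U_class \<zeta> x \<and> (\<exists>c. hw x = cscale c (unit_vec B0))"
    using assms
  proof (induction rule: Uq_borel_induct)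
    case one
    show ?case by (intro exI[of _ 1]) (simp add: cscale_def)
  next
    case (E i)
    show ?case by (intro exI[of _ 0]) (simp add: E_unit_vec fun_eq_iff)
  next
    case (minus x)
    then obtain c where "hw x = cscale c (unit_vec B0)" by blast
    then show ?case by (intro exI[of _ "- c"]) (simp add: fun_eq_iff)
  next
    case (add x y)
    then obtain c d where "hw x = cscale c (unit_vec B0)" "hw y = cscale d (unit_vec B0)" by blast
    then show ?case by (intro exI[of _ "c + d"]) (simp add: fun_eq_iff ring_distribs)
  next
    case (mult x y)
    then obtain c d where "hw x = cscale c (unit_vec B0)" "hw y = cscale d (unit_vec B0)" by blast
    then show ?case by (intro exI[of _ "d * c"]) (simp add: app_cscale)
  qed (auto simp: app_vgen_unit_vec)
  then show ?thesis by (auto simp: unit_vec_def)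
qed

text \<open>\<open>borel_char\<close> is defined by choice, so a character must be exhibited. B
  preserves the line of v_h in the model, and the eigenvalue is the coefficient at
  \<open>B0\<close>.\<close>

lemma borel_char_exists:
  "(\<lambda>b. coord b B0) \<in> ring_hom (Uq_borel \<zeta>) complex_ring \<and>
     (\<forall>c. coord (U_class \<zeta> (scal c)) B0 = c) \<and>
     (\<forall>i. coord (U_class \<zeta> (genK i)) B0 = at_node t i \<and> coord (U_class \<zeta> (genE i)) B0 = 0)"
proof (intro conjI allI)
  show "(\<lambda>b. coord b B0) \<in> ring_hom (Uq_borel \<zeta>) complex_ring"
  proof (rule ring_hom_memI)
    fix b b' assume "b \<in> carrier (Uq_borel \<zeta>)" "b' \<in> carrier (Uq_borel \<zeta>)"
    then obtain x y where *: "b = U_class \<zeta> x" "hw x = cscale (hw x B0) (unit_vec B0)"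
      "b' = U_class \<zeta> y" "hw y = cscale (hw y B0) (unit_vec B0)"
      using hw_borel by meson
    have "hw (x * y) = app (rep (vgen \<zeta> t) x) (cscale (hw y B0) (unit_vec B0))"
      using *(4) by (simp only: rep_simps(6) app_endo(6))
    then have "hw (x * y) B0 = hw x B0 * hw y B0"
      by (simp add: app_cscale)
    then show "coord (b \<otimes>\<^bsub>Uq_borel \<zeta>\<^esub> b') B0 = coord b B0 \<otimes>\<^bsub>complex_ring\<^esub> coord b' B0"
      unfolding *(1,3) Uq_borel_simps Uq_simps coord_class by simp
    show "coord (b \<oplus>\<^bsub>Uq_borel \<zeta>\<^esub> b') B0 = coord b B0 \<oplus>\<^bsub>complex_ring\<^esub> coord b' B0"
      unfolding *(1,3) Uq_borel_simps Uq_simps coord_class by simp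
  qed (simp_all add: Uq_borel_simps Uq_simps coord_class, simp add: unit_vec_def)
qed (simp_all add: coord_class app_vgen_unit_vec E_unit_vec, simp_all add: unit_vec_def)

lemma borel_char:
  "borel_char \<zeta> t \<in> ring_hom (Uq_borel \<zeta>) complex_ring"
  "borel_char \<zeta> t (U_class \<zeta> (scal c)) = c"
  "borel_char \<zeta> t (U_class \<zeta> (genK i)) = at_node t i"
  "borel_char \<zeta> t (U_class \<zeta> (genE i)) = 0"
  using someI[of "\<lambda>\<chi>. \<chi> \<in> ring_hom (Uq_borel \<zeta>) complex_ring \<and>
     (\<forall>c. \<chi> (U_class \<zeta> (scal c)) = c) \<and>
     (\<forall>i. \<chi> (U_class \<zeta> (genK i)) = at_node t i \<and> \<chi> (U_class \<zeta> (genE i)) = 0)", OF borel_char_exists]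
  unfolding borel_char_def[symmetric] by blast+

lemma borel_char_hom:
  assumes "U_class \<zeta> x \<in> carrier (Uq_borel \<zeta>)" "U_class \<zeta> y \<in> carrier (Uq_borel \<zeta>)"
  shows "borel_char \<zeta> t (U_class \<zeta> (x * y)) = borel_char \<zeta> t (U_class \<zeta> x) * borel_char \<zeta> t (U_class \<zeta> y)"
    and "borel_char \<zeta> t (U_class \<zeta> (x + y)) = borel_char \<zeta> t (U_class \<zeta> x) + borel_char \<zeta> t (U_class \<zeta> y)"
  using ring_hom_mult[OF borel_char(1) assms] ring_hom_add[OF borel_char(1) assms]
  by (simp_all add: Uq_borel_simps Uq_simps)

text \<open>Identifies the chosen character with the action on v_h. Its value on the inverse of K_i
  is not prescribed by the definition and follows from multiplicativity.\<close>

lemma borel_eigen: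
  assumes "b \<in> carrier (Uq_borel \<zeta>)"
  shows "\<exists>x. b = U_class \<zeta> x \<and> hw x = cscale (borel_char \<zeta> t (U_class \<zeta> x)) (unit_vec B0)"
  using assms
proof (induction rule: Uq_borel_induct)
  case one
  have "(1 :: falg) = scal 1" by simp
  then have "borel_char \<zeta> t (U_class \<zeta> 1) = 1" using borel_char(2)[of 1] by simp
  then show ?case by (simp add: cscale_def)
next
  case (Kinv i)
  have "scal 1 - genKinv i * genK i \<in> U_ideal \<zeta>"
    using U_ideal_closed(4)[OF ideal_rel(2)[of i \<zeta>]] by simp
  then have "U_class \<zeta> (scal 1) = U_class \<zeta> (genKinv i * genK i)"
    by (simp only: U_class_eq_iff)
  then have "borel_char \<zeta> t (U_class \<zeta> (genKinv i)) * at_node t i = 1"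
    using borel_char_hom(1)[OF borel_generators(3,2), of i i] borel_char(2)[of 1] borel_char(3) by simp
  then have "borel_char \<zeta> t (U_class \<zeta> (genKinv i)) = inverse (at_node t i)"
    by (metis inverse_unique mult.commute)
  then show ?case by (simp add: app_vgen_unit_vec)
next
  case (minus x)
  have "borel_char \<zeta> t (U_class \<zeta> (scal (- 1) * x)) = - borel_char \<zeta> t (U_class \<zeta> x)"
    using borel_char_hom(1)[OF borel_generators(1) minus(1)] by (simp add: borel_char(2))
  then show ?case using minus(2) by (simp add: falg.sc_minus fun_eq_iff)
next
  case (add x y)
  then show ?case by (simp add: borel_char_hom fun_eq_iff ring_distribs)
next
  case (mult x y)
  then show ?case by (simp add: borel_char_hom app_cscale mult.commute)
qed (simp_all add: borel_char app_vgen_unit_vec E_unit_vec)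

text \<open>The map sending u tensor z to z u v_h.\<close>

abbreviation \<pi> :: "falg set \<times> complex \<Rightarrow> b8 \<Rightarrow> complex" where
  "\<pi> \<equiv> (\<lambda>(u, z). cscale z (coord u))"

lemma highest_line_simps:
  "carrier (highest_line \<zeta> t) = UNIV" "x \<oplus>\<^bsub>highest_line \<zeta> t\<^esub> y = x + y"
  "b \<odot>\<^bsub>highest_line \<zeta> t\<^esub> y = borel_char \<zeta> t b * y"
  by (simp_all add: highest_line_def)

lemma borel_subset: "b \<in> carrier (Uq_borel \<zeta>) \<Longrightarrow> b \<in> carrier (Uq \<zeta>)"
  using borel_eigen by (auto simp: Uq_carrier)

sublocale form: tensor_form "Uq_borel \<zeta>" "Uq \<zeta>" "(\<otimes>\<^bsub>Uq \<zeta>\<^esub>)" "highest_line \<zeta> t" \<pi>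
proof
  fix m r and n :: complex assume "m \<in> carrier (Uq \<zeta>)" and r: "r \<in> carrier (Uq_borel \<zeta>)"
  then obtain x where x: "m = U_class \<zeta> x" by (auto simp: Uq_carrier)
  obtain y where y: "r = U_class \<zeta> y" "hw y = cscale (borel_char \<zeta> t r) (unit_vec B0)"
    using borel_eigen[OF r] by blast
  show "\<pi> (m \<otimes>\<^bsub>Uq \<zeta>\<^esub> r, n) = \<pi> (m, r \<odot>\<^bsub>highest_line \<zeta> t\<^esub> n)"
    using y(2) unfolding x y(1)
    by (simp add: Uq_simps coord_class highest_line_simps app_cscale mult.commute)
  show "m \<otimes>\<^bsub>Uq \<zeta>\<^esub> r \<in> carrier (Uq \<zeta>)"
    unfolding x y(1) by (simp add: Uq_simps Uq_carrier)
qed (auto simp: Uq_carrier Uq_simps coord_class highest_line_simps fun_eq_iff ring_distribs)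

text \<open>Lifts of the basis vectors, written with \<open>F12\<close> so that they are
  combinations of the ordered monomials. On v_h they agree with the words that the labels stand for,
  because the squares of the F_i vanish.\<close>

fun monomial :: "b8 \<Rightarrow> falg" where
  "monomial B0 = 1"
| "monomial (B1 N1) = genF N1"
| "monomial (B1 N2) = genF N2"
| "monomial (B2 N1) = genF N1 * genF N2"
| "monomial (B2 N2) = - F12 \<zeta> + scal \<zeta> * (genF N1 * genF N2)"
| "monomial (B3 N1) = - (genF N1 * F12 \<zeta>)"
| "monomial (B3 N2) = - (F12 \<zeta> * genF N2)"
| "monomial B4 = - (genF N1 * F12 \<zeta> * genF N2)"

lemma hw_monomial: "hw (monomial b) = unit_vec b"
  by (cases b rule: b8_cases)
     (simp_all add: F12_def F_unit_vec app_cscale app_diff app_minus app_add del: plus_fun_apply)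

lemma F_pow_spanned: "F_pow \<zeta> ` \<Psi> \<subseteq> spn N (range monomial)"
proof -
  have m: "monomial b \<in> spn N (range monomial)" for b by (rule spn.base) simp
  have "F12 \<zeta> = scal \<zeta> * monomial (B2 N1) - monomial (B2 N2)" by simp
  then have "F12 \<zeta> \<in> spn N (range monomial)" by (simp only: m spn_diff spn.scal)
  moreover have "genF N1 * F12 \<zeta> \<in> spn N (range monomial)" "F12 \<zeta> * genF N2 \<in> spn N (range monomial)"
    "genF N1 * F12 \<zeta> * genF N2 \<in> spn N (range monomial)"
    using spn_minus[OF m[of "B3 N1"]] spn_minus[OF m[of "B3 N2"]] spn_minus[OF m[of B4]] by simp_all
  ultimately show ?thesis
    using m[of B0] m[of "B1 N1"] m[of "B1 N2"] m[of "B2 N1"] by (auto simp: \<Psi>_def)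
qed

section \<open>The upper bound on V(t)\<close>

abbreviation S :: "(falg set \<times> complex \<Rightarrow>\<^sub>0 int) set" where "S \<equiv> form.S"

text \<open>The annihilator of the generator 1 tensor v_h in the actual tensor product, as opposed
  to the model.\<close>

definition kill :: "falg set" where
  "kill = {x. frag_of (U_class \<zeta> x, 1) \<in> S}"

lemma hw_kill: "x \<in> kill \<Longrightarrow> hw x = 0"
  using form.add_ext_S[of "frag_of (U_class \<zeta> x, 1)"] by (simp add: kill_def coord_class)

lemma S_left_mult: "z \<in> S \<Longrightarrow> frag_extend (\<lambda>(a, z). frag_of (U_class \<zeta> y \<otimes>\<^bsub>Uq \<zeta>\<^esub> a, z)) z \<in> S"
proof (induction rule: form.S_induct)
  case (relation r)
  interpret ring "Uq \<zeta>" by (rule Uq_ring)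
  have u: "U_class \<zeta> y \<in> carrier (Uq \<zeta>)" by (simp add: Uq_carrier)
  show ?case
    using relation unfolding tensor_relations_def
  proof (elim UnE CollectE exE conjE)
    fix m m' n
    assume "r = frag_of (m \<oplus>\<^bsub>Uq \<zeta>\<^esub> m', n) - frag_of (m, n) - frag_of (m', n)"
      and m: "m \<in> carrier (Uq \<zeta>)" "m' \<in> carrier (Uq \<zeta>)" "n \<in> carrier (highest_line \<zeta> t)"
    then show ?thesis
      using form.S_relations(1)[OF m_closed[OF u m(1)] m_closed[OF u m(2)] m(3)] u
      by (simp add: frag_extend_diff r_distr)
  next
    fix m n n'
    assume "r = frag_of (m, n \<oplus>\<^bsub>highest_line \<zeta> t\<^esub> n') - frag_of (m, n) - frag_of (m, n')"
      and m: "m \<in> carrier (Uq \<zeta>)" "n \<in> carrier (highest_line \<zeta> t)" "n' \<in> carrier (highest_line \<zeta> t)"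
    then show ?thesis
      using form.S_relations(2)[OF m_closed[OF u m(1)] m(2,3)]
      by (simp add: frag_extend_diff)
  next
    fix m b n
    assume "r = frag_of (m \<otimes>\<^bsub>Uq \<zeta>\<^esub> b, n) - frag_of (m, b \<odot>\<^bsub>highest_line \<zeta> t\<^esub> n)"
      and m: "m \<in> carrier (Uq \<zeta>)" "b \<in> carrier (Uq_borel \<zeta>)" "n \<in> carrier (highest_line \<zeta> t)"
    then show ?thesis
      using form.S_relations(3)[OF m_closed[OF u m(1)] m(2,3)] u borel_subset[OF m(2)]
      by (simp add: frag_extend_diff m_assoc)
  qed
qed (simp_all add: frag_extend_add frag_extend_minus form.S_closed)

lemma add_class: "frag_of (U_class \<zeta> (x + y), z) - frag_of (U_class \<zeta> x, z) - frag_of (U_class \<zeta> y, z) \<in> S"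
  using form.S_relations(1)[of "U_class \<zeta> x" "U_class \<zeta> y" z]
  by (simp add: Uq_carrier Uq_simps highest_line_simps)

lemma move_class:
  assumes "U_class \<zeta> b \<in> carrier (Uq_borel \<zeta>)"
  shows "frag_of (U_class \<zeta> (x * b), z) - frag_of (U_class \<zeta> x, borel_char \<zeta> t (U_class \<zeta> b) * z) \<in> S"
  using form.S_relations(3)[of "U_class \<zeta> x" "U_class \<zeta> b" z] assms
  by (simp add: Uq_carrier Uq_simps highest_line_simps)

lemma kill_ideal: "weight_ideal \<zeta> kill (at_node t)"
proof
  show "\<zeta>\<^sup>2 = - 1" by (rule zeta)
  show add: "x + y \<in> kill" if "x \<in> kill" "y \<in> kill" for x y
    using form.S_closed(2)[OF form.S_closed(2)[OF add_class[of x y 1] that(1)[unfolded kill_def mem_Collect_eq]]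
        that(2)[unfolded kill_def mem_Collect_eq]]
    by (simp add: kill_def)
  have zero: "0 \<in> kill"
    using form.S_closed(3)[OF add_class[of 0 0 1]] by (simp add: kill_def)
  show "z * x \<in> kill" if "x \<in> kill" for x z
    using S_left_mult[of "frag_of (U_class \<zeta> x, 1)" z] that by (simp add: kill_def Uq_simps)
  show "U_ideal \<zeta> \<subseteq> kill"
  proof
    fix x assume "x \<in> U_ideal \<zeta>"
    then have "U_class \<zeta> x = U_class \<zeta> 0" by (simp add: U_class_eq_iff)
    then show "x \<in> kill" using zero by (simp add: kill_def)
  qed
  show "at_node t i \<noteq> 0" for i using t by (cases i) (auto simp: \<P>_def)
  show "genK i - scal (at_node t i) \<in> kill" for i
  proof -
    let ?a = "at_node t i"
    have K: "frag_of (U_class \<zeta> (genK i), 1) - frag_of (U_class \<zeta> 1, ?a) \<in> S"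
      using move_class[OF borel_generators(2), of 1 i 1] by (simp add: borel_char)
    have c: "frag_of (U_class \<zeta> (scal ?a), 1) - frag_of (U_class \<zeta> 1, ?a) \<in> S"
      using move_class[OF borel_generators(1), of 1 ?a 1] by (simp add: borel_char)
    have d: "frag_of (U_class \<zeta> (genK i), 1) - frag_of (U_class \<zeta> (genK i - scal ?a), 1) -
        frag_of (U_class \<zeta> (scal ?a), 1) \<in> S"
      using add_class[of "genK i - scal ?a" "scal ?a" 1] by simp
    from form.S_closed(4)[OF form.S_closed(4)[OF K c] d] show ?thesis
      by (simp add: kill_def)
  qed
qed

sublocale kill: weight_ideal \<zeta> kill "at_node t"
  by (rule kill_ideal)

lemma E_kill: "genE i \<in> kill"
proof -
  have "frag_of (U_class \<zeta> (genE i), 1) - frag_of (U_class \<zeta> 1, 0) \<in> S"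
    using move_class[OF borel_generators(4), of 1 i 1] by (simp add: borel_char)
  moreover have "frag_of (U_class \<zeta> 1, 0 :: complex) \<in> S"
    using form.S_closed(3)[OF form.S_relations(2)[of "U_class \<zeta> 1" 0 0]]
    by (simp add: highest_line_simps Uq_carrier)
  ultimately have "frag_of (U_class \<zeta> (genE i), 1) - frag_of (U_class \<zeta> 1, 0) + frag_of (U_class \<zeta> 1, 0) \<in> S"
    by (rule form.S_closed(2))
  then show ?thesis by (simp add: kill_def)
qed

text \<open>The factors E annihilate v_h, so of the ordered products only those without E's
  survive.\<close>

lemma spanned_monomials: "x \<in> spn kill (range monomial)"
proof (rule spn_trans)
  show "x \<in> spn kill (PBW \<zeta>)"
  proof -
    obtain a where a: "x - (\<Sum>b\<in>PBW \<zeta>. scal (a b) * b) \<in> kill"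
      using kill.spanned_PBW by blast
    have "(\<Sum>b\<in>B. scal (a b) * b) \<in> spn kill (PBW \<zeta>)" if "B \<subseteq> PBW \<zeta>" "finite B" for B
      using that(2,1)
    proof induction
      case empty
      show ?case by (simp add: spn.sub kill.zero_in_N)
    next
      case (insert b B)
      then show ?case by (simp add: spn.add spn.scal spn.base)
    qed
    from spn.add[OF spn.sub[OF a] this[OF order_refl finite_PBW]] show ?thesis by simp
  qed
  show "PBW \<zeta> \<subseteq> spn kill (range monomial)"
  proof
    fix b assume "b \<in> PBW \<zeta>"
    then obtain \<psi> \<psi>' where "b = F_pow \<zeta> \<psi> * E_pow \<zeta> \<psi>'" "\<psi> \<in> \<Psi>" "\<psi>' \<in> \<Psi>"
      unfolding PBW_def by blast
    moreover obtain p q r where "\<psi>' = (p, q, r)" by (rule prod_cases3)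
    ultimately have b: "b = F_pow \<zeta> \<psi> * (genE N1 ^ p * E12 \<zeta> ^ q * genE N2 ^ r)" "\<psi> \<in> \<Psi>"
      "p \<in> {0, 1}" "q \<in> {0, 1}" "r \<in> {0, 1}"
      by (simp_all only: Psi_mem E_pow.simps)
    have E12: "E12 \<zeta> \<in> kill"
    proof -
      have "(- genE N1) * genE N2 + (- scal \<zeta> * genE N2) * genE N1 \<in> kill"
        by (intro kill.N_add kill.N_mult E_kill)
      then show ?thesis by (simp add: E12_def)
    qed
    show "b \<in> spn kill (range monomial)"
    proof (cases "p = 0 \<and> q = 0 \<and> r = 0")
      case True
      then have "b = F_pow \<zeta> \<psi>" using b(1) by simp
      then show ?thesis using F_pow_spanned b(2) by blast
    next
      case False
      then have "genE N1 ^ p * E12 \<zeta> ^ q * genE N2 ^ r \<in> kill"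
      proof (cases "r = 1")
        case True
        then show ?thesis by (simp add: kill.N_mult E_kill)
      next
        case r: False
        show ?thesis
        proof (cases "q = 1")
          case True
          then show ?thesis using r b(5) by (simp add: kill.N_mult E12)
        next
          case q: False
          then show ?thesis using r b(3-5) False E_kill[of N1] by simp
        qed
      qed
      from kill.N_mult[OF this] show ?thesis unfolding b(1) by (rule spn.sub)
    qed
  qed
qed (auto intro: spn.sub)

lemma inj_monomial: "inj monomial"
proof (rule injI)
  fix b c assume "monomial b = monomial c"
  then have "unit_vec b = unit_vec c" using hw_monomial by metis
  then show "b = c" by (auto simp: unit_vec_def fun_eq_iff split: if_splits)
qed

definition combination :: "(b8 \<Rightarrow> complex) \<Rightarrow> falg" where
  "combination f = (\<Sum>b\<in>UNIV. scal (f b) * monomial b)"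

lemma hw_sum: "hw (\<Sum>b\<in>B. g b) = (\<Sum>b\<in>B. hw (g b))"
  by (induction B rule: infinite_finite_induct) (simp_all del: plus_fun_apply zero_fun_apply)

lemma hw_combination: "hw (combination f) = f"
proof -
  have "hw (combination f) = (\<Sum>b\<in>UNIV. cscale (f b) (unit_vec b))"
    by (simp add: combination_def hw_sum hw_monomial)
  then show ?thesis by (simp only: unit_vec_expansion[symmetric])
qed

lemma combination_add: "combination (f + g) = combination f + combination g"
  by (simp add: combination_def falg.sc_add ring_distribs sum.distrib)

text \<open>The two bounds meet: the spanning monomials have distinct unit vectors as images in the
  model, which forces the coefficients to be the coordinates of x.\<close>

lemma congruent_combination: "x - combination (hw x) \<in> kill"
proof -
  obtain a where a: "x - (\<Sum>y\<in>range monomial. scal (a y) * y) \<in> kill"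
    using spn_finite[OF spanned_monomials, of x] kill.N_add kill.N_mult kill.zero_in_N by auto
  have *: "(\<Sum>y\<in>range monomial. scal (a y) * y) = combination (\<lambda>b. a (monomial b))"
    by (simp add: combination_def sum.reindex[OF inj_monomial])
  have "hw x - hw (combination (\<lambda>b. a (monomial b))) = 0"
    using hw_kill[OF a] unfolding * by (simp only: rep_simps app_endo)
  then have "hw x = (\<lambda>b. a (monomial b))" by (simp only: hw_combination right_minus_eq)
  with a show ?thesis unfolding * by simp
qed

sublocale model: tensor_model "Uq_borel \<zeta>" "Uq \<zeta>" "(\<otimes>\<^bsub>Uq \<zeta>\<^esub>)" "highest_line \<zeta> t" \<pi>
  "\<lambda>f. frag_of (U_class \<zeta> (combination f), 1)"
proof
  show "Poly_Mapping.keys (frag_of (U_class \<zeta> (combination f), 1 :: complex))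
      \<subseteq> carrier (Uq \<zeta>) \<times> carrier (highest_line \<zeta> t)" for f
    by (simp add: Uq_carrier highest_line_simps)
  show "frag_of (U_class \<zeta> (combination (f + g)), 1) - frag_of (U_class \<zeta> (combination f), 1) -
      frag_of (U_class \<zeta> (combination g), 1) \<in> S" for f g
    unfolding combination_add by (rule add_class)
  show "add_ext \<pi> (frag_of (U_class \<zeta> (combination f), 1)) = f" for f
    by (simp add: coord_class hw_combination)
  fix m and n :: complex assume "m \<in> carrier (Uq \<zeta>)"
  then obtain x where x: "m = U_class \<zeta> x" by (auto simp: Uq_carrier)
  \<comment> \<open>Scalars lie in B, so the coefficient n moves across the tensor sign.\<close>
  let ?y = "x * scal n"
  have "hw ?y = \<pi> (m, n)" by (simp add: x coord_class app_cscale)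
  then have "frag_of (U_class \<zeta> (?y - combination (\<pi> (m, n))), 1) \<in> S"
    using congruent_combination[of ?y] by (simp add: kill_def)
  from form.S_closed(2)[OF add_class[of "?y - combination (\<pi> (m, n))" "combination (\<pi> (m, n))" 1] this]
  have 1: "frag_of (U_class \<zeta> ?y, 1) - frag_of (U_class \<zeta> (combination (\<pi> (m, n))), 1) \<in> S"
    by simp
  have 2: "frag_of (U_class \<zeta> ?y, 1) - frag_of (m, n) \<in> S"
    using move_class[OF borel_generators(1), of x n 1] by (simp add: borel_char x)
  from form.S_closed(4)[OF 1 2]
  show "frag_of (m, n) - frag_of (U_class \<zeta> (combination (\<pi> (m, n))), 1) \<in> S" by simp
qed

lemma verma_models: "models \<zeta> (verma \<zeta> t) (vgen \<zeta> t) model.fiber"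
  unfolding models_def
proof (intro conjI allI)
  show "inj model.fiber" by (rule model.inj_fiber)
  show "carrier (verma \<zeta> t) = range model.fiber"
    by (simp add: verma_def Let_def model.tensor_carrier)
  show "\<zero>\<^bsub>verma \<zeta> t\<^esub> = model.fiber 0"
    by (simp add: verma_def Let_def model.tensor_zero del: zero_fun_apply)
  show "model.fiber f \<oplus>\<^bsub>verma \<zeta> t\<^esub> model.fiber h = model.fiber (f + h)" for f h
    unfolding verma_def Let_def by (rule model.tensor_add)
  show "U_class \<zeta> x \<odot>\<^bsub>verma \<zeta> t\<^esub> model.fiber f = model.fiber (app (rep (vgen \<zeta> t) x) f)" for x f
  proof -
    have "tensor_class (Uq_borel \<zeta>) (Uq \<zeta>) (\<otimes>\<^bsub>Uq \<zeta>\<^esub>) (highest_line \<zeta> t)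
        (frag_extend (\<lambda>(a, z). frag_of (U_class \<zeta> x \<otimes>\<^bsub>Uq \<zeta>\<^esub> a, z)) y) = model.fiber (app (rep (vgen \<zeta> t) x) f)"
      if "y \<in> model.fiber f" for y
      by (rule model.tensor_class_extend[OF _ that])
         (auto simp: Uq_carrier Uq_simps coord_class app_cscale highest_line_simps)
    then have "(\<Union>y\<in>model.fiber f. tensor_class (Uq_borel \<zeta>) (Uq \<zeta>) (\<otimes>\<^bsub>Uq \<zeta>\<^esub>) (highest_line \<zeta> t)
        (frag_extend (\<lambda>(a, z). frag_of (U_class \<zeta> x \<otimes>\<^bsub>Uq \<zeta>\<^esub> a, z)) y)) = model.fiber (app (rep (vgen \<zeta> t) x) f)"
      using model.fiber_nonempty by auto
    then show ?thesis by (simp add: verma_def Let_def model.tensor_smult)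
  qed
qed

end


section \<open>Coordinates on a tensor product of modules\<close>

definition outer :: "('b \<Rightarrow> complex) \<Rightarrow> ('c \<Rightarrow> complex) \<Rightarrow> 'b \<times> 'c \<Rightarrow> complex" where
  "outer f h = (\<lambda>(b, c). f b * h c)"

lemma outer_simps:
  "outer (f + f') h = outer f h + outer f' h" "outer f (h + h') = outer f h + outer f h'"
  "outer (cscale k f) h = cscale k (outer f h)" "outer f (cscale k h) = cscale k (outer f h)"
  by (auto simp: outer_def fun_eq_iff ring_distribs)

lemma app_outer: "app (lft A * rgt B) (outer f h) = outer (app A f) (app B h)"
  by (auto simp: fun_eq_iff outer_def app_mult_lambda)
     (simp add: app_mult_lambda mult.commute[of "f _"] mult.commute[of "app A f _"])

locale U_tensor_setup =
  fixes \<zeta> :: complex and M :: "'m U_module" and N :: "'n U_module"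
    and g :: "gen \<Rightarrow> 'b::finite endo" and h :: "gen \<Rightarrow> 'c::finite endo" and \<Phi> \<Theta>
  assumes zeta: "\<zeta>\<^sup>2 = - 1" and g: "U_rep \<zeta> g" and h: "U_rep \<zeta> h"
    and M: "models \<zeta> M g \<Phi>" and N: "models \<zeta> N h \<Theta>"
begin

abbreviation ract :: "'m \<Rightarrow> complex \<Rightarrow> 'm" where
  "ract \<equiv> (\<lambda>m c. U_class \<zeta> (scal c) \<odot>\<^bsub>M\<^esub> m)"

definition \<pi> :: "'m \<times> 'n \<Rightarrow> 'b \<times> 'c \<Rightarrow> complex" where
  "\<pi> = (\<lambda>(m, n). outer (inv_into UNIV \<Phi> m) (inv_into UNIV \<Theta> n))"

lemma \<pi>_apply [simp]: "\<pi> (\<Phi> f, \<Theta> k) = outer f k"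
  by (simp add: \<pi>_def inv_f_f modelsD(1)[OF M] modelsD(1)[OF N])

lemma module_simps:
  "carrier M = range \<Phi>" "\<Phi> f \<oplus>\<^bsub>M\<^esub> \<Phi> f' = \<Phi> (f + f')" "U_class \<zeta> x \<odot>\<^bsub>M\<^esub> \<Phi> f = \<Phi> (app (rep g x) f)"
  "carrier N = range \<Theta>" "U_class \<zeta> x \<odot>\<^bsub>N\<^esub> \<Theta> k = \<Theta> (app (rep h x) k)"
  "carrier (complex_vs \<zeta> N) = range \<Theta>"
  "\<Theta> k \<oplus>\<^bsub>complex_vs \<zeta> N\<^esub> \<Theta> k' = \<Theta> (k + k')" "c \<odot>\<^bsub>complex_vs \<zeta> N\<^esub> \<Theta> k = \<Theta> (cscale c k)"
  using modelsD[OF M] modelsD[OF N] by (simp_all add: complex_vs_def)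

sublocale form: tensor_form complex_ring M ract "complex_vs \<zeta> N" \<pi>
proof
  fix m n and c :: complex
  assume "m \<in> carrier M" "n \<in> carrier (complex_vs \<zeta> N)"
  then obtain f k where mn: "m = \<Phi> f" "n = \<Theta> k" by (auto simp: module_simps)
  show "\<pi> (ract m c, n) = \<pi> (m, c \<odot>\<^bsub>complex_vs \<zeta> N\<^esub> n)"
    by (simp add: mn module_simps outer_simps)
qed (auto simp: module_simps outer_simps simp del: plus_fun_apply)

lemma relation_left:
  "frag_of (\<Phi> (f + f'), \<Theta> k) - frag_of (\<Phi> f, \<Theta> k) - frag_of (\<Phi> f', \<Theta> k) \<in> form.S"
  using form.S_relations(1)[of "\<Phi> f" "\<Phi> f'" "\<Theta> k"] by (simp only: module_simps rangeI)

lemma relation_right: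
  "frag_of (\<Phi> f, \<Theta> (k + k')) - frag_of (\<Phi> f, \<Theta> k) - frag_of (\<Phi> f, \<Theta> k') \<in> form.S"
  using form.S_relations(2)[of "\<Phi> f" "\<Theta> k" "\<Theta> k'"] by (simp only: module_simps rangeI)

lemma relation_scalar: "frag_of (\<Phi> (cscale c f), \<Theta> k) - frag_of (\<Phi> f, \<Theta> (cscale c k)) \<in> form.S"
  using form.S_relations(3)[of "\<Phi> f" c "\<Theta> k"]
  by (simp only: module_simps rangeI ring_of_type_algebra_simps UNIV_I rep_simps app_sce)

lemma relation_sum:
  assumes "finite B"
  shows "frag_of (\<Phi> (\<Sum>b\<in>B. f b), \<Theta> k) - (\<Sum>b\<in>B. frag_of (\<Phi> (f b), \<Theta> k)) \<in> form.S"
  using assms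
proof induction
  case empty
  have eq: "- (p - p - p) = p" for p :: "'m \<times> 'n \<Rightarrow>\<^sub>0 int" by simp
  show ?case
    using form.S_closed(3)[OF relation_left[of 0 0 k]] unfolding add_0_left eq sum.empty diff_0_right .
next
  case (insert b B)
  have eq: "p - q - r + (r - s) = p - (q + s)" for p q r s :: "'m \<times> 'n \<Rightarrow>\<^sub>0 int" by simp
  show ?case
    using form.S_closed(2)[OF relation_left[of "f b" "\<Sum>b\<in>B. f b" k] insert.IH]
    unfolding eq sum.insert[OF insert.hyps] .
qed

text \<open>The left factor is expanded in unit vectors and the right one keeps its row of
  coefficients, so that additivity is a relation in the right argument alone.\<close>

definition \<sigma> :: "('b \<times> 'c \<Rightarrow> complex) \<Rightarrow> ('m \<times> 'n \<Rightarrow>\<^sub>0 int)" where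
  "\<sigma> F = (\<Sum>b\<in>UNIV. frag_of (\<Phi> (unit_vec b), \<Theta> (\<lambda>c. F (b, c))))"

sublocale model: tensor_model complex_ring M ract "complex_vs \<zeta> N" \<pi> \<sigma>
proof
  show "Poly_Mapping.keys (\<sigma> F) \<subseteq> carrier M \<times> carrier (complex_vs \<zeta> N)" for F
    unfolding \<sigma>_def by (rule order_trans[OF keys_sum]) (auto simp: module_simps)
  show "\<sigma> (F + F') - \<sigma> F - \<sigma> F' \<in> form.S" for F F'
  proof -
    have "\<sigma> (F + F') - \<sigma> F - \<sigma> F' = (\<Sum>b\<in>UNIV. frag_of (\<Phi> (unit_vec b), \<Theta> ((\<lambda>c. F (b, c)) + (\<lambda>c. F' (b, c)))) -
        frag_of (\<Phi> (unit_vec b), \<Theta> (\<lambda>c. F (b, c))) - frag_of (\<Phi> (unit_vec b), \<Theta> (\<lambda>c. F' (b, c))))"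
      by (simp add: \<sigma>_def sum_subtractf plus_fun_def)
    also have "\<dots> \<in> form.S" by (intro form.S_sum relation_right)
    finally show ?thesis .
  qed
  show "add_ext \<pi> (\<sigma> F) = F" for F
  proof -
    have "(\<Sum>b\<in>UNIV. unit_vec b a * F (b, c)) = F (a, c)" for a c
    proof -
      have "(\<Sum>b\<in>UNIV. unit_vec b a * F (b, c)) = (\<Sum>b\<in>UNIV. if b = a then F (b, c) else 0)"
        by (rule sum.cong) (auto simp: unit_vec_def)
      then show ?thesis by simp
    qed
    then show ?thesis
      by (auto simp: \<sigma>_def add_ext_sum fun_eq_iff sum_fun_apply outer_def)
  qed
  fix m n assume "m \<in> carrier M" "n \<in> carrier (complex_vs \<zeta> N)"
  then obtain f k where mn: "m = \<Phi> f" "n = \<Theta> k" by (auto simp: module_simps)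
  have 1: "frag_of (\<Phi> f, \<Theta> k) - (\<Sum>b\<in>UNIV. frag_of (\<Phi> (cscale (f b) (unit_vec b)), \<Theta> k)) \<in> form.S"
    using relation_sum[of UNIV "\<lambda>b. cscale (f b) (unit_vec b)" k] by (simp flip: unit_vec_expansion)
  have 2: "(\<Sum>b\<in>UNIV. frag_of (\<Phi> (cscale (f b) (unit_vec b)), \<Theta> k) - frag_of (\<Phi> (unit_vec b), \<Theta> (cscale (f b) k))) \<in> form.S"
    by (intro form.S_sum relation_scalar)
  have "\<sigma> (\<pi> (m, n)) = (\<Sum>b\<in>UNIV. frag_of (\<Phi> (unit_vec b), \<Theta> (cscale (f b) k)))"
    by (simp add: \<sigma>_def mn outer_def cscale_def)
  then show "frag_of (m, n) - \<sigma> (\<pi> (m, n)) \<in> form.S"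
    using form.S_closed(2)[OF 1 2] by (simp add: mn sum_subtractf)
qed

definition coproduct_action :: "falg \<Rightarrow> 'm \<times> 'n \<Rightarrow> ('m \<times> 'n \<Rightarrow>\<^sub>0 int)" where
  "coproduct_action x = (\<lambda>(m, n). \<Sum>(v, w)\<in>Poly_Mapping.keys (coproduct x). frag_of
     (U_class \<zeta> (Poly_Mapping.single v (Poly_Mapping.lookup (coproduct x) (v, w))) \<odot>\<^bsub>M\<^esub> m,
      U_class \<zeta> (Poly_Mapping.single w 1) \<odot>\<^bsub>N\<^esub> n))"

lemma coproduct_action:
  assumes "m \<in> carrier M" "n \<in> carrier (complex_vs \<zeta> N)"
  shows "Poly_Mapping.keys (coproduct_action x (m, n)) \<subseteq> carrier M \<times> carrier (complex_vs \<zeta> N)"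
    and "add_ext \<pi> (coproduct_action x (m, n)) = app (rep (tensor_gen g h) x) (\<pi> (m, n))"
proof -
  obtain f k where mn: "m = \<Phi> f" "n = \<Theta> k" using assms by (auto simp: module_simps)
  show "Poly_Mapping.keys (coproduct_action x (m, n)) \<subseteq> carrier M \<times> carrier (complex_vs \<zeta> N)"
    unfolding coproduct_action_def prod.case
    by (rule order_trans[OF keys_sum]) (auto simp: mn module_simps)
  have rep_single: "rep r (Poly_Mapping.single v c) = sce c * word_value r v" for r :: "gen \<Rightarrow> 'd endo" and v c
    by (simp add: rep_def)
  let ?K = "Poly_Mapping.keys (coproduct x)" and ?l = "Poly_Mapping.lookup (coproduct x)"
  have "add_ext \<pi> (coproduct_action x (m, n)) =
      (\<Sum>(v, w)\<in>?K. cscale (?l (v, w)) (outer (app (word_value g v) f) (app (word_value h w) k)))"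
    by (simp add: coproduct_action_def mn module_simps add_ext_sum split_def rep_single outer_simps) (simp only: cscale_def)
  also have "\<dots> = (\<Sum>p\<in>?K. app (sce (?l p) * (case p of (v, w) \<Rightarrow> lft (word_value g v) * rgt (word_value h w))) (outer f k))"
    by (rule sum.cong) (auto simp: app_outer simp del: app_endo(6) simp: app_endo(6)[of "sce _"])
  also have "\<dots> = app (rep2 g h (coproduct x)) (outer f k)"
  proof -
    have "app (\<Sum>p\<in>K. A p) F = (\<Sum>p\<in>K. app (A p) F)" for K and A :: "word \<times> word \<Rightarrow> ('b \<times> 'c) endo" and F
      by (induction K rule: infinite_finite_induct) (simp_all del: plus_fun_apply zero_fun_apply)
    then show ?thesis by (simp only: rep2_def endo.lin_def)
  qed
  finally show "add_ext \<pi> (coproduct_action x (m, n)) = app (rep (tensor_gen g h) x) (\<pi> (m, n))"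
    by (simp add: rep2_coproduct mn)
qed

lemma U_tensor_eq:
  "U_tensor \<zeta> M N = tensor_module complex_ring M ract (complex_vs \<zeta> N) (\<lambda>u T. \<Union>x\<in>u. \<Union>y\<in>T.
     tensor_class complex_ring M ract (complex_vs \<zeta> N) (frag_extend (coproduct_action x) y))"
  unfolding U_tensor_def Let_def coproduct_action_def ..

text \<open>The union in \<open>U_tensor\<close> runs over all representatives x of a coset. They
  act alike because \<open>tensor_gen g h\<close> satisfies the defining relations, so the union is
  a single coset.\<close>

lemma U_tensor_models: "models \<zeta> (U_tensor \<zeta> M N) (tensor_gen g h) model.fiber"
  unfolding models_def U_tensor_eq
proof (intro conjI allI)
  fix x f
  have c: "tensor_class complex_ring M ract (complex_vs \<zeta> N) (frag_extend (coproduct_action x') y) =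
      model.fiber (app (rep (tensor_gen g h) x) f)" if "x' \<in> U_class \<zeta> x" "y \<in> model.fiber f" for x' y
  proof -
    have "rep (tensor_gen g h) (x' - x) = 0"
      using that(1) by (intro U_rep_vanishes[OF zeta U_rep_tensor[OF zeta g h]]) (simp add: U_class_eq)
    then have "rep (tensor_gen g h) x' = rep (tensor_gen g h) x" by simp
    then show ?thesis
      using model.tensor_class_extend[OF conjI[OF coproduct_action] that(2), of x'] by simp
  qed
  have "x \<in> U_class \<zeta> x" by (simp add: U_class_eq U_ideal_closed)
  moreover obtain y where "y \<in> model.fiber f" using model.fiber_nonempty by blast
  ultimately have "(\<Union>x'\<in>U_class \<zeta> x. \<Union>y\<in>model.fiber f.
      tensor_class complex_ring M ract (complex_vs \<zeta> N) (frag_extend (coproduct_action x') y)) =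
      model.fiber (app (rep (tensor_gen g h) x) f)"
    using c by blast
  then show "U_class \<zeta> x \<odot>\<^bsub>tensor_module complex_ring M ract (complex_vs \<zeta> N) (\<lambda>u T. \<Union>x\<in>u. \<Union>y\<in>T.
     tensor_class complex_ring M ract (complex_vs \<zeta> N) (frag_extend (coproduct_action x) y))\<^esub> model.fiber f =
     model.fiber (app (rep (tensor_gen g h) x) f)"
    unfolding model.tensor_smult .
qed (rule model.inj_fiber model.tensor_carrier model.tensor_zero model.tensor_add)+

end

lemma verma_tensor_cyclic_iff:
  assumes z: "\<zeta>\<^sup>2 = - 1" and t: "t \<in> \<P>" and s: "s \<in> \<P>"
  defines "g \<equiv> tensor_gen (vgen \<zeta> t) (vgen \<zeta> s)"
  shows "homogeneous_cyclic \<zeta> (U_tensor \<zeta> (verma \<zeta> t) (verma \<zeta> s)) \<longleftrightarrow>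
    (\<exists>v. v \<noteq> 0 \<and> (\<forall>i. \<exists>c. app (g (GK i)) v = cscale c v) \<and>
      (\<forall>W. csubspace W \<and> (\<forall>\<psi>\<in>\<Psi>. \<forall>\<psi>'\<in>\<Psi>. app (rep g (F_pow \<zeta> \<psi> * E_pow \<zeta> \<psi>')) v \<in> W) \<longrightarrow> W = UNIV))"
proof -
  interpret t: verma_setup \<zeta> t by standard fact+
  interpret s: verma_setup \<zeta> s by standard fact+
  interpret U_tensor_setup \<zeta> "verma \<zeta> t" "verma \<zeta> s" "vgen \<zeta> t" "vgen \<zeta> s" t.model.fiber s.model.fiber
    by standard (rule z U_rep_vgen[OF z t] U_rep_vgen[OF z s] t.verma_models s.verma_models)+
  show ?thesis
    unfolding g_def by (rule homogeneous_cyclic_models[OF U_tensor_models])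
qed


section \<open>Vanishing matrix coefficients\<close>

abbreviation vgen2 :: "complex \<Rightarrow> torus_char \<Rightarrow> torus_char \<Rightarrow> gen \<Rightarrow> (b8 \<times> b8) endo" where
  "vgen2 \<zeta> t s \<equiv> tensor_gen (vgen \<zeta> t) (vgen \<zeta> s)"

lemma tensor_E_at:
  "app (vgen2 \<zeta> t s (GE i)) f (b, c) =
     at_node s i * wt \<zeta> i c * E_fun (sn \<zeta> (at_node t i)) (cs (at_node t i)) i (\<lambda>b'. f (b', c)) b +
     E_fun (sn \<zeta> (at_node s i)) (cs (at_node s i)) i (\<lambda>c'. f (b, c')) c"
proof -
  have "app (vgen \<zeta> t (GE i)) (\<lambda>b'. k * f (b', c)) b = k * app (vgen \<zeta> t (GE i)) (\<lambda>b'. f (b', c)) b" for k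
    by (simp only: app_mult_lambda)
  then show ?thesis by (simp add: app_vgen tensor_gen.simps)
qed

lemma tensor_F_at:
  "app (vgen2 \<zeta> t s (GF i)) f (b, c) =
     F_fun i (\<lambda>b'. f (b', c)) b + inverse (at_node t i * wt \<zeta> i b) * F_fun i (\<lambda>c'. f (b, c')) c"
  by (simp add: app_vgen tensor_gen.simps)

text \<open>The assumptions on \<open>inverse\<close> and \<open>cs\<close> follow from
  \<open>sn = 0\<close> by \<open>sn_eq_0D\<close>. As equations they allow evaluation backwards
  from the target coordinate.\<close>

lemma functional_X:
  assumes z: "\<zeta>\<^sup>2 = - 1" and "sn \<zeta> (at_node t i) = 0" "sn \<zeta> (at_node s i) = 0"
    and "inverse (at_node t i) = at_node t i" "cs (at_node t i) = at_node t i" "cs (at_node s i) = at_node s i"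
  shows "app (vgen2 \<zeta> t s (GF (other i))) (app (vgen2 \<zeta> t s (GF i))
    (app (vgen2 \<zeta> t s (GF (other i)))
      (app (vgen2 \<zeta> t s (GE i)) v))) (B3 (other i), B3 (other i)) = 0"
  by (simp add: assms tensor_E_at tensor_F_at zeta_powi[OF z])

text \<open>As both values of sn vanish for s, no E_i reaches v_h in the right factor. So all four
  operators act on the left, where E_1 E_2 E_1 E_2 takes the lowest weight vector to a multiple of
  (sn_1 sn_2 - cs_1 cs_2) v_h.\<close>

lemma functional_X12_R12:
  assumes z: "\<zeta>\<^sup>2 = - 1" and "sn \<zeta> (fst t) * sn \<zeta> (snd t) = cs (fst t) * cs (snd t)"
   and "sn \<zeta> (fst s) = 0" "sn \<zeta> (snd s) = 0"
  shows "app (vgen2 \<zeta> t s (GE N1)) (app (vgen2 \<zeta> t s (GE N2)) (app (vgen2 \<zeta> t s (GE N1)) (app (vgen2 \<zeta> t s (GE N2)) v))) (B0, B0) = 0"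
  by (simp add: assms tensor_E_at zeta_powi[OF z] algebra_simps)

lemma functional_R12_X12:
  assumes z: "\<zeta>\<^sup>2 = - 1" and "sn \<zeta> (fst s) * sn \<zeta> (snd s) = cs (fst s) * cs (snd s)"
   and "sn \<zeta> (fst t) = 0" "sn \<zeta> (snd t) = 0"
  shows "app (vgen2 \<zeta> t s (GE N1)) (app (vgen2 \<zeta> t s (GE N2)) (app (vgen2 \<zeta> t s (GE N1)) (app (vgen2 \<zeta> t s (GE N2)) v))) (B0, B0) = 0"
  by (simp add: assms tensor_E_at zeta_powi[OF z] algebra_simps)

section \<open>The hypersurfaces in terms of sn and cs\<close>

lemma sn_cs_relations:
  assumes z: "\<zeta>\<^sup>2 = - 1"
  shows "sn \<zeta> x + \<zeta> * cs x = \<zeta> * inverse x" "sn \<zeta> x - \<zeta> * cs x = - (\<zeta> * x)"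
proof -
  have zz: "\<zeta> * \<zeta> = - 1" "\<zeta> * (\<zeta> * u) = - u" for u
    using z by (simp_all add: power2_eq_square flip: mult.assoc)
  have sn: "sn \<zeta> x = - \<zeta> * (x - inverse x) / 2"
    unfolding sn_def divide_inverse[of "x - inverse x"] inverse_mult_distrib zeta_powi(4)[OF z] by simp
  show "sn \<zeta> x + \<zeta> * cs x = \<zeta> * inverse x" "sn \<zeta> x - \<zeta> * cs x = - (\<zeta> * x)"
    by (simp_all only: sn cs_def) (simp_all add: algebra_simps add_divide_distrib diff_divide_distrib)
qed

lemma sn_eq_0_iff:
  assumes "\<zeta> \<noteq> 0" "x \<noteq> 0"
  shows "sn \<zeta> x = 0 \<longleftrightarrow> x\<^sup>2 = 1"
  using assms by (simp add: sn_def field_simps power2_eq_square)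

lemma sn_eq_0D: "\<zeta> \<noteq> 0 \<Longrightarrow> x \<noteq> 0 \<Longrightarrow> sn \<zeta> x = 0 \<Longrightarrow> inverse x = x \<and> cs x = x"
  by (auto simp: sn_def cs_def)

lemma sn_cs_product_iff:
  assumes z: "\<zeta>\<^sup>2 = - 1" and "x \<noteq> 0" "y \<noteq> 0"
  shows "sn \<zeta> x * sn \<zeta> y = cs x * cs y \<longleftrightarrow> (x * y)\<^sup>2 = - 1"
proof -
  define u v where "u = inverse x" and "v = inverse y"
  have "sn \<zeta> x * sn \<zeta> y = - ((x - u) * (y - v)) / 4"
    using z by (simp add: sn_def power2_eq_square u_def v_def)
  moreover have "cs x * cs y = (x + u) * (y + v) / 4"
    by (simp add: cs_def u_def v_def)
  ultimately have "cs x * cs y - sn \<zeta> x * sn \<zeta> y = (x * y + u * v) / 2"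
    by (simp only:) (simp add: field_simps)
  then have "sn \<zeta> x * sn \<zeta> y = cs x * cs y \<longleftrightarrow> x * y + inverse (x * y) = 0"
    by (auto simp: u_def v_def)
  also have "\<dots> \<longleftrightarrow> (x * y)\<^sup>2 = - 1"
    using assms(2,3) by (simp add: field_simps power2_eq_square eq_neg_iff_add_eq_0)
  finally show ?thesis .
qed

text \<open>On this hypersurface e^2 = 1, so x determines y up to the sign e. Passing from x to y
  exchanges sine and cosine up to this sign.\<close>

lemma X12_parameters:
  assumes z: "\<zeta>\<^sup>2 = - 1" and "x \<noteq> 0" "y \<noteq> 0" and xy: "(x * y)\<^sup>2 = - 1"
  obtains e where "y = e * \<zeta> * inverse x" "inverse y = - e * \<zeta> * x"
    "sn \<zeta> y = e * cs x" "cs y = e * sn \<zeta> x"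
proof -
  define e where "e = - \<zeta> * x * y"
  have zz: "\<zeta> * \<zeta> = - 1" "\<zeta> * (\<zeta> * u) = - u" for u
    using z by (simp_all add: power2_eq_square flip: mult.assoc)
  have "e * \<zeta> * inverse x = - (\<zeta> * \<zeta>) * (x * inverse x) * y"
    unfolding e_def by (simp only: mult_ac mult_minus_left mult_minus_right)
  then have y: "y = e * \<zeta> * inverse x" using assms(2) by (simp add: zz)
  have "y * (- e * \<zeta> * x) = - (x * y)\<^sup>2"
    by (simp add: e_def power2_eq_square zz algebra_simps)
  then have iy: "inverse y = - e * \<zeta> * x" using xy by (intro inverse_unique) simp
  have sn: "sn \<zeta> x = - \<zeta> * (x - inverse x) / 2" for x
    unfolding sn_def divide_inverse[of "x - inverse x"] inverse_mult_distrib zeta_powi(4)[OF z] by simp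
  have "sn \<zeta> y = - \<zeta> * (e * \<zeta> * inverse x - - e * \<zeta> * x) / 2"
    unfolding sn[of y] iy by (simp only: y[symmetric])
  then have 1: "sn \<zeta> y = e * cs x" by (simp add: cs_def zz algebra_simps)
  have "cs y = (e * \<zeta> * inverse x + - e * \<zeta> * x) / 2"
    unfolding cs_def iy by (simp only: y[symmetric])
  then have 2: "cs y = e * sn \<zeta> x" by (simp add: sn algebra_simps)
  show ?thesis using that y iy 1 2 by blast
qed

lemma functional_X12:
  assumes z: "\<zeta>\<^sup>2 = - 1" and t: "t \<in> \<X>12" and s: "s \<in> \<X>12"
  shows "app (vgen2 \<zeta> t s (GF N1)) (app (vgen2 \<zeta> t s (GE N2))
    (app (vgen2 \<zeta> t s (GE N1)) (app (vgen2 \<zeta> t s (GE N2)) v)))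
    (B1 N1, B1 N1) = 0"
proof -
  have zz: "\<zeta> * \<zeta> = - 1" "\<zeta> * (\<zeta> * u) = - u" for u
    using z by (simp_all add: power2_eq_square flip: mult.assoc)
  define p where "p = inverse (fst t)"
  define a c A C where "a = sn \<zeta> (fst t)" and "c = cs (fst t)" and "A = sn \<zeta> (fst s)" and "C = cs (fst s)"
  have t': "fst t \<noteq> 0" "snd t \<noteq> 0" "(fst t * snd t)\<^sup>2 = - 1"
    and s': "fst s \<noteq> 0" "snd s \<noteq> 0" "(fst s * snd s)\<^sup>2 = - 1"
    using t s by (simp_all add: \<X>12_def \<P>_def)
  obtain e where e: "inverse (snd t) = - e * \<zeta> * fst t" "sn \<zeta> (snd t) = e * c" "cs (snd t) = e * a"
    unfolding a_def c_def by (rule X12_parameters[OF z t'])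
  obtain d where d: "sn \<zeta> (snd s) = d * C" "cs (snd s) = d * A"
    unfolding A_def C_def by (rule X12_parameters[OF z s'])
  have a: "a = \<zeta> * p - \<zeta> * c" and A: "A = \<zeta> * C - \<zeta> * fst s"
    using sn_cs_relations(1)[OF z, of "fst t"] sn_cs_relations(2)[OF z, of "fst s"]
    by (simp_all add: a_def c_def A_def C_def p_def algebra_simps)
  let ?g = "vgen2 \<zeta> t s"
  let ?A = "?g (GF N1) * (?g (GE N2) * (?g (GE N1) * ?g (GE N2)))"
  \<comment> \<open>Once \<open>X12_parameters\<close> and the equations \<open>a\<close> and
    \<open>A\<close> have removed the dependent quantities, each of the 64 entries is a polynomial
    identity modulo \<zeta>^2 = -1.\<close>
  have unit: "app ?A (unit_vec (b, b')) (B1 N1, B1 N1) = 0" for b b'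
    by (cases b rule: b8_cases; cases b' rule: b8_cases;
        simp add: unit_vec_def tensor_E_at tensor_F_at zeta_powi[OF z];
        (simp only: e d p_def[symmetric] a_def[symmetric] c_def[symmetric] A_def[symmetric] C_def[symmetric])?;
        (simp only: a A)?; simp add: algebra_simps zz)
  have "app ?A v (B1 N1, B1 N1) = 0"
    unfolding app_expansion[of ?A v] by (rule sum.neutral) (auto simp only: unit split_paired_all mult_zero_right)
  then show ?thesis by simp
qed


section \<open>Cyclic vectors\<close>

lemma csubspaceD:
  assumes "csubspace S"
  shows "0 \<in> S" "f \<in> S \<Longrightarrow> h \<in> S \<Longrightarrow> f + h \<in> S" "f \<in> S \<Longrightarrow> cscale c f \<in> S"
    "f \<in> S \<Longrightarrow> h \<in> S \<Longrightarrow> f - h \<in> S"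
proof -
  note s = assms[unfolded csubspace_def]
  show "0 \<in> S" "f \<in> S \<Longrightarrow> h \<in> S \<Longrightarrow> f + h \<in> S" "f \<in> S \<Longrightarrow> cscale c f \<in> S"
    using s by blast+
  show "f \<in> S \<Longrightarrow> h \<in> S \<Longrightarrow> f - h \<in> S"
    using s csubspace_minus[OF assms, of h] unfolding diff_conv_add_uminus by blast
qed

lemma csubspace_cancel: "csubspace S \<Longrightarrow> c \<noteq> 0 \<Longrightarrow> cscale c f \<in> S \<Longrightarrow> f \<in> S"
  using csubspaceD(3)[of S "cscale c f" "inverse c"] by simp

lemma csubspace_sum: "csubspace S \<Longrightarrow> (\<And>i. i \<in> I \<Longrightarrow> f i \<in> S) \<Longrightarrow> (\<Sum>i\<in>I. f i) \<in> S"
proof (induction I rule: infinite_finite_induct)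
  case (insert x F)
  then show ?case using csubspaceD(2)[of S "f x" "sum f F"] by (simp del: plus_fun_apply)
qed (simp_all add: csubspaceD(1) del: zero_fun_apply)

lemma csubspace_UNIV_iff:
  assumes "csubspace (S :: ('b::finite \<Rightarrow> complex) set)" "\<And>b. unit_vec b \<in> S"
  shows "S = UNIV"
proof -
  have "f \<in> S" for f
    by (subst unit_vec_expansion) (intro csubspace_sum csubspaceD(3) assms)
  then show ?thesis by blast
qed

lemma unit_vec_outer: "unit_vec (b, c) = outer (unit_vec b) (unit_vec c)"
  by (auto simp: fun_eq_iff unit_vec_def outer_def)

lemma outer_zero [simp]: "outer 0 f = 0" "outer f 0 = 0"
  by (auto simp: outer_def fun_eq_iff)

lemma tensor_outer:
  "app (tensor_gen g h (GE i)) (outer f k) =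
    outer (app (g (GE i)) f) (app (h (GK i)) k) + outer f (app (h (GE i)) k)"
  "app (tensor_gen g h (GF i)) (outer f k) =
    outer (app (g (GF i)) f) k + outer (app (g (GKinv i)) f) (app (h (GF i)) k)"
  "app (tensor_gen g h (GK i)) (outer f k) = outer (app (g (GK i)) f) (app (h (GK i)) k)"
proof -
  have l: "app (lft A) (outer f k) = outer (app A f) k" and r: "app (rgt B) (outer f k) = outer f (app B k)" for A B
    using app_outer[of A 1 f k] app_outer[of 1 B f k] by (simp_all add: lft_ring rgt_ring)
  show "app (tensor_gen g h (GE i)) (outer f k) =
      outer (app (g (GE i)) f) (app (h (GK i)) k) + outer f (app (h (GE i)) k)"
    "app (tensor_gen g h (GF i)) (outer f k) =
      outer (app (g (GF i)) f) k + outer (app (g (GKinv i)) f) (app (h (GF i)) k)"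
    "app (tensor_gen g h (GK i)) (outer f k) = outer (app (g (GK i)) f) (app (h (GK i)) k)"
    by (simp_all only: tensor_gen.simps app_endo(3) app_outer l r)
qed

locale verma_pair =
  fixes \<zeta> :: complex and t s :: torus_char
  assumes z: "\<zeta>\<^sup>2 = - 1" and t: "t \<in> \<P>" and s: "s \<in> \<P>"
begin

abbreviation g :: "gen \<Rightarrow> (b8 \<times> b8) endo" where
  "g \<equiv> vgen2 \<zeta> t s"

lemma U_rep_g: "U_rep \<zeta> g"
  by (rule U_rep_tensor[OF z U_rep_vgen[OF z t] U_rep_vgen[OF z s]])

lemma zeta_nonzero: "\<zeta> \<noteq> 0"
  using z by auto

lemma nonzero: "at_node t i \<noteq> 0" "at_node s i \<noteq> 0" "wt \<zeta> i b \<noteq> 0"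
proof -
  show "at_node t i \<noteq> 0" "at_node s i \<noteq> 0" using t s by (cases i; simp add: \<P>_def)+
  show "wt \<zeta> i b \<noteq> 0" using zeta_nonzero by (cases b) simp_all
qed

definition stable :: "(b8 \<times> b8 \<Rightarrow> complex) set \<Rightarrow> bool" where
  "stable S \<longleftrightarrow> csubspace S \<and> (\<forall>f\<in>S. \<forall>i. app (g (GE i)) f \<in> S \<and> app (g (GF i)) f \<in> S)"

lemma stableD:
  assumes "stable S"
  shows "csubspace S" "f \<in> S \<Longrightarrow> app (g (GE i)) f \<in> S" "f \<in> S \<Longrightarrow> app (g (GF i)) f \<in> S"
  using assms by (auto simp: stable_def)

text \<open>The annihilator N of v is a \<open>weight_ideal\<close>, so the submodule generated by v
  is already spanned by the products F^\<psi> E^\<psi>' v.\<close>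

lemma homogeneous_cyclicI:
  assumes v: "v \<noteq> 0" and K: "\<And>i. app (g (GK i)) v = cscale (\<kappa> i) v"
    and gen: "\<And>S. stable S \<Longrightarrow> v \<in> S \<Longrightarrow> S = UNIV"
  shows "homogeneous_cyclic \<zeta> (U_tensor \<zeta> (verma \<zeta> t) (verma \<zeta> s))"
  unfolding verma_tensor_cyclic_iff[OF z t s]
proof (intro exI[of _ v] conjI allI impI v)
  show "\<exists>c. app (g (GK i)) v = cscale c v" for i using K by blast
  fix W
  assume W: "csubspace W \<and> (\<forall>\<psi>\<in>\<Psi>. \<forall>\<psi>'\<in>\<Psi>. app (rep g (F_pow \<zeta> \<psi> * E_pow \<zeta> \<psi>')) v \<in> W)"
  define N where "N = {x. app (rep g x) v = 0}"
  interpret weight_ideal \<zeta> N \<kappa>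
  proof
    show "U_ideal \<zeta> \<subseteq> N" using U_rep_vanishes[OF z U_rep_g] by (auto simp: N_def)
    show "genK i - scal (\<kappa> i) \<in> N" for i by (simp add: N_def K)
    show "\<kappa> i \<noteq> 0" for i
    proof
      assume "\<kappa> i = 0"
      then have "app (g (GKinv i) * g (GK i)) v = 0" using K[of i] by (simp)
      moreover have "g (GKinv i) * g (GK i) = 1" using U_rep_g by (simp add: U_rep_def)
      ultimately show False using v by (simp only: app_endo)
    qed
  qed (simp_all add: N_def z del: plus_fun_apply zero_fun_apply)
  define S where "S = {app (rep g x) v | x. True}"
  have S: "app (rep g x) v \<in> S" for x by (auto simp: S_def)
  have "stable S"
    unfolding stable_def csubspace_def
  proof (intro conjI ballI allI)
    show "0 \<in> S" using S[of 0] by (simp del: zero_fun_apply)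
    fix f assume "f \<in> S"
    then obtain x where x: "f = app (rep g x) v" by (auto simp: S_def)
    show "cscale c f \<in> S" for c using S[of "scal c * x"] by (simp add: x)
    show "app (g (GE i)) f \<in> S" "app (g (GF i)) f \<in> S" for i
      using S[of "genE i * x"] S[of "genF i * x"] by (simp_all add: x)
    fix h assume "h \<in> S"
    then obtain y where y: "h = app (rep g y) v" by (auto simp: S_def)
    show "f + h \<in> S" using S[of "x + y"] by (simp add: x y del: plus_fun_apply)
  qed
  moreover have "v \<in> S" using S[of 1] by simp
  ultimately have "S = UNIV" by (rule gen)
  moreover have "S \<subseteq> W"
  proof
    fix f assume "f \<in> S"
    then obtain x where x: "f = app (rep g x) v" by (auto simp: S_def)
    obtain a where "x - (\<Sum>b\<in>PBW \<zeta>. scal (a b) * b) \<in> N" using spanned_PBW by blast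
    then have "f - app (rep g (\<Sum>b\<in>PBW \<zeta>. scal (a b) * b)) v = 0"
      unfolding N_def mem_Collect_eq x by (simp only: rep_simps app_endo)
    moreover have "app (\<Sum>b\<in>B. A b) v = (\<Sum>b\<in>B. app (A b) v)" for B and A :: "falg \<Rightarrow> (b8 \<times> b8) endo"
      by (induction B rule: infinite_finite_induct) (simp_all del: plus_fun_apply zero_fun_apply)
    ultimately have "f = (\<Sum>b\<in>PBW \<zeta>. cscale (a b) (app (rep g b) v))"
      by (simp only: rep_sum rep_simps app_endo app_sce right_minus_eq)
    also have "\<dots> \<in> W"
      using W by (intro csubspace_sum csubspaceD(3)) (auto simp only: PBW_def)
    finally show "f \<in> W" .
  qed
  ultimately show "W = UNIV" by blast
qed

lemma F_unit_vec_cases: "app (vgen \<zeta> t (GF i)) (unit_vec b) \<in> insert 0 (range unit_vec)"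
  by (cases b) (simp_all add: F_unit_vec)

text \<open>F_i maps b tensor c to F_i b tensor c plus a nonzero multiple of b tensor F_i c. If S
  contains everything over c, it contains the first summand, and thus everything over F_i c.\<close>

lemma fill_left:
  assumes S: "stable S" and top: "\<And>b. outer (unit_vec b) (unit_vec B0) \<in> S"
  shows "S = UNIV"
proof -
  note sub = stableD(1)[OF S]
  have step: "outer (unit_vec b) (unit_vec c') \<in> S"
    if c: "\<And>b. outer (unit_vec b) (unit_vec c) \<in> S" and F: "app (vgen \<zeta> s (GF i)) (unit_vec c) = unit_vec c'" for b c c' i
  proof -
    let ?\<kappa> = "inverse (at_node t i * wt \<zeta> i b)"
    have "outer (app (vgen \<zeta> t (GF i)) (unit_vec b)) (unit_vec c) + cscale ?\<kappa> (outer (unit_vec b) (unit_vec c')) \<in> S"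
      using stableD(3)[OF S c, of i b] by (simp only: tensor_outer app_vgen_unit_vec F outer_simps)
    moreover have "outer (app (vgen \<zeta> t (GF i)) (unit_vec b)) (unit_vec c) \<in> S"
      using F_unit_vec_cases[of i b] c csubspaceD(1)[OF sub] by (auto simp del: zero_fun_apply)
    ultimately have "cscale ?\<kappa> (outer (unit_vec b) (unit_vec c')) \<in> S"
      using csubspaceD(4)[OF sub] by (metis add_diff_cancel_left')
    then show ?thesis by (rule csubspace_cancel[OF sub, rotated]) (simp add: nonzero)
  qed
  have 1: "outer (unit_vec b) (unit_vec (B1 k)) \<in> S" for b k
    by (rule step[OF top F_unit_vec(1)])
  have 2: "outer (unit_vec b) (unit_vec (B2 k)) \<in> S" for b k
    by (rule step[OF 1[of _ "other k"], of k]) (simp add: F_unit_vec)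
  have 3: "outer (unit_vec b) (unit_vec (B3 k)) \<in> S" for b k
    by (rule step[OF 2[of _ "other k"], of k]) (simp add: F_unit_vec)
  have 4: "outer (unit_vec b) (unit_vec B4) \<in> S" for b
    by (rule step[OF 3[of _ N1], of N2]) (simp add: F_unit_vec)
  have "unit_vec (b, c) \<in> S" for b c
    unfolding unit_vec_outer by (cases c) (simp_all only: top 1 2 3 4)
  then show ?thesis by (intro csubspace_UNIV_iff[OF sub]) (simp add: split_paired_all)
qed

text \<open>Mirror image of \<open>fill_left\<close>: here the second summand is the known
  one.\<close>

lemma fill_right:
  assumes S: "stable S" and top: "\<And>c. outer (unit_vec B0) (unit_vec c) \<in> S"
  shows "S = UNIV"
proof -
  note sub = stableD(1)[OF S]
  have F': "app (vgen \<zeta> s (GF i)) (unit_vec c) \<in> insert 0 (range unit_vec)" for i c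
    by (cases c) (simp_all add: F_unit_vec)
  have step: "outer (unit_vec b') (unit_vec c) \<in> S"
    if b: "\<And>c. outer (unit_vec b) (unit_vec c) \<in> S" and F: "app (vgen \<zeta> t (GF i)) (unit_vec b) = unit_vec b'" for b b' c i
  proof -
    let ?\<kappa> = "inverse (at_node t i * wt \<zeta> i b)"
    have "outer (unit_vec b') (unit_vec c) + cscale ?\<kappa> (outer (unit_vec b) (app (vgen \<zeta> s (GF i)) (unit_vec c))) \<in> S"
      using stableD(3)[OF S b, of i c] by (simp only: tensor_outer app_vgen_unit_vec F outer_simps)
    moreover have "outer (unit_vec b) (app (vgen \<zeta> s (GF i)) (unit_vec c)) \<in> S"
      using F'[of i c] b csubspaceD(1)[OF sub] by (auto simp del: zero_fun_apply)
    then have "cscale ?\<kappa> (outer (unit_vec b) (app (vgen \<zeta> s (GF i)) (unit_vec c))) \<in> S"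
      by (rule csubspaceD(3)[OF sub])
    ultimately show ?thesis
      using csubspaceD(4)[OF sub] by (metis add_diff_cancel_right')
  qed
  have 1: "outer (unit_vec (B1 k)) (unit_vec c) \<in> S" for c k
    by (rule step[OF top F_unit_vec(1)])
  have 2: "outer (unit_vec (B2 k)) (unit_vec c) \<in> S" for c k
    by (rule step[OF 1[of "other k"], of k]) (simp add: F_unit_vec)
  have 3: "outer (unit_vec (B3 k)) (unit_vec c) \<in> S" for c k
    by (rule step[OF 2[of "other k"], of k]) (simp add: F_unit_vec)
  have 4: "outer (unit_vec B4) (unit_vec c) \<in> S" for c
    by (rule step[OF 3[of N1], of N2]) (simp add: F_unit_vec)
  have "unit_vec (b, c) \<in> S" for b c
    unfolding unit_vec_outer by (cases b) (simp_all only: top 1 2 3 4)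
  then show ?thesis by (intro csubspace_UNIV_iff[OF sub]) (simp add: split_paired_all)
qed

end

text \<open>On the way up from the lowest weight vector, the only degree of dimension two is (1, 1).
  There E_1 and E_2 provide two vectors with determinant sn_1 sn_2 - cs_1 cs_2.\<close>

lemma E_generated_typical:
  fixes A :: "(b8 \<Rightarrow> complex) set"
  assumes A: "csubspace A" and E: "\<And>i f. f \<in> A \<Longrightarrow> app (vgen \<zeta> t (GE i)) f \<in> A"
    and low: "unit_vec B4 \<in> A" and sn: "\<And>i. sn \<zeta> (at_node t i) \<noteq> 0"
    and X: "sn \<zeta> (fst t) * sn \<zeta> (snd t) \<noteq> cs (fst t) * cs (snd t)"
  shows "unit_vec b \<in> A"
proof -
  note E' = E_unit_vec
  have 3: "unit_vec (B3 k) \<in> A" for k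
    using E[OF low, of "other k"] csubspace_cancel[OF A sn] by (simp add: E')
  have "cscale (sn \<zeta> (fst t)) (unit_vec (B2 N1)) - cscale (cs (fst t)) (unit_vec (B2 N2)) \<in> A" (is "?x \<in> A")
    and "cscale (sn \<zeta> (snd t)) (unit_vec (B2 N2)) - cscale (cs (snd t)) (unit_vec (B2 N1)) \<in> A" (is "?y \<in> A")
    using E[OF 3, of N1 N1] E[OF 3, of N2 N2] by (simp_all add: E')
  note xy = this
  let ?d = "sn \<zeta> (fst t) * sn \<zeta> (snd t) - cs (fst t) * cs (snd t)"
  have d: "?d \<noteq> 0" using X by simp
  \<comment> \<open>Cramer's rule for these two vectors.\<close>
  have "cscale (sn \<zeta> (snd t)) ?x + cscale (cs (fst t)) ?y = cscale ?d (unit_vec (B2 N1))"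
    "cscale (cs (snd t)) ?x + cscale (sn \<zeta> (fst t)) ?y = cscale ?d (unit_vec (B2 N2))"
    by (simp_all add: fun_eq_iff algebra_simps)
  then have "unit_vec (B2 N1) \<in> A" "unit_vec (B2 N2) \<in> A"
    using csubspaceD(2)[OF A csubspaceD(3)[OF A xy(1)] csubspaceD(3)[OF A xy(2)]]
    by (metis csubspace_cancel[OF A d])+
  then have 2: "unit_vec (B2 k) \<in> A" for k by (cases k) simp_all
  have 1: "unit_vec (B1 k) \<in> A" for k
    using E[OF 2[of k], of "other k"] csubspace_cancel[OF A sn] by (simp add: E')
  have 0: "unit_vec B0 \<in> A"
    using E[OF 1[of N1], of N1] csubspace_cancel[OF A sn[of N1]] by (simp add: E')
  show ?thesis by (cases b) (simp_all add: low 0 1 2 3)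
qed

text \<open>With sn_i = 0 the lowest weight vector is annihilated by E_i, so
  \<open>B3 (other i)\<close> is out of its reach and has to be assumed.\<close>

lemma E_generated_atypical:
  fixes A :: "(b8 \<Rightarrow> complex) set"
  assumes A: "csubspace A" and E: "\<And>i f. f \<in> A \<Longrightarrow> app (vgen \<zeta> t (GE i)) f \<in> A"
    and low: "unit_vec B4 \<in> A" "unit_vec (B3 (other i)) \<in> A"
    and sn: "sn \<zeta> (at_node t i) = 0" "sn \<zeta> (at_node t (other i)) \<noteq> 0"
    and cs: "cs (at_node t i) \<noteq> 0" "cs (at_node t (other i)) \<noteq> 0"
  shows "unit_vec b \<in> A"
proof -
  have 3: "unit_vec (B3 i) \<in> A"
    using E[OF low(1), of "other i"] csubspace_cancel[OF A sn(2)] by (simp add: E_unit_vec)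
  have "cscale (- cs (at_node t i)) (unit_vec (B2 (other i))) \<in> A"
    using E[OF 3, of i] by (simp add: E_unit_vec sn(1) cscale_def fun_diff_def zero_fun_def)
  then have 2: "unit_vec (B2 (other i)) \<in> A"
    by (rule csubspace_cancel[OF A, rotated]) (simp add: cs)
  have "cscale (sn \<zeta> (at_node t (other i))) (unit_vec (B2 (other i))) - cscale (cs (at_node t (other i))) (unit_vec (B2 i)) \<in> A"
    using E[OF low(2), of "other i"] by (simp add: E_unit_vec)
  moreover have "f \<in> A" if "h \<in> A" "h - f \<in> A" for f h
    using csubspaceD(4)[OF A that] by (simp only: diff_diff_eq2 add_diff_cancel_left')
  ultimately have "cscale (cs (at_node t (other i))) (unit_vec (B2 i)) \<in> A"
    using csubspaceD(3)[OF A 2] by blast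
  then have b2: "unit_vec (B2 i) \<in> A" by (rule csubspace_cancel[OF A cs(2)])
  have 1: "unit_vec (B1 (other i)) \<in> A"
    using E[OF b2, of i] csubspace_cancel[OF A cs(1)] by (simp add: E_unit_vec)
  have b1: "unit_vec (B1 i) \<in> A"
    using E[OF b2, of "other i"] csubspace_cancel[OF A sn(2)] by (simp add: E_unit_vec)
  have 0: "unit_vec B0 \<in> A"
    using E[OF 1, of "other i"] csubspace_cancel[OF A sn(2)] by (simp add: E_unit_vec)
  have k: "k = i \<or> k = other i" for k using neq_iff_other by blast
  show ?thesis
    using low 0 1 b1 2 b2 3 k by (cases b) metis+
qed

section \<open>Generators outside the locus\<close>

context verma_pair
begin

text \<open>Since E_i v_h = 0, only the summand E_i tensor K_i acts on f tensor v_h, and K_i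
  contributes a nonzero scalar.\<close>

lemma left_E_stable:
  assumes S: "stable S"
  defines "A \<equiv> {f. outer f (unit_vec B0) \<in> S}"
  shows "csubspace A" "f \<in> A \<Longrightarrow> app (vgen \<zeta> t (GE i)) f \<in> A"
proof -
  note sub = stableD(1)[OF S]
  show "csubspace A"
    unfolding csubspace_def A_def mem_Collect_eq outer_simps
    using csubspaceD[OF sub] by (simp del: plus_fun_apply zero_fun_apply)
  assume "f \<in> A"
  then have "cscale (at_node s i * wt \<zeta> i B0) (outer (app (vgen \<zeta> t (GE i)) f) (unit_vec B0)) \<in> S"
    using stableD(2)[OF S, of "outer f (unit_vec B0)" i]
    unfolding A_def mem_Collect_eq tensor_outer app_vgen_unit_vec E_unit_vec outer_zero add_0_right outer_simps by blast
  then show "app (vgen \<zeta> t (GE i)) f \<in> A"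
    unfolding A_def mem_Collect_eq by (rule csubspace_cancel[OF sub, rotated]) (simp add: nonzero)
qed

lemma right_E_stable:
  assumes S: "stable S"
  defines "A \<equiv> {f. outer (unit_vec B0) f \<in> S}"
  shows "csubspace A" "f \<in> A \<Longrightarrow> app (vgen \<zeta> s (GE i)) f \<in> A"
proof -
  note sub = stableD(1)[OF S]
  show "csubspace A"
    unfolding csubspace_def A_def mem_Collect_eq outer_simps
    using csubspaceD[OF sub] by (simp del: plus_fun_apply zero_fun_apply)
  assume "f \<in> A"
  then show "app (vgen \<zeta> s (GE i)) f \<in> A"
    using stableD(2)[OF S, of "outer (unit_vec B0) f" i]
    unfolding A_def mem_Collect_eq tensor_outer E_unit_vec outer_zero add_0_left by blast
qed

lemma weight_unit_vec:
  "app (g (GK i)) (outer (unit_vec b) (unit_vec c)) =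
    cscale (at_node t i * at_node s i * (wt \<zeta> i b * wt \<zeta> i c)) (outer (unit_vec b) (unit_vec c))"
  by (simp add: tensor_outer app_vgen_unit_vec outer_simps mult_ac)

lemma outer_unit_nonzero: "outer (unit_vec b) (unit_vec c) + cscale k (outer (unit_vec b') (unit_vec c')) \<noteq> 0"
  if "b \<noteq> b'"
  using that by (auto simp: fun_eq_iff outer_def unit_vec_def intro!: exI[of _ b] exI[of _ c])

lemma cyclic_typical_left:
  assumes sn: "\<And>i. sn \<zeta> (at_node t i) \<noteq> 0"
    and X: "sn \<zeta> (fst t) * sn \<zeta> (snd t) \<noteq> cs (fst t) * cs (snd t)"
  shows "homogeneous_cyclic \<zeta> (U_tensor \<zeta> (verma \<zeta> t) (verma \<zeta> s))"
proof (rule homogeneous_cyclicI)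
  let ?v = "outer (unit_vec B4) (unit_vec B0)"
  show "?v \<noteq> 0" using outer_unit_nonzero[of B4 B0 B0 0] by simp
  show "app (g (GK i)) ?v = cscale (at_node t i * at_node s i * (wt \<zeta> i B4 * wt \<zeta> i B0)) ?v" for i
    by (rule weight_unit_vec)
  fix S assume S: "stable S" and v: "?v \<in> S"
  show "S = UNIV"
    by (rule fill_left[OF S], rule E_generated_typical[OF left_E_stable[OF S] _ sn X, unfolded mem_Collect_eq])
       (assumption, rule v)
qed

lemma cyclic_typical_right:
  assumes sn: "\<And>i. sn \<zeta> (at_node s i) \<noteq> 0"
    and X: "sn \<zeta> (fst s) * sn \<zeta> (snd s) \<noteq> cs (fst s) * cs (snd s)"
  shows "homogeneous_cyclic \<zeta> (U_tensor \<zeta> (verma \<zeta> t) (verma \<zeta> s))"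
proof (rule homogeneous_cyclicI)
  let ?v = "outer (unit_vec B0) (unit_vec B4)"
  show "?v \<noteq> 0" using outer_unit_nonzero[of B0 B4 B4 0] by simp
  show "app (g (GK i)) ?v = cscale (at_node t i * at_node s i * (wt \<zeta> i B0 * wt \<zeta> i B4)) ?v" for i
    by (rule weight_unit_vec)
  fix S assume S: "stable S" and v: "?v \<in> S"
  show "S = UNIV"
    by (rule fill_right[OF S], rule E_generated_typical[OF right_E_stable[OF S] _ sn X, unfolded mem_Collect_eq])
       (assumption, rule v)
qed

lemma wt_products:
  "wt \<zeta> k (B3 (other i)) * wt \<zeta> k (B1 i) = - 1" "wt \<zeta> k B4 * wt \<zeta> k B0 = - 1"
  using z by (cases i; cases k; simp add: power2_eq_square)+

lemma cyclic_atypical_left: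
  assumes sn: "sn \<zeta> (at_node t i) = 0" "sn \<zeta> (at_node t (other i)) \<noteq> 0"
    and cs: "cs (at_node t i) \<noteq> 0" "cs (at_node t (other i)) \<noteq> 0"
    and s': "sn \<zeta> (at_node s i) \<noteq> 0"
  shows "homogeneous_cyclic \<zeta> (U_tensor \<zeta> (verma \<zeta> t) (verma \<zeta> s))"
proof -
  define \<kappa> where "\<kappa> = inverse (at_node t i * wt \<zeta> i (B3 (other i)))"
  have \<kappa>: "\<kappa> \<noteq> 0" by (simp add: \<kappa>_def nonzero del: wt.simps)
  define x y where "x = outer (unit_vec B4) (unit_vec B0)" and "y = outer (unit_vec (B3 (other i))) (unit_vec (B1 i))"
  define w where "w = outer (unit_vec (B3 (other i))) (unit_vec B0)"
  \<comment> \<open>E_i annihilates x and sends y to a nonzero multiple of w, while F_i w = x +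
    \<kappa> y. Any coefficient of y other than 0 and \<kappa> works: nonzero to reach w, different
    from \<kappa> to separate x from y.\<close>
  let ?v = "x + cscale (2 * \<kappa>) y"
  have E: "app (g (GE i)) ?v = cscale (2 * \<kappa> * sn \<zeta> (at_node s i)) w"
    by (simp only: app_add app_cscale x_def y_def w_def tensor_outer E_unit_vec sn(1) other_simps if_False if_True refl
        cscale_simps outer_zero add_0_left add_0_right outer_simps)
  have F: "app (g (GF i)) w = x + cscale \<kappa> y"
    by (simp only: w_def x_def y_def \<kappa>_def tensor_outer F_unit_vec app_vgen_unit_vec other_simps if_False outer_simps)
  show ?thesis
  proof (rule homogeneous_cyclicI)
    show "?v \<noteq> 0" unfolding x_def y_def by (rule outer_unit_nonzero) simp
    show "app (g (GK k)) ?v = cscale (- (at_node t k * at_node s k)) ?v" for k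
    proof -
      have "app (g (GK k)) x = cscale (- (at_node t k * at_node s k)) x"
        "app (g (GK k)) y = cscale (- (at_node t k * at_node s k)) y"
        unfolding x_def y_def weight_unit_vec wt_products by simp_all
      then show ?thesis by (simp add: app_add app_cscale fun_eq_iff algebra_simps)
    qed
    fix S assume S: "stable S" and v: "?v \<in> S"
    note sub = stableD(1)[OF S]
    have w: "w \<in> S"
      using stableD(2)[OF S v, of i] unfolding E by (rule csubspace_cancel[OF sub, rotated]) (simp add: \<kappa> s')
    have "?v - (x + cscale \<kappa> y) = cscale \<kappa> y" by (simp add: fun_eq_iff algebra_simps)
    then have "cscale \<kappa> y \<in> S"
      using csubspaceD(4)[OF sub v stableD(3)[OF S w, of i]] unfolding F by simp
    from csubspaceD(4)[OF sub stableD(3)[OF S w, of i] this] have x: "x \<in> S"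
      unfolding F by (simp only: add_diff_cancel_right')
    show "S = UNIV"
      by (rule fill_left[OF S], rule E_generated_atypical[OF left_E_stable[OF S] _ _ sn cs, unfolded mem_Collect_eq])
         (assumption, rule x[unfolded x_def], rule w[unfolded w_def])
  qed
qed

lemma cyclic_atypical_right:
  assumes sn: "sn \<zeta> (at_node s i) = 0" "sn \<zeta> (at_node s (other i)) \<noteq> 0"
    and cs: "cs (at_node s i) \<noteq> 0" "cs (at_node s (other i)) \<noteq> 0"
    and t': "sn \<zeta> (at_node t i) \<noteq> 0"
  shows "homogeneous_cyclic \<zeta> (U_tensor \<zeta> (verma \<zeta> t) (verma \<zeta> s))"
proof -
  define \<kappa> where "\<kappa> = inverse (at_node t i * wt \<zeta> i B0)"
  have \<kappa>: "\<kappa> \<noteq> 0" by (simp add: \<kappa>_def nonzero del: wt.simps)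
  define x y where "x = outer (unit_vec B0) (unit_vec B4)" and "y = outer (unit_vec (B1 i)) (unit_vec (B3 (other i)))"
  define w where "w = outer (unit_vec B0) (unit_vec (B3 (other i)))"
  \<comment> \<open>Again E_i annihilates x and sends y to a nonzero multiple of w, but now F_i w =
    y + \<kappa> x, so the coefficient of x only has to differ from \<kappa>.\<close>
  let ?v = "y + cscale (2 * \<kappa>) x"
  let ?c = "at_node s i * wt \<zeta> i (B3 (other i)) * sn \<zeta> (at_node t i)"
  have E: "app (g (GE i)) ?v = cscale ?c w"
    by (simp only: app_add app_cscale x_def y_def w_def tensor_outer E_unit_vec app_vgen_unit_vec sn(1) other_simps
        if_False if_True refl cscale_simps outer_zero add_0_left add_0_right outer_simps)
  have F: "app (g (GF i)) w = y + cscale \<kappa> x"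
    by (simp only: w_def x_def y_def \<kappa>_def tensor_outer F_unit_vec app_vgen_unit_vec other_simps if_False outer_simps)
  show ?thesis
  proof (rule homogeneous_cyclicI)
    show "?v \<noteq> 0" unfolding x_def y_def by (rule outer_unit_nonzero) simp
    show "app (g (GK k)) ?v = cscale (- (at_node t k * at_node s k)) ?v" for k
    proof -
      have "app (g (GK k)) x = cscale (- (at_node t k * at_node s k)) x"
        "app (g (GK k)) y = cscale (- (at_node t k * at_node s k)) y"
        unfolding x_def y_def weight_unit_vec mult.commute[of "wt \<zeta> k B0"] mult.commute[of "wt \<zeta> k (B1 i)"] wt_products
        by simp_all
      then show ?thesis by (simp add: app_add app_cscale fun_eq_iff algebra_simps)
    qed
    fix S assume S: "stable S" and v: "?v \<in> S"
    note sub = stableD(1)[OF S]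
    have w: "w \<in> S"
      using stableD(2)[OF S v, of i] unfolding E
      by (rule csubspace_cancel[OF sub, rotated]) (simp add: nonzero t' del: wt.simps)
    have "?v - (y + cscale \<kappa> x) = cscale \<kappa> x" by (simp add: fun_eq_iff algebra_simps)
    then have "cscale \<kappa> x \<in> S"
      using csubspaceD(4)[OF sub v stableD(3)[OF S w, of i]] unfolding F by simp
    then have x: "x \<in> S" by (rule csubspace_cancel[OF sub \<kappa>])
    show "S = UNIV"
      by (rule fill_right[OF S], rule E_generated_atypical[OF right_E_stable[OF S] _ _ sn cs, unfolded mem_Collect_eq])
         (assumption, rule x[unfolded x_def], rule w[unfolded w_def])
  qed
qed

end


section \<open>Obstructions to cyclicity\<close>

text \<open>The number of factors F_i in the word that the basis vector stands for.\<close>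

fun dg :: "node \<Rightarrow> b8 \<Rightarrow> nat" where
  "dg i B0 = 0"
| "dg i (B1 k) = (if k = i then 1 else 0)"
| "dg i (B2 k) = 1"
| "dg i (B3 k) = (if k = i then 2 else 1)"
| "dg i B4 = 2"

fun depth :: "node \<Rightarrow> b8 \<times> b8 \<Rightarrow> int" where
  "depth i (b, c) = int (dg i b + dg i c)"

text \<open>For \<open>m = 0\<close> this is homogeneity of degree \<open>d\<close>, because \<open>0 dvd x\<close> means \<open>x = 0\<close>.\<close>

definition homog :: "int \<Rightarrow> (node \<Rightarrow> int) \<Rightarrow> (b8 \<times> b8 \<Rightarrow> complex) \<Rightarrow> bool" where
  "homog m d f \<longleftrightarrow> (\<forall>\<beta>. f \<beta> \<noteq> 0 \<longrightarrow> (\<forall>k. m dvd depth k \<beta> - d k))"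

lemma homogD: "homog m d f \<Longrightarrow> f \<beta> \<noteq> 0 \<Longrightarrow> m dvd depth k \<beta> - d k"
  unfolding homog_def by blast

lemma homog_closed:
  "homog m d 0" "homog m d f \<Longrightarrow> homog m d h \<Longrightarrow> homog m d (f + h)" "homog m d f \<Longrightarrow> homog m d (cscale c f)"
  "homog m d f \<Longrightarrow> homog m d (- f)" "homog m d f \<Longrightarrow> homog m d h \<Longrightarrow> homog m d (f - h)"
proof -
  show "homog m d 0" by (simp add: homog_def)
  show p: "homog m d f \<Longrightarrow> homog m d h \<Longrightarrow> homog m d (f + h)" for f h
    unfolding homog_def plus_fun_apply by (metis add_0)
  show c: "homog m d f \<Longrightarrow> homog m d (cscale c f)" for f c
    unfolding homog_def cscale_apply by (metis mult_zero_right)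
  have "- f = cscale (- 1) f" for f :: "b8 \<times> b8 \<Rightarrow> complex" by (simp add: fun_eq_iff)
  then show m: "homog m d f \<Longrightarrow> homog m d (- f)" for f using c by metis
  show "homog m d f \<Longrightarrow> homog m d h \<Longrightarrow> homog m d (f - h)"
    unfolding diff_conv_add_uminus by (intro p m)
qed

lemma E_fun_degree:
  assumes "E_fun a c i f b \<noteq> 0"
  shows "\<exists>b'. f b' \<noteq> 0 \<and> (\<forall>k. dg k b' = dg k b + (if k = i then 1 else 0))"
proof (rule ccontr)
  assume none: "\<not> ?thesis"
  have *: "f b' = 0" if "dg N1 b' = dg N1 b + (if N1 = i then 1 else 0)" "dg N2 b' = dg N2 b + (if N2 = i then 1 else 0)" for b'
  proof -
    have "dg k b' = dg k b + (if k = i then 1 else 0)" for k using that by (cases k) simp_all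
    with none show ?thesis by blast
  qed
  have "E_fun a c i f b = 0"
    by (cases i; cases b rule: b8_cases) (simp_all add: *)
  with assms show False by simp
qed

lemma F_fun_degree:
  assumes "F_fun i f b \<noteq> 0"
  shows "\<exists>b'. f b' \<noteq> 0 \<and> (\<forall>k. dg k b = dg k b' + (if k = i then 1 else 0))"
proof (rule ccontr)
  assume none: "\<not> ?thesis"
  have *: "f b' = 0" if "dg N1 b = dg N1 b' + (if N1 = i then 1 else 0)" "dg N2 b = dg N2 b' + (if N2 = i then 1 else 0)" for b'
  proof -
    have "dg k b = dg k b' + (if k = i then 1 else 0)" for k using that by (cases k) simp_all
    with none show ?thesis by blast
  qed
  have "F_fun i f b = 0"
    by (cases i; cases b rule: b8_cases) (simp_all add: *)
  with assms show False by simp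
qed

lemma power_zeta_eq:
  assumes z: "\<zeta>\<^sup>2 = (- 1 :: complex)" and eq: "\<zeta> ^ a = \<zeta> ^ b"
  shows "(4 :: int) dvd int a - int b"
proof -
  have z4: "\<zeta> ^ 4 = 1" using z by (simp add: power4_eq_xxxx power2_eq_square)
  have m: "\<zeta> ^ n = \<zeta> ^ (n mod 4)" for n
  proof -
    have "\<zeta> ^ n = \<zeta> ^ (4 * (n div 4) + n mod 4)" by simp
    then show ?thesis unfolding power_add power_mult z4 by simp
  qed
  have ne: "\<zeta> \<noteq> 1" "\<zeta> \<noteq> - 1" "\<zeta> \<noteq> 0" "\<zeta> \<noteq> - \<zeta>" using z by auto
  have z3: "\<zeta> ^ 3 = - \<zeta>" using z by (simp add: power3_eq_cube power2_eq_square)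
  have v: "n mod 4 = 0 \<and> \<zeta> ^ n = 1 \<or> n mod 4 = 1 \<and> \<zeta> ^ n = \<zeta> \<or> n mod 4 = 2 \<and> \<zeta> ^ n = - 1 \<or> n mod 4 = 3 \<and> \<zeta> ^ n = - \<zeta>" for n
  proof -
    have "n mod 4 = 0 \<or> n mod 4 = 1 \<or> n mod 4 = 2 \<or> n mod 4 = 3" by presburger
    then show ?thesis using m[of n] z z3 by auto
  qed
  have "a mod 4 = b mod 4"
    using v[of a] v[of b] eq ne by (auto simp: minus_equation_iff[of \<zeta>] equation_minus_iff)
  then show ?thesis by presburger
qed

context verma_pair
begin

lemma homog_E:
  assumes "homog m d f"
  shows "homog m (\<lambda>k. d k - (if k = i then 1 else 0)) (app (g (GE i)) f)"
  unfolding homog_def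
proof (intro allI impI)
  fix \<beta> k assume nz: "app (g (GE i)) f \<beta> \<noteq> 0"
  obtain b c where \<beta>: "\<beta> = (b, c)" by (rule prod.exhaust)
  have "(\<exists>b'. f (b', c) \<noteq> 0 \<and> (\<forall>k. dg k b' = dg k b + (if k = i then 1 else 0))) \<or>
      (\<exists>c'. f (b, c') \<noteq> 0 \<and> (\<forall>k. dg k c' = dg k c + (if k = i then 1 else 0)))"
    using nz unfolding \<beta> tensor_E_at
    using E_fun_degree[of _ _ i "\<lambda>b'. f (b', c)" b] E_fun_degree[of _ _ i "\<lambda>c'. f (b, c')" c]
    by (metis add.right_neutral mult_zero_right)
  then obtain \<beta>' where "f \<beta>' \<noteq> 0" "depth k \<beta>' = depth k \<beta> + (if k = i then 1 else 0)"
    unfolding \<beta> by fastforce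
  then show "m dvd depth k \<beta> - (d k - (if k = i then 1 else 0))"
    using homogD[OF assms, of \<beta>' k] by (simp add: algebra_simps split: if_splits)
qed

lemma homog_F:
  assumes "homog m d f"
  shows "homog m (\<lambda>k. d k + (if k = i then 1 else 0)) (app (g (GF i)) f)"
  unfolding homog_def
proof (intro allI impI)
  fix \<beta> k assume nz: "app (g (GF i)) f \<beta> \<noteq> 0"
  obtain b c where \<beta>: "\<beta> = (b, c)" by (rule prod.exhaust)
  have "(\<exists>b'. f (b', c) \<noteq> 0 \<and> (\<forall>k. dg k b = dg k b' + (if k = i then 1 else 0))) \<or>
      (\<exists>c'. f (b, c') \<noteq> 0 \<and> (\<forall>k. dg k c = dg k c' + (if k = i then 1 else 0)))"
    using nz unfolding \<beta> tensor_F_at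
    using F_fun_degree[of i "\<lambda>b'. f (b', c)" b] F_fun_degree[of i "\<lambda>c'. f (b, c')" c]
    by (metis add.right_neutral mult_zero_right)
  then obtain \<beta>' where "f \<beta>' \<noteq> 0" "depth k \<beta> = depth k \<beta>' + (if k = i then 1 else 0)"
    unfolding \<beta> by fastforce
  then show "m dvd depth k \<beta> - (d k + (if k = i then 1 else 0))"
    using homogD[OF assms, of \<beta>' k] by (simp add: algebra_simps split: if_splits)
qed

text \<open>Quantified over all moduli because each product is used twice: with m = 4 for weights
  and with m = 0 for exact degrees.\<close>

definition shifts :: "(node \<Rightarrow> int) \<Rightarrow> falg \<Rightarrow> bool" where
  "shifts n x \<longleftrightarrow> (\<forall>m d f. homog m d f \<longrightarrow> homog m (\<lambda>k. d k + n k) (app (rep g x) f))"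

lemma shifts_mult: "shifts n x \<Longrightarrow> shifts n' y \<Longrightarrow> shifts (\<lambda>k. n k + n' k) (x * y)"
  unfolding shifts_def by (simp add: add.commute[of "n _"] flip: add.assoc)

lemma shifts_linear:
  "shifts n x \<Longrightarrow> shifts n (- x)" "shifts n x \<Longrightarrow> shifts n y \<Longrightarrow> shifts n (x + y)"
  "shifts n x \<Longrightarrow> shifts n y \<Longrightarrow> shifts n (x - y)" "shifts n x \<Longrightarrow> shifts n (scal c * x)"
  unfolding shifts_def by (simp_all add: homog_closed del: plus_fun_apply)

lemma shifts_one: "shifts (\<lambda>k. 0) 1"
  by (simp add: shifts_def)

lemma shifts_power: "shifts n x \<Longrightarrow> shifts (\<lambda>k. int p * n k) (x ^ p)"
proof (induction p)
  case 0
  then show ?case using shifts_one by simp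
next
  case (Suc p)
  then show ?case using shifts_mult[of n x "\<lambda>k. int p * n k" "x ^ p"] by (simp add: ring_distribs add.commute)
qed

lemma shifts_gen:
  "shifts (\<lambda>k. if k = i then 1 else 0) (genF i)" "shifts (\<lambda>k. - (if k = i then 1 else 0)) (genE i)"
  unfolding shifts_def rep_simps add_uminus_conv_diff by (intro allI impI homog_F homog_E; assumption)+

lemma shifts_F12: "shifts (\<lambda>k. 1) (F12 \<zeta>)"
proof -
  have *: "(\<lambda>k. (if k = N2 then 1 else 0) + (if k = N1 then 1 else 0)) = (\<lambda>k. 1 :: int)"
    "(\<lambda>k. (if k = N1 then 1 else 0) + (if k = N2 then 1 else 0)) = (\<lambda>k. 1 :: int)"
    using node.exhaust by (auto simp: fun_eq_iff)
  have "shifts (\<lambda>k. 1) (genF N2 * genF N1)" "shifts (\<lambda>k. 1) (genF N1 * genF N2)"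
    using shifts_mult[OF shifts_gen(1)[of N2] shifts_gen(1)[of N1]]
      shifts_mult[OF shifts_gen(1)[of N1] shifts_gen(1)[of N2]] unfolding * .
  then show ?thesis unfolding F12_def mult.assoc by (intro shifts_linear)
qed

lemma shifts_E12: "shifts (\<lambda>k. - 1) (E12 \<zeta>)"
proof -
  have *: "(\<lambda>k. - (if k = N2 then 1 else 0) + - (if k = N1 then 1 else 0)) = (\<lambda>k. - 1 :: int)"
    "(\<lambda>k. - (if k = N1 then 1 else 0) + - (if k = N2 then 1 else 0)) = (\<lambda>k. - 1 :: int)"
    using node.exhaust by (auto simp: fun_eq_iff)
  have "shifts (\<lambda>k. - 1) (genE N2 * genE N1)" "shifts (\<lambda>k. - 1) (genE N1 * genE N2)"
    using shifts_mult[OF shifts_gen(2)[of N2] shifts_gen(2)[of N1]]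
      shifts_mult[OF shifts_gen(2)[of N1] shifts_gen(2)[of N2]] unfolding * .
  then show ?thesis unfolding E12_def mult.assoc by (intro shifts_linear)
qed

end

section \<open>Counting ordered products by weight\<close>

fun height :: "nat \<times> nat \<times> nat \<Rightarrow> node \<Rightarrow> int" where
  "height (a, b, c) N1 = int a + int b"
| "height (a, b, c) N2 = int b + int c"

definition Psi_list :: "(nat \<times> nat \<times> nat) list" where
  "Psi_list = [(0,0,0), (0,0,1), (0,1,0), (0,1,1), (1,0,0), (1,0,1), (1,1,0), (1,1,1)]"

lemma set_Psi_list: "set Psi_list = \<Psi>"
  by (auto simp: Psi_list_def \<Psi>_def)

text \<open>An exhaustive evaluation over all 64 pairs. The excluded class (0, 0) contains ten of
  them: the eight with equal entries and the two that combine (0, 1, 0) with (1, 0, 1).\<close>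

lemma weight_count:
  "\<forall>x\<in>set [0, 1, 2, 3]. \<forall>y\<in>set [0, 1, 2, 3]. (x, y) \<noteq> (0, 0) \<longrightarrow>
     length (filter (\<lambda>(\<psi>, \<psi>'). (height \<psi> N1 - height \<psi>' N1) mod 4 = x \<and> (height \<psi> N2 - height \<psi>' N2) mod 4 = y)
       (List.product Psi_list Psi_list)) \<le> 6"
  unfolding Psi_list_def by code_simp

lemma card_weight:
  assumes "\<not> (\<forall>k. 4 dvd d k)"
  shows "card {(\<psi>, \<psi>'). \<psi> \<in> \<Psi> \<and> \<psi>' \<in> \<Psi> \<and> (\<forall>k. 4 dvd d k + height \<psi> k - height \<psi>' k)} \<le> 6"
proof -
  define x y where "x = (- d N1) mod 4" and "y = (- d N2) mod 4"
  let ?L = "filter (\<lambda>(\<psi>, \<psi>'). (height \<psi> N1 - height \<psi>' N1) mod 4 = x \<and> (height \<psi> N2 - height \<psi>' N2) mod 4 = y)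
       (List.product Psi_list Psi_list)"
  have m: "u mod 4 \<in> set [0, 1, 2, 3]" for u :: int
    by (simp, presburger)
  have "(x, y) \<noteq> (0, 0)"
  proof
    assume "(x, y) = (0, 0)"
    then have "4 dvd d N1" "4 dvd d N2" by (simp_all add: x_def y_def dvd_eq_mod_eq_0[symmetric])
    then have "4 dvd d k" for k by (cases k) simp_all
    with assms show False by blast
  qed
  then have "length ?L \<le> 6"
    using weight_count m unfolding x_def y_def by blast
  moreover have "{(\<psi>, \<psi>'). \<psi> \<in> \<Psi> \<and> \<psi>' \<in> \<Psi> \<and> (\<forall>k. 4 dvd d k + height \<psi> k - height \<psi>' k)} \<subseteq> set ?L"
  proof clarify
    fix a b c a' b' c' :: nat
    let ?p = "(a, b, c)" and ?q = "(a', b', c')"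
    assume *: "?p \<in> \<Psi>" "?q \<in> \<Psi>" "\<forall>k. 4 dvd d k + height ?p k - height ?q k"
    have "(u - w) mod 4 = (- e) mod 4" if "4 dvd e + u - w" for u w e :: int
      using that by presburger
    then show "(?p, ?q) \<in> set ?L"
      using * by (simp add: x_def y_def set_Psi_list del: height.simps)
  qed
  ultimately show ?thesis
    by (meson List.finite_set card_length card_mono order_trans)
qed

text \<open>Provides the bound on the size of independent sets for
  \<open>cyclic_degree\<close>.\<close>

interpretation fun_space: vector_space "cscale :: complex \<Rightarrow> ('b \<Rightarrow> complex) \<Rightarrow> 'b \<Rightarrow> complex"
  by standard (auto simp: fun_eq_iff algebra_simps)

lemma csubspace_span: "csubspace (fun_space.span T)"
  unfolding csubspace_def
  using fun_space.span_zero fun_space.span_add fun_space.span_scale by blast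

lemma inj_unit_vec: "inj unit_vec"
  by (rule injI) (auto simp: unit_vec_def fun_eq_iff split: if_splits)

lemma independent_unit_vec:
  assumes "finite B"
  shows "fun_space.independent (unit_vec ` B)"
  unfolding fun_space.dependent_finite[OF finite_imageI[OF assms]]
proof clarify
  fix u b
  assume b: "b \<in> B" "u (unit_vec b) \<noteq> 0" and "(\<Sum>v\<in>unit_vec ` B. cscale (u v) v) = 0"
  then have "(\<Sum>c\<in>B. cscale (u (unit_vec c)) (unit_vec c)) b = 0"
    by (simp add: sum.reindex[OF inj_on_subset[OF inj_unit_vec]])
  moreover have "unit_vec c b = (if b = c then 1 else 0)" for c by (simp add: unit_vec_def)
  then have "(\<Sum>c\<in>B. cscale (u (unit_vec c)) (unit_vec c)) b = (\<Sum>c\<in>B. if c = b then u (unit_vec c) else 0)"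
    unfolding sum_fun_apply by (intro sum.cong) auto
  ultimately show False using b assms by simp
qed

definition middle :: "(b8 \<times> b8) list" where
  "middle = [(B0, B4), (B4, B0), (B1 N1, B3 N2), (B1 N2, B3 N1), (B3 N1, B1 N2), (B3 N2, B1 N1),
     (B2 N1, B2 N1), (B2 N1, B2 N2), (B2 N2, B2 N1), (B2 N2, B2 N2)]"

lemma deg_middle: "\<beta> \<in> set middle \<Longrightarrow> depth k \<beta> = 2"
  by (cases k) (auto simp: middle_def)

section \<open>The degree of a cyclic vector\<close>

context verma_pair
begin

abbreviation pbw :: "nat \<times> nat \<times> nat \<Rightarrow> nat \<times> nat \<times> nat \<Rightarrow> (b8 \<times> b8 \<Rightarrow> complex) \<Rightarrow> b8 \<times> b8 \<Rightarrow> complex" where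
  "pbw \<psi> \<psi>' \<equiv> app (rep g (F_pow \<zeta> \<psi> * E_pow \<zeta> \<psi>'))"

lemma homog_pbw:
  assumes "homog m d v"
  shows "homog m (\<lambda>k. d k + height \<psi> k - height \<psi>' k) (pbw \<psi> \<psi>' v)"
proof -
  obtain a b c where p: "\<psi> = (a, b, c)" by (rule prod_cases3)
  obtain a' b' c' where p': "\<psi>' = (a', b', c')" by (rule prod_cases3)
  note p = p p'
  note sh = shifts_mult[OF
      shifts_mult[OF shifts_mult[OF shifts_power[OF shifts_gen(1)[of N1], of a] shifts_power[OF shifts_F12, of b]]
        shifts_power[OF shifts_gen(1)[of N2], of c]]
      shifts_mult[OF shifts_mult[OF shifts_power[OF shifts_gen(2)[of N1], of a'] shifts_power[OF shifts_E12, of b']]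
        shifts_power[OF shifts_gen(2)[of N2], of c']]]
  have "(\<lambda>k. d k + (int a * (if k = N1 then 1 else 0) + int b * 1 + int c * (if k = N2 then 1 else 0) +
      (int a' * - (if k = N1 then 1 else 0) + int b' * - 1 + int c' * - (if k = N2 then 1 else 0)))) =
      (\<lambda>k. d k + height \<psi> k - height \<psi>' k)"
  proof
    fix k show "d k + (int a * (if k = N1 then 1 else 0) + int b * 1 + int c * (if k = N2 then 1 else 0) +
      (int a' * - (if k = N1 then 1 else 0) + int b' * - 1 + int c' * - (if k = N2 then 1 else 0))) =
      d k + height \<psi> k - height \<psi>' k"
      by (cases k) (simp_all add: p)
  qed
  with sh[unfolded shifts_def, rule_format, OF assms] show ?thesis
    unfolding p F_pow.simps E_pow.simps by simp
qed

text \<open>Up to a factor depending only on t and s, the eigenvalue of K_i is \<zeta> to the power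
  2 d_i + d_j. The matrix with rows (2, 1) and (1, 2) has determinant 3, a unit modulo 4, so the
  weight determines the degree modulo 4.\<close>

lemma weight_homog:
  assumes K: "\<And>i. \<exists>c. app (g (GK i)) v = cscale c v" and \<beta>: "v \<beta> \<noteq> 0"
  shows "homog 4 (\<lambda>k. depth k \<beta>) v"
  unfolding homog_def
proof (intro allI impI)
  fix \<beta>' k assume \<beta>': "v \<beta>' \<noteq> 0"
  obtain b c b' c' where bc: "\<beta> = (b, c)" "\<beta>' = (b', c')" by (metis prod.exhaust)
  have w: "wt \<zeta> i b = \<zeta> ^ (2 * dg i b + dg (other i) b)" for i b
  proof -
    have "\<zeta> ^ 3 = - \<zeta>" "\<zeta> ^ 5 = \<zeta>" "\<zeta> ^ 4 = 1" "\<zeta> ^ 6 = - 1"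
      using z by (simp_all add: power2_eq_square numeral_eq_Suc)
    then show ?thesis using z by (cases i; cases b rule: b8_cases) (simp_all add: numeral_eq_Suc)
  qed
  have dvd: "4 dvd (2 * depth i \<beta>' + depth (other i) \<beta>') - (2 * depth i \<beta> + depth (other i) \<beta>)" for i
  proof -
    obtain e where e: "app (g (GK i)) v = cscale e v" using K by blast
    have at: "app (g (GK i)) v (x, y) = at_node t i * at_node s i * (wt \<zeta> i x * wt \<zeta> i y) * v (x, y)" for x y
      by (simp add: tensor_gen.simps app_vgen)
    have cancel: "p = e" if "e * w = p * w" "w \<noteq> 0" for p w :: complex using that by simp
    have "at_node t i * at_node s i * (wt \<zeta> i b * wt \<zeta> i c) = e"
      using at[of b c] \<beta> unfolding e bc cscale_apply by (rule cancel)
    moreover have "at_node t i * at_node s i * (wt \<zeta> i b' * wt \<zeta> i c') = e"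
      using at[of b' c'] \<beta>' unfolding e bc cscale_apply by (rule cancel)
    ultimately have "wt \<zeta> i b' * wt \<zeta> i c' = wt \<zeta> i b * wt \<zeta> i c"
      using nonzero(1,2)[of i] by (metis mult_cancel_left mult_eq_0_iff)
    then have "\<zeta> ^ (2 * dg i b' + dg (other i) b' + (2 * dg i c' + dg (other i) c')) =
        \<zeta> ^ (2 * dg i b + dg (other i) b + (2 * dg i c + dg (other i) c))"
      unfolding w power_add .
    from power_zeta_eq[OF z this] show ?thesis by (simp add: bc algebra_simps)
  qed
  have "4 dvd x' - x" "4 dvd y' - y"
    if "4 dvd (2 * x' + y') - (2 * x + y)" "4 dvd (2 * y' + x') - (2 * y + x)" for x x' y y' :: int
    using that by presburger+
  from this[OF dvd[of N1, unfolded other.simps] dvd[of N2, unfolded other.simps]]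
  show "4 dvd depth k \<beta>' - depth k \<beta>" by (cases k) simp_all
qed

text \<open>The weight space spanned by \<open>middle\<close> has dimension 10, and from a vector of any other weight
  too few of the operators \<open>F\<^sup>\<psi> E\<^sup>\<psi>'\<close> lead into it.\<close>

lemma cyclic_degree:
  assumes v: "homog 4 d v"
    and span: "\<And>W. csubspace W \<Longrightarrow> (\<And>\<psi> \<psi>'. \<psi> \<in> \<Psi> \<Longrightarrow> \<psi>' \<in> \<Psi> \<Longrightarrow> pbw \<psi> \<psi>' v \<in> W) \<Longrightarrow> W = UNIV"
  shows "4 dvd d k - 2"
proof (rule ccontr)
  assume "\<not> 4 dvd d k - 2"
  then have "\<not> (\<forall>k. 4 dvd d k - 2)" by blast
  note card = card_weight[OF this]
  define P where "P = {(\<psi>, \<psi>'). \<psi> \<in> \<Psi> \<and> \<psi>' \<in> \<Psi> \<and> (\<forall>k. 4 dvd d k - 2 + height \<psi> k - height \<psi>' k)}"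
  have "P \<subseteq> \<Psi> \<times> \<Psi>" by (auto simp: P_def)
  then have finP: "finite P" by (rule finite_subset) (simp add: set_Psi_list[symmetric])
  \<comment> \<open>Projection onto the span of \<open>middle\<close>. Products outside P have no
    component there, so the images of those in P would have to span ten dimensions.\<close>
  define r where "r f = (\<lambda>\<beta>. if \<beta> \<in> set middle then f \<beta> else 0)" for f :: "b8 \<times> b8 \<Rightarrow> complex"
  have r: "r (f + h) = r f + r h" "r (cscale c f) = cscale c (r f)" "r 0 = 0" for f h c
    by (auto simp: r_def fun_eq_iff)
  define T where "T = (\<lambda>(\<psi>, \<psi>'). r (pbw \<psi> \<psi>' v)) ` P"
  have finT: "finite T" using finP by (simp add: T_def)
  have all: "{f. r f \<in> fun_space.span T} = UNIV"
  proof (rule span)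
    show "csubspace {f. r f \<in> fun_space.span T}"
      using csubspace_span[of T] unfolding csubspace_def mem_Collect_eq r by blast
    fix \<psi> \<psi>' assume \<psi>: "\<psi> \<in> \<Psi>" "\<psi>' \<in> \<Psi>"
    show "pbw \<psi> \<psi>' v \<in> {f. r f \<in> fun_space.span T}"
    proof (cases "(\<psi>, \<psi>') \<in> P")
      case True
      then have "r (pbw \<psi> \<psi>' v) \<in> T" unfolding T_def by force
      then show ?thesis by (simp add: fun_space.span_base)
    next
      case False
      have "pbw \<psi> \<psi>' v \<beta> = 0" if \<beta>: "\<beta> \<in> set middle" for \<beta>
      proof (rule ccontr)
        assume "pbw \<psi> \<psi>' v \<beta> \<noteq> 0"
        then have "4 dvd 2 - (d k + height \<psi> k - height \<psi>' k)" for k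
          using homogD[OF homog_pbw[OF v]] deg_middle[OF \<beta>] by metis
        then have "4 dvd d k - 2 + height \<psi> k - height \<psi>' k" for k
          by (metis (no_types, opaque_lifting) add_diff_eq diff_add_eq diff_diff_eq2 dvd_diff_commute)
        with False \<psi> show False by (simp add: P_def)
      qed
      then have "r (pbw \<psi> \<psi>' v) = 0" by (auto simp: r_def fun_eq_iff)
      then show ?thesis by (simp only: mem_Collect_eq fun_space.span_zero)
    qed
  qed
  have "unit_vec ` set middle \<subseteq> fun_space.span T"
  proof (rule image_subsetI)
    fix \<beta> assume "\<beta> \<in> set middle"
    then have "r (unit_vec \<beta>) = unit_vec \<beta>" by (auto simp: r_def fun_eq_iff unit_vec_def)
    moreover have "r (unit_vec \<beta>) \<in> fun_space.span T" using all by blast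
    ultimately show "unit_vec \<beta> \<in> fun_space.span T" by simp
  qed
  then have "card (unit_vec ` set middle) \<le> card T"
    using fun_space.independent_span_bound[OF finT independent_unit_vec[OF finite_set]] by blast
  also have "\<dots> \<le> card P" unfolding T_def by (rule card_image_le[OF finP])
  also have "\<dots> \<le> 6" using card unfolding P_def .
  finally have "card (set middle) \<le> 6" by (simp add: card_image[OF inj_on_subset[OF inj_unit_vec]])
  then show False by (simp add: middle_def)
qed

text \<open>Products of any other degree vanish at \<beta> anyway, once v is known to have degree
  (2, 2). So all F^\<psi> E^\<psi>' v lie in the hyperplane of functions vanishing at
  \<beta>.\<close>

lemma not_cyclicI:
  assumes van: "\<And>v \<psi> \<psi>'. \<psi> \<in> \<Psi> \<Longrightarrow> \<psi>' \<in> \<Psi> \<Longrightarrow> (\<And>k. depth k \<beta> = 2 + height \<psi> k - height \<psi>' k) \<Longrightarrow> pbw \<psi> \<psi>' v \<beta> = 0"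
  shows "\<not> homogeneous_cyclic \<zeta> (U_tensor \<zeta> (verma \<zeta> t) (verma \<zeta> s))"
  unfolding verma_tensor_cyclic_iff[OF z t s]
proof clarify
  fix v assume "v \<noteq> 0" and K: "\<forall>i. \<exists>c. app (g (GK i)) v = cscale c v"
    and span: "\<forall>W. csubspace W \<and> (\<forall>\<psi>\<in>\<Psi>. \<forall>\<psi>'\<in>\<Psi>. pbw \<psi> \<psi>' v \<in> W) \<longrightarrow> W = UNIV"
  from \<open>v \<noteq> 0\<close> obtain \<beta>\<^sub>0 where \<beta>\<^sub>0: "v \<beta>\<^sub>0 \<noteq> 0" by (auto simp: fun_eq_iff)
  have h: "homog 4 (\<lambda>k. depth k \<beta>\<^sub>0) v" using K \<beta>\<^sub>0 by (intro weight_homog) auto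
  have two: "4 dvd depth k \<beta>\<^sub>0 - 2" for k by (rule cyclic_degree[OF h]) (use span in blast)
  have "homog 0 (\<lambda>k. 2) v"
    unfolding homog_def
  proof (intro allI impI)
    fix \<beta>' k assume "v \<beta>' \<noteq> 0"
    then have "4 dvd depth k \<beta>' - 2" using homogD[OF h, of \<beta>' k] two[of k] by presburger
    moreover have "dg k b \<le> 2" for b by (cases b) simp_all
    then have "0 \<le> depth k \<beta>'" "depth k \<beta>' \<le> 4" by (cases \<beta>'; simp add: add_mono[of _ 2 _ 2, simplified])+
    \<comment> \<open>Between 0 and 4 only 2 is congruent to 2 modulo 4; this turns the weight into
      an exact degree.\<close>
    ultimately have "depth k \<beta>' = 2" by presburger
    then show "0 dvd depth k \<beta>' - 2" by simp
  qed
  note h0 = homog_pbw[OF this]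
  have "pbw \<psi> \<psi>' v \<beta> = 0" if "\<psi> \<in> \<Psi>" "\<psi>' \<in> \<Psi>" for \<psi> \<psi>'
  proof (rule ccontr)
    assume nz: "pbw \<psi> \<psi>' v \<beta> \<noteq> 0"
    then have "depth k \<beta> = 2 + height \<psi> k - height \<psi>' k" for k using homogD[OF h0 nz] by simp
    with van[OF that] nz show False by blast
  qed
  moreover have "csubspace {f. f \<beta> = 0}" by (simp add: csubspace_def)
  ultimately have "{f :: b8 \<times> b8 \<Rightarrow> complex. f \<beta> = 0} = UNIV"
    using span[rule_format, of "{f. f \<beta> = 0}"] by blast
  then have "unit_vec \<beta> \<beta> = 0" by blast
  then show False by (simp add: unit_vec_def)
qed

section \<open>The components of the locus\<close>

lemma X_not_cyclic:
  assumes sn: "sn \<zeta> (at_node t i) = 0" "sn \<zeta> (at_node s i) = 0"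
  shows "\<not> homogeneous_cyclic \<zeta> (U_tensor \<zeta> (verma \<zeta> t) (verma \<zeta> s))"
proof (rule not_cyclicI[of "(B3 (other i), B3 (other i))"])
  fix v \<psi> \<psi>'
  assume \<psi>: "\<psi> \<in> \<Psi>" "\<psi>' \<in> \<Psi>"
    and deg: "\<And>k. depth k (B3 (other i), B3 (other i)) = 2 + height \<psi> k - height \<psi>' k"
  obtain a b c where p: "\<psi> = (a, b, c)" by (rule prod_cases3)
  obtain a' b' c' where p': "\<psi>' = (a', b', c')" by (rule prod_cases3)
  note p = p p'
  note \<psi> = \<psi>[unfolded p Psi_mem]
  have F0: "g (GF k) * g (GF k) = 0" for k using U_rep_g by (simp add: U_rep_def)
  have F0': "app (g (GF k)) (app (g (GF k)) f) = 0" for k f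
    using F0[of k] by (metis app_endo(1,6))
  have fun0: "app (g (GF (other i))) (app (g (GF i)) (app (g (GF (other i))) (app (g (GE i)) v)))
      (B3 (other i), B3 (other i)) = 0"
    using functional_X[OF z sn, of v] sn_eq_0D[OF zeta_nonzero nonzero(1) sn(1)]
      sn_eq_0D[OF zeta_nonzero nonzero(2) sn(2)] by blast
  show "pbw \<psi> \<psi>' v (B3 (other i), B3 (other i)) = 0"
  proof (cases i)
    case N1
    \<comment> \<open>The degrees differ by 0 at i and by 2 at the other node, which leaves one
      product; as F_2^2 = 0, its factor \<open>F12\<close> F_2 is -F_2 F_1 F_2.\<close>
    then have "a = 0" "b = 1" "c = 1" "a' = 1" "b' = 0" "c' = 0"
      using deg[of N1] deg[of N2] \<psi> by (auto simp: p)
    then show ?thesis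
      using fun0 N1 by (simp add: p F12_def F0' app_diff)
  next
    case N2
    then have "a = 1" "b = 1" "c = 0" "a' = 0" "b' = 0" "c' = 1"
      using deg[of N1] deg[of N2] \<psi> by (auto simp: p)
    then show ?thesis
      using fun0 N2 by (simp add: p F12_def F0' app_diff app_minus app_cscale)
  qed
qed

lemma E_squares: "app (g (GE k)) (app (g (GE k)) f) = 0"
proof -
  have "g (GE k) * g (GE k) = 0" using U_rep_g by (simp add: U_rep_def)
  then show ?thesis by (metis app_endo(1,6))
qed

lemma X12_not_cyclic:
  assumes "t \<in> \<X>12" "s \<in> \<X>12"
  shows "\<not> homogeneous_cyclic \<zeta> (U_tensor \<zeta> (verma \<zeta> t) (verma \<zeta> s))"
proof (rule not_cyclicI[of "(B1 N1, B1 N1)"])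
  fix v \<psi> \<psi>'
  assume \<psi>: "\<psi> \<in> \<Psi>" "\<psi>' \<in> \<Psi>" and deg: "\<And>k. depth k (B1 N1, B1 N1) = 2 + height \<psi> k - height \<psi>' k"
  obtain a b c where p: "\<psi> = (a, b, c)" by (rule prod_cases3)
  obtain a' b' c' where p': "\<psi>' = (a', b', c')" by (rule prod_cases3)
  note p = p p'
  note \<psi> = \<psi>[unfolded p Psi_mem]
  \<comment> \<open>From degree (2, 2) to (2, 0) only F_1 \<open>E12\<close> E_2 leads, which equals
    -\<zeta> F_1 E_2 E_1 E_2.\<close>
  have "a = 1" "b = 0" "c = 0" "a' = 0" "b' = 1" "c' = 1"
    using deg[of N1] deg[of N2] \<psi> by (auto simp: p)
  then show "pbw \<psi> \<psi>' v (B1 N1, B1 N1) = 0"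
    using functional_X12[OF z assms, of v] by (simp add: p E12_def E_squares app_minus app_cscale)
qed

text \<open>From degree (2, 2) up to v_h tensor v_h only E_1 \<open>E12\<close> E_2 leads, a
  multiple of E_1 E_2 E_1 E_2.\<close>

lemma top_not_cyclic:
  assumes "\<And>v. app (g (GE N1)) (app (g (GE N2)) (app (g (GE N1)) (app (g (GE N2)) v))) (B0, B0) = 0"
  shows "\<not> homogeneous_cyclic \<zeta> (U_tensor \<zeta> (verma \<zeta> t) (verma \<zeta> s))"
proof (rule not_cyclicI[of "(B0, B0)"])
  fix v \<psi> \<psi>'
  assume \<psi>: "\<psi> \<in> \<Psi>" "\<psi>' \<in> \<Psi>" and deg: "\<And>k. depth k (B0, B0) = 2 + height \<psi> k - height \<psi>' k"
  obtain a b c where p: "\<psi> = (a, b, c)" by (rule prod_cases3)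
  obtain a' b' c' where p': "\<psi>' = (a', b', c')" by (rule prod_cases3)
  note p = p p'
  note \<psi> = \<psi>[unfolded p Psi_mem]
  have "a = 0" "b = 0" "c = 0" "a' = 1" "b' = 1" "c' = 1"
    using deg[of N1] deg[of N2] \<psi> by (auto simp: p)
  then show "pbw \<psi> \<psi>' v (B0, B0) = 0"
    using assms[of v] by (simp add: p E12_def E_squares app_minus app_cscale)
qed

lemma X_iff:
  assumes r: "r \<in> \<P>"
  shows "r \<in> \<X>1 \<longleftrightarrow> sn \<zeta> (at_node r N1) = 0" "r \<in> \<X>2 \<longleftrightarrow> sn \<zeta> (at_node r N2) = 0"
    "r \<in> \<X>12 \<longleftrightarrow> sn \<zeta> (fst r) * sn \<zeta> (snd r) = cs (fst r) * cs (snd r)"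
proof -
  have nz: "fst r \<noteq> 0" "snd r \<noteq> 0" using r by (auto simp: \<P>_def)
  note sn_eq_0_iff[OF zeta_nonzero nz(1)] sn_eq_0_iff[OF zeta_nonzero nz(2)] sn_cs_product_iff[OF z nz]
  then show "r \<in> \<X>1 \<longleftrightarrow> sn \<zeta> (at_node r N1) = 0" "r \<in> \<X>2 \<longleftrightarrow> sn \<zeta> (at_node r N2) = 0"
    "r \<in> \<X>12 \<longleftrightarrow> sn \<zeta> (fst r) * sn \<zeta> (snd r) = cs (fst r) * cs (snd r)"
    using r by (simp_all add: \<X>1_def \<X>2_def \<X>12_def)
qed

lemmas membership = X_iff[OF t] X_iff[OF s]

lemma cyclic_iff:
  "homogeneous_cyclic \<zeta> (U_tensor \<zeta> (verma \<zeta> t) (verma \<zeta> s)) \<longleftrightarrow>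
    (t, s) \<notin> \<X>1 \<times> \<X>1 \<union> \<X>2 \<times> \<X>2 \<union> \<X>12 \<times> \<X>12 \<union> \<X>12 \<times> \<R>12 \<union> \<R>12 \<times> \<X>12"
  (is "?C \<longleftrightarrow> _ \<notin> ?A")
proof
  assume ?C
  have 1: "\<not> (t \<in> \<X>1 \<and> s \<in> \<X>1)" "\<not> (t \<in> \<X>2 \<and> s \<in> \<X>2)"
    using X_not_cyclic[of N1] X_not_cyclic[of N2] \<open>?C\<close> unfolding membership by blast+
  have 2: "\<not> (t \<in> \<X>12 \<and> s \<in> \<X>12)" using X12_not_cyclic \<open>?C\<close> by blast
  have 3: "\<not> (t \<in> \<X>12 \<and> s \<in> \<X>1 \<and> s \<in> \<X>2)"
    using top_not_cyclic[OF functional_X12_R12[OF z]] \<open>?C\<close> unfolding membership at_node.simps by blast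
  have 4: "\<not> (t \<in> \<X>1 \<and> t \<in> \<X>2 \<and> s \<in> \<X>12)"
    using top_not_cyclic[OF functional_R12_X12[OF z]] \<open>?C\<close> unfolding membership at_node.simps by blast
  show "(t, s) \<notin> ?A" using 1 2 3 4 by (auto simp: \<R>12_def)
next
  assume A: "(t, s) \<notin> ?A"
  \<comment> \<open>On the intersection of the first two sets the product of the coordinates has
    square 1, not -1.\<close>
  have excl: "\<not> (r \<in> \<X>1 \<and> r \<in> \<X>2 \<and> r \<in> \<X>12)" for r
    by (auto simp: \<X>1_def \<X>2_def \<X>12_def power_mult_distrib)
  have left: ?C if "t \<in> \<X>1 \<and> t \<notin> \<X>2 \<and> s \<notin> \<X>1 \<or> t \<in> \<X>2 \<and> t \<notin> \<X>1 \<and> s \<notin> \<X>2" "t \<notin> \<X>12"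
    using that(1)
  proof
    assume *: "t \<in> \<X>1 \<and> t \<notin> \<X>2 \<and> s \<notin> \<X>1"
    \<comment> \<open>As sn_1 = 0 for t, being outside \<open>\<X>12\<close> says that cs_1 cs_2 is
      nonzero.\<close>
    then show ?C
      using that(2) by (intro cyclic_atypical_left[of N1]) (auto simp: membership)
  next
    assume *: "t \<in> \<X>2 \<and> t \<notin> \<X>1 \<and> s \<notin> \<X>2"
    then show ?C
      using that(2) by (intro cyclic_atypical_left[of N2]) (auto simp: membership)
  qed
  have right: ?C if "s \<in> \<X>1 \<and> s \<notin> \<X>2 \<and> t \<notin> \<X>1 \<or> s \<in> \<X>2 \<and> s \<notin> \<X>1 \<and> t \<notin> \<X>2" "s \<notin> \<X>12"
    using that(1)
  proof
    assume *: "s \<in> \<X>1 \<and> s \<notin> \<X>2 \<and> t \<notin> \<X>1"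
    then show ?C
      using that(2) by (intro cyclic_atypical_right[of N1]) (auto simp: membership)
  next
    assume *: "s \<in> \<X>2 \<and> s \<notin> \<X>1 \<and> t \<notin> \<X>2"
    then show ?C
      using that(2) by (intro cyclic_atypical_right[of N2]) (auto simp: membership)
  qed
  have typical: ?C if "t \<notin> \<X>1" "t \<notin> \<X>2" "t \<notin> \<X>12"
  proof (rule cyclic_typical_left)
    show "sn \<zeta> (at_node t i) \<noteq> 0" for i using that by (cases i) (auto simp: membership)
  qed (use that in \<open>simp add: membership\<close>)
  have typical': ?C if "s \<notin> \<X>1" "s \<notin> \<X>2" "s \<notin> \<X>12"
  proof (rule cyclic_typical_right)
    show "sn \<zeta> (at_node s i) \<noteq> 0" for i using that by (cases i) (auto simp: membership)
  qed (use that in \<open>simp add: membership\<close>)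
  have "\<not> (t \<in> \<X>1 \<and> s \<in> \<X>1)" "\<not> (t \<in> \<X>2 \<and> s \<in> \<X>2)" "\<not> (t \<in> \<X>12 \<and> s \<in> \<X>12)"
    "\<not> (t \<in> \<X>12 \<and> s \<in> \<X>1 \<and> s \<in> \<X>2)" "\<not> (t \<in> \<X>1 \<and> t \<in> \<X>2 \<and> s \<in> \<X>12)"
    using A excl[of t] excl[of s] by (auto simp: \<R>12_def)
  \<comment> \<open>If neither factor is typical, the excluded combinations leave one factor that
    lies on \<open>\<X>1\<close> or \<open>\<X>2\<close> and on no other of the three sets, while
    the other factor is off that set.\<close>
  then show ?C
    using left right typical typical' excl[of t] excl[of s] by blast
qed

end

theorem theorem1p6:
  fixes \<zeta> :: complex
  assumes "primitive_root_of_unity 4 \<zeta>"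
  shows "acyclicity_locus \<zeta> =
    \<X>1 \<times> \<X>1 \<union> \<X>2 \<times> \<X>2 \<union> \<X>12 \<times> \<X>12 \<union> \<X>12 \<times> \<R>12 \<union> \<R>12 \<times> \<X>12"
proof -
  note z = primitive_4_square[OF assms]
  have "(t, s) \<in> acyclicity_locus \<zeta> \<longleftrightarrow>
    (t, s) \<in> \<X>1 \<times> \<X>1 \<union> \<X>2 \<times> \<X>2 \<union> \<X>12 \<times> \<X>12 \<union> \<X>12 \<times> \<R>12 \<union> \<R>12 \<times> \<X>12" for t s
  proof (cases "t \<in> \<P> \<and> s \<in> \<P>")
    case True
    then interpret verma_pair \<zeta> t s by unfold_locales (use z in auto)
    show ?thesis using True cyclic_iff by (simp add: acyclicity_locus_def)
  next
    case False
    then show ?thesis by (auto simp: acyclicity_locus_def \<X>1_def \<X>2_def \<X>12_def \<R>12_def)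
  qed
  then show ?thesis by (intro equalityI subsetI; metis prod.exhaust)
qed

end
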